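(* Let $\rho$ be the pseudo-max distance: for columns of $\mathbf X^\dagger$ (and likewise of $\mathbf H^\dagger$), $\rho(\mathbf X^\dagger_{\cdot i},\mathbf X^\dagger_{\cdot j})=\max_{\ell\ne i,j}\big|\frac1{p^\dagger}(\mathbf X^\dagger_{\cdot i}-\mathbf X^\dagger_{\cdot j})'\mathbf X^\dagger_{\cdot\ell}\big|$. Assume the setup and Assumption 1 below, and: (i) for every $\varepsilon>0$, $\lim_{\Delta\to0}\limsup_{n,p^\dagger\to\infty}\mathbb P\big\{\max_{i\in[n]}\max_{j:\rho(\mathbf H^\dagger_{\cdot i},\mathbf H^\dagger_{\cdot j})<\Delta}\|\boldsymbol\alpha_i-\boldsymbol\alpha_j\|>\varepsilon\big\}=0$; (ii) for some $\underline c>0$, $\lim_{n,p^\dagger\to\infty}\mathbb P\big\{\min_{i\in[n]}s_{\min}\big(\frac1{p^\dagger}\nabla\boldsymbol\eta^\dagger(\boldsymbol\alpha_i)'\nabla\boldsymbol\eta^\dagger(\boldsymbol\alpha_i)\big)\ge\underline c\big\}=1$; (iii) for some $\underline c'>0$, $\lim_{n,p^\dagger\to\infty}\mathbb P\big\{\min_{\ell\in[r]}\min_{i\in[n]}\sup_{\boldsymbol\alpha\in\mathcal A}\frac1{p^\dagger}\|\mathscr P_{\boldsymbol\alpha_i,\ell}[\boldsymbol\eta^\dagger(\boldsymbol\alpha)]\|^2\ge\underline c'\big\}=1$. If $n^{4/\nu}(\log n)^{(\nu-2)/\nu}/p\lesssim1$, then Assumption 2 holds with $a_n=((\log n)/p)^{1/2}$,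 $\rho_0=0$, $\underline\varsigma=\bar\varsigma=1$.
   Context: Setup: data form a $p\times n$ matrix $\mathbf X=\mathbf H+\mathbf U$ whose $i$th column is $\mathbf x_i=\boldsymbol\eta(\boldsymbol\alpha_i)+\mathbf u_i$, $i=1,\dots,n$, with entries $x_{il}$, where $\boldsymbol\alpha_i\in\mathbb R^r$ ($r$ fixed) are unobserved latent variables, $\boldsymbol\eta=(\eta_1,\dots,\eta_p)':\mathbb R^r\to\mathbb R^p$ are unobserved latent functions, $\mathbf H$ has $i$th column $\boldsymbol\eta(\boldsymbol\alpha_i)$, $\mathbf U$ has $i$th column $\mathbf u_i=(u_{i1},\dots,u_{ip})'$, and $\mathbb E[\mathbf u_i\mid\mathscr F]=0$, where $\mathscr F$ is the $\sigma$-field generated by $(\boldsymbol\alpha_i)_{i\le n}$ and $\boldsymbol\eta(\cdot)$. Asymptotics are as $n,p\to\infty$. Assumption 1: (a) $(\boldsymbol\alpha_i)_{i\le n}$ are i.i.d. with compact convex support $\mathcal A\subset\mathbb R^r$ and a density bounded and bounded away from zero on $\mathcal A$; (b) each $\eta_l$ is $\bar m$ times continuously differentiable for some $\bar m\ge 2$, with all partial derivatives of order at most $\bar m$ bounded by a constant not depending on $l$; (c) the $u_{il}$ are independent across $i$ and $l$ conditional on $\mathscr F$, and for some $\nu>0$, $\max_{i,l}\mathbb E[|u_{il}|^{2+\nu}\mid\mathscr F]<\infty$ a.s. Row splitting: the row index set is split into disjoint sets $[p]=\mathcal R^\dagger\cup\mathcal R^\ddagger$ with $p^\dagger=|\mathcal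 R^\dagger|\asymp p^\ddagger=|\mathcal R^\ddagger|\asymp p$; $\mathbf X^\dagger,\mathbf H^\dagger$ are the submatrices of $\mathbf X,\mathbf H$ with rows in $\mathcal R^\dagger$, and $\mathbf A_{\cdot i}$ denotes the $i$th column of $\mathbf A$. $\boldsymbol\eta^\dagger=(\eta_l)_{l\in\mathcal R^\dagger}:\mathbb R^r\to\mathbb R^{p^\dagger}$ and $\nabla\boldsymbol\eta^\dagger(\boldsymbol\alpha)$ is its $p^\dagger\times r$ Jacobian matrix; $s_{\min}$ denotes smallest singular value. For $\boldsymbol\alpha\in\mathcal A$, fix an orthonormal basis of the $r$-dimensional column space of $\nabla\boldsymbol\eta^\dagger(\boldsymbol\alpha)$ (the tangent space at $\boldsymbol\eta^\dagger(\boldsymbol\alpha)$), and let $\mathscr P_{\boldsymbol\alpha,\ell}[\cdot]$ denote orthogonal projection in $\mathbb R^{p^\dagger}$ onto the $\ell$th basis direction. Asymptotic notation: $a_n\lesssim_{\mathbb P}b_n$ means $\lim_{\varepsilon\to\infty}\limsup_n\mathbb P(|a_n/b_n|\ge\varepsilon)=0$; $a_n\gtrsim_{\mathbb P}b_n$ means $b_n\lesssim_{\mathbb P}a_n$; $a_n\lesssim b_n$ means $\limsup_n|a_n/b_n|<\infty$. Assumption 2 (Indirect matching): there exist fixed constants $\rho_0\ge0$, $\underline\varsigma>0$, $\bar\varsigma>0$ and a positive sequence $a_n=o(1)$ such that (a) $\max_{1\le i,j\le n}|\rho(\mathbf X^\dagger_{\cdot i},\mathbf X^\dagger_{\cdot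 j})-\rho(\mathbf H^\dagger_{\cdot i},\mathbf H^\dagger_{\cdot j})-\rho_0|\lesssim_{\mathbb P}a_n$; (b) $\max_{i,j:\boldsymbol\alpha_i\ne\boldsymbol\alpha_j}\rho(\mathbf H^\dagger_{\cdot i},\mathbf H^\dagger_{\cdot j})/\|\boldsymbol\alpha_i-\boldsymbol\alpha_j\|^{\bar\varsigma}\lesssim_{\mathbb P}1$ and $\min_{i,j:\boldsymbol\alpha_i\ne\boldsymbol\alpha_j}\rho(\mathbf H^\dagger_{\cdot i},\mathbf H^\dagger_{\cdot j})/\|\boldsymbol\alpha_i-\boldsymbol\alpha_j\|^{\underline\varsigma}\gtrsim_{\mathbb P}1$. *)

theory Defs
  imports "HOL-Probability.Probability"
begin

fun pderivs :: "'r::finite list \<Rightarrow> (real^'r \<Rightarrow> real) \<Rightarrow> real^'r \<Rightarrow> real" where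
  "pderivs [] f = f"
| "pderivs (k # ks) f = (\<lambda>x. frechet_derivative (pderivs ks f) (at x) (axis k 1))"

definition Ck :: "nat \<Rightarrow> (real^'r::finite \<Rightarrow> real) \<Rightarrow> bool" where
  "Ck m f \<longleftrightarrow>
     (\<forall>ks. length ks < m \<longrightarrow> (\<forall>x. pderivs ks f differentiable (at x))) \<and>
     (\<forall>ks. length ks \<le> m \<longrightarrow> continuous_on UNIV (pderivs ks f))"

definition pd :: "'r::finite \<Rightarrow> (real^'r \<Rightarrow> real) \<Rightarrow> real^'r \<Rightarrow> real" where
  "pd k f = pderivs [k] f"

definition smin :: "real^'r^'r::finite \<Rightarrow> real" where
  "smin A = Inf {norm (A *v v) | v. norm v = 1}"

definition gram :: "nat set \<Rightarrow> (nat \<Rightarrow> real^'r::finite \<Rightarrow> real) \<Rightarrow> real^'r \<Rightarrow> real^'r^'r" where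
  "gram R eta a = (\<chi> k m. (\<Sum>l\<in>R. pd k (eta l) a * pd m (eta l) a) / real (card R))"

text \<open>The family e (indexed by 'r) of vectors of R^R (represented as functions on R) is an
  orthonormal basis of the column space of the Jacobian of (eta_l)_{l in R} at a, provided the
  Jacobian has full column rank r: the e's are orthonormal and every column lies in their span.\<close>
definition tangent_onb :: "nat set \<Rightarrow> (nat \<Rightarrow> real^'r::finite \<Rightarrow> real) \<Rightarrow> real^'r \<Rightarrow> ('r \<Rightarrow> nat \<Rightarrow> real) \<Rightarrow> bool" where
  "tangent_onb R eta a e \<longleftrightarrow>
     (\<forall>q q'. (\<Sum>l\<in>R. e q l * e q' l) = (if q = q' then 1 else 0)) \<and>
     (\<forall>k. \<exists>c::'r \<Rightarrow> real. \<forall>l\<in>R. pd k (eta l) a = (\<Sum>q\<in>UNIV. c q * e q l))"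

definition full_rank_jac :: "nat set \<Rightarrow> (nat \<Rightarrow> real^'r::finite \<Rightarrow> real) \<Rightarrow> real^'r \<Rightarrow> bool" where
  "full_rank_jac R eta a \<longleftrightarrow>
     (\<forall>c::'r \<Rightarrow> real. (\<forall>l\<in>R. (\<Sum>k\<in>UNIV. c k * pd k (eta l) a) = 0) \<longrightarrow> (\<forall>k. c k = 0))"

definition proj_dir :: "nat set \<Rightarrow> (nat \<Rightarrow> real) \<Rightarrow> (nat \<Rightarrow> real) \<Rightarrow> (nat \<Rightarrow> real)" where
  "proj_dir R e v = (\<lambda>l. (\<Sum>l'\<in>R. v l' * e l') * e l)"

definition sqnorm :: "nat set \<Rightarrow> (nat \<Rightarrow> real) \<Rightarrow> real" where
  "sqnorm R v = (\<Sum>l\<in>R. (v l)\<^sup>2)"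

text \<open>Y i is the i-th column (a function of the row index l), R the row set, n the number of columns:
  rho(Y_i, Y_j) = max over k in [n], k distinct from i and j, of |(Y_i - Y_j)' Y_k| / |R|.
  (Inserting 0 does not change the max of these nonnegative numbers and handles the empty case.)\<close>
definition pmd :: "nat set \<Rightarrow> nat \<Rightarrow> (nat \<Rightarrow> nat \<Rightarrow> real) \<Rightarrow> nat \<Rightarrow> nat \<Rightarrow> real" where
  "pmd R n Y i j =
     Max (insert 0 {\<bar>(\<Sum>l\<in>R. (Y i l - Y j l) * Y k l)\<bar> / real (card R) | k. k < n \<and> k \<noteq> i \<and> k \<noteq> j})"

definition gen_sigma :: "'w measure \<Rightarrow> ('w \<Rightarrow> real) set \<Rightarrow> 'w measure" where
  "gen_sigma M G = sigma (space M) (\<Union>g\<in>G. {g -` B \<inter> space M | B. B \<in> sets borel})"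

definition cond_indep :: "'w measure \<Rightarrow> 'w measure \<Rightarrow> ('i \<Rightarrow> 'w \<Rightarrow> real) \<Rightarrow> 'i set \<Rightarrow> bool" where
  "cond_indep M F X I \<longleftrightarrow>
     (\<forall>J B. J \<subseteq> I \<longrightarrow> finite J \<longrightarrow> (\<forall>j\<in>J. B j \<in> sets borel) \<longrightarrow>
        (AE w in M. nn_cond_exp M F (\<lambda>w. \<Prod>j\<in>J. indicator (B j) (X j w)) w
                   = (\<Prod>j\<in>J. nn_cond_exp M F (\<lambda>w. indicator (B j) (X j w)) w)))"

text \<open>Stochastic order along a sequence of probability spaces M n:
  A n \<lesssim>_P B n, i.e. lim_{eps\<rightarrow>\<infinity>} limsup_n P(|A n / B n| \<ge> eps) = 0, where the event
  |A/B| \<ge> eps is written as eps |B| \<le> |A| (so that B = 0 or B = \<infinity> are treated correctly).\<close>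
definition lesssim_P :: "(nat \<Rightarrow> 'w measure) \<Rightarrow> (nat \<Rightarrow> 'w \<Rightarrow> ereal) \<Rightarrow> (nat \<Rightarrow> 'w \<Rightarrow> ereal) \<Rightarrow> bool" where
  "lesssim_P M A B \<longleftrightarrow>
     ((\<lambda>eps::real. Limsup sequentially
         (\<lambda>n. ereal (measure (M n) {w \<in> space (M n). ereal eps * \<bar>B n w\<bar> \<le> \<bar>A n w\<bar>})))
      \<longlongrightarrow> 0) at_top"

end

(* Write x = eta(alpha_i) + u_i and condition on the sigma-algebra F. The perturbation of the pseudo-max
   distance is controlled by the sums over l of eta_l(alpha_i) u_kl and of u_il u_kl for distinct
   i and k, whose summands have conditional mean zero and conditionally bounded moments of order 2 + nu. Each summand is split at
   the level 1/lam = (p / log n)^(1/2): the bounded part has an exponential moment controlled by the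
   second moments alone, the remainder is handled by Chebyshev's inequality, and the rate condition
   makes the union over the n^2 pairs affordable.
   The upper bound in Assumption 2(b) is Lipschitz continuity. For the lower bound, points further apart than
   some eps are separated by condition (i). For nearby points put v = alpha_j - alpha_i and test the
   difference of the two columns against eta(a) - eta(b) with a - b parallel to v and a, b in A near
   alpha_i, which exist as A is convex with interior points. By condition (ii) the main term is the Gram
   form in direction v, hence of order |v|. With high probability the sample comes close to both
   a and b, so that the maximum over the sample sees this lower bound. *)
theory Submission
  imports Defs
begin

subsection \<open>Conditional independence\<close>

text \<open>Conditional independence is given through \<open>nn_cond_exp\<close> of indicator
  products, and no regular conditional law is constructed. Every conditional statement therefore
  becomes an integral against a nonnegative weight built from \<open>F\<close> and from other noise
  variables, and signed terms travel as separate positive and negative parts. The conditional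
  moments are only bounded in probability, so the estimates run on an event of \<open>F\<close>
  where they stay below a constant; its indicator can join the weight. Second moments of the tail
  are forced by the rate: with \<open>d = sqrt (ln n / p)\<close> it only makes
  \<open>n^2 * d powr nu\<close> of order \<open>ln n\<close>. A first moment bound would keep this
  logarithm; in the second moment the diagonal is divided by \<open>d^2 * p = ln n\<close>, and the
  off-diagonal part is of order \<open>(ln n / n)^2\<close>. What survives is of order
  \<open>1 / eps^2\<close>, not small in \<open>n\<close>, which is all that
  \<open>lesssim_P\<close> asks. In the lower bound every error must be proportional to the length
  of \<open>v\<close>, as pairs may be arbitrarily close. It is, because one factor is always a
  difference over \<open>v\<close>; so fixed accuracies suffice and the covering by the sample needs
  no rate.\<close>

text \<open>The sigma-algebra generated by \<open>F\<close> and the variables \<open>U j\<close>,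
  \<open>j \<in> J\<close>. Intersections are taken as generators so that they form an
  intersection-stable class, on which measures can be compared.\<close>

definition adjoin :: "'w measure \<Rightarrow> 'w measure \<Rightarrow> ('i \<Rightarrow> 'w \<Rightarrow> real) \<Rightarrow> 'i set \<Rightarrow> 'w measure" where
  "adjoin M F U J = sigma (space M)
     {D \<inter> {w \<in> space M. \<forall>j\<in>J. U j w \<in> B j} | D B. D \<in> sets F \<and> (\<forall>j\<in>J. B j \<in> sets borel)}"

lemma space_adjoin [simp]: "space (adjoin M F U J) = space M"
  unfolding adjoin_def by (simp add: space_measure_of_conv)

lemma adjoin_generator_subset:
  "{D \<inter> {w \<in> space M. \<forall>j\<in>J. U j w \<in> B j} | D B. D \<in> sets F \<and> (\<forall>j\<in>J. B j \<in> sets borel)}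
     \<subseteq> Pow (space M)"
  by auto

lemma sets_adjoin: "sets (adjoin M F U J) = sigma_sets (space M)
     {D \<inter> {w \<in> space M. \<forall>j\<in>J. U j w \<in> B j} | D B. D \<in> sets F \<and> (\<forall>j\<in>J. B j \<in> sets borel)}"
  unfolding adjoin_def by (rule sets_measure_of[OF adjoin_generator_subset])

lemma adjoin_basic:
  assumes "D \<in> sets F" "\<And>j. j \<in> J \<Longrightarrow> B j \<in> sets borel"
  shows "D \<inter> {w \<in> space M. \<forall>j\<in>J. U j w \<in> B j} \<in> sets (adjoin M F U J)"
  unfolding sets_adjoin using assms by (intro sigma_sets.Basic) blast

lemma sets_subset_adjoin:
  assumes "subalgebra M F"
  shows "sets F \<subseteq> sets (adjoin M F U J)"
proof
  fix D assume D: "D \<in> sets F"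
  then have "D \<subseteq> space M"
    using assms sets.sets_into_space unfolding subalgebra_def by metis
  then have "D \<inter> {w \<in> space M. \<forall>j\<in>J. U j w \<in> UNIV} = D" by auto
  with adjoin_basic[OF D, of J "\<lambda>_. UNIV" M U] show "D \<in> sets (adjoin M F U J)" by simp
qed

lemma measurable_adjoin_self:
  assumes "subalgebra M F" "j \<in> J"
  shows "U j \<in> borel_measurable (adjoin M F U J)"
proof (rule measurableI)
  fix B :: "real set" assume "B \<in> sets borel"
  then have "space F \<inter> {w \<in> space M. \<forall>i\<in>J. U i w \<in> (if i = j then B else UNIV)} \<in> sets (adjoin M F U J)"
    by (intro adjoin_basic) auto
  moreover have "space F \<inter> {w \<in> space M. \<forall>i\<in>J. U i w \<in> (if i = j then B else UNIV)} = U j -` B \<inter> space M"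
    using assms by (auto simp: subalgebra_def)
  ultimately show "U j -` B \<inter> space (adjoin M F U J) \<in> sets (adjoin M F U J)" by simp
qed simp

lemma adjoin_mono:
  fixes M F :: "'w measure" and U :: "'i \<Rightarrow> 'w \<Rightarrow> real"
  assumes "J \<subseteq> K"
  shows "sets (adjoin M F U J) \<subseteq> sets (adjoin M F U K)"
  unfolding sets_adjoin
proof (rule sigma_sets_subseteq, safe)
  fix D :: "'w set" and B :: "'i \<Rightarrow> real set" assume *: "D \<in> sets F" "\<forall>j\<in>J. B j \<in> sets borel"
  have "{w \<in> space M. \<forall>j\<in>J. U j w \<in> B j} = {w \<in> space M. \<forall>j\<in>K. U j w \<in> (if j \<in> J then B j else UNIV)}"
    using assms by auto
  then show "\<exists>D' B'. D \<inter> {w \<in> space M. \<forall>j\<in>J. U j w \<in> B j} = D' \<inter> {w \<in> space M. \<forall>j\<in>K. U j w \<in> B' j} \<and>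
       D' \<in> sets F \<and> (\<forall>j\<in>K. B' j \<in> sets borel)"
    using * by (intro exI[of _ D] exI[of _ "\<lambda>j. if j \<in> J then B j else UNIV"]) auto
qed

lemma measurable_adjoin_mono:
  assumes "f \<in> borel_measurable (adjoin M F U J)" "J \<subseteq> K"
  shows "f \<in> borel_measurable (adjoin M F U K)"
  using measurable_mono[OF _ _ adjoin_mono[OF assms(2), of M F U], of borel borel] assms(1) by auto

lemma measurable_adjoin_base:
  assumes "f \<in> borel_measurable F" "subalgebra M F"
  shows "f \<in> borel_measurable (adjoin M F U J)"
  using measurable_mono[OF _ _ sets_subset_adjoin[OF assms(2), of U J], of borel borel] assms
  by (auto simp: subalgebra_def)

lemma subalgebra_adjoin:
  fixes M F :: "'w measure" and U :: "'i \<Rightarrow> 'w \<Rightarrow> real"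
  assumes "subalgebra M F" "\<And>j. j \<in> J \<Longrightarrow> U j \<in> borel_measurable M" "finite J"
  shows "subalgebra M (adjoin M F U J)"
  unfolding subalgebra_def
proof
  show "sets (adjoin M F U J) \<subseteq> sets M"
    unfolding sets_adjoin
  proof (rule sets.sigma_sets_subset, safe)
    fix D :: "'w set" and B :: "'i \<Rightarrow> real set" assume *: "D \<in> sets F" "\<forall>j\<in>J. B j \<in> sets borel"
    have "{w \<in> space M. \<forall>j\<in>J. U j w \<in> B j} \<in> sets M"
      using * assms(2,3) by (intro sets.sets_Collect_finite_All) (auto intro!: measurable_sets simp: vimage_def Int_def conj_commute)
    then show "D \<inter> {w \<in> space M. \<forall>j\<in>J. U j w \<in> B j} \<in> sets M"
      using * assms(1) by (auto simp: subalgebra_def)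
  qed
qed simp

lemma Int_stable_adjoin_generator:
  fixes M F :: "'w measure" and U :: "'i \<Rightarrow> 'w \<Rightarrow> real"
  shows "Int_stable {D \<inter> {w \<in> space M. \<forall>j\<in>J. U j w \<in> B j} | D B. D \<in> sets F \<and> (\<forall>j\<in>J. B j \<in> sets borel)}"
proof (rule Int_stableI, clarify)
  fix D D' :: "'w set" and B B' :: "'i \<Rightarrow> real set" assume "D \<in> sets F" "\<forall>j\<in>J. B j \<in> sets (borel :: real measure)"
     "D' \<in> sets F" "\<forall>j\<in>J. B' j \<in> sets (borel :: real measure)"
  then show "\<exists>E C. D \<inter> {w \<in> space M. \<forall>j\<in>J. U j w \<in> B j} \<inter> (D' \<inter> {w \<in> space M. \<forall>j\<in>J. U j w \<in> B' j})
      = E \<inter> {w \<in> space M. \<forall>j\<in>J. U j w \<in> C j} \<and> E \<in> sets F \<and> (\<forall>j\<in>J. C j \<in> sets borel)"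
    by (intro exI[of _ "D \<inter> D'"] exI[of _ "\<lambda>j. B j \<inter> B' j"]) auto
qed

locale cond_indep_family = prob_space M + finite_measure_subalgebra M F for M F :: "'w measure" +
  fixes U :: "'i \<Rightarrow> 'w \<Rightarrow> real" and I :: "'i set"
  assumes U_meas [measurable]: "\<And>j. U j \<in> borel_measurable M"
    and ci: "cond_indep M F U I"
begin

lemma subalgebra_adjoin': "finite J \<Longrightarrow> subalgebra M (adjoin M F U J)"
  by (rule subalgebra_adjoin[OF subalg]) auto

lemma adjoin_meas_M: "finite J \<Longrightarrow> f \<in> borel_measurable (adjoin M F U J) \<Longrightarrow> f \<in> borel_measurable M"
  using measurable_from_subalg[OF subalgebra_adjoin'] by blast

text \<open>Conditional independence is used twice: for \<open>insert b J\<close> to split off the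
  factor of \<open>b\<close>, and for \<open>J\<close> to reassemble the other factors into one
  conditional expectation, which the defining property then trades for \<open>?P\<close>.\<close>

lemma nn_integral_basic_indicator:
  assumes "finite J" "J \<subseteq> I" "b \<in> I - J" "D \<in> sets F" "\<And>j. j \<in> J \<Longrightarrow> B j \<in> sets borel" "C \<in> sets borel"
  shows "(\<integral>\<^sup>+w. indicator (D \<inter> {w \<in> space M. \<forall>j\<in>J. U j w \<in> B j}) w * indicator C (U b w) \<partial>M)
    = (\<integral>\<^sup>+w. indicator (D \<inter> {w \<in> space M. \<forall>j\<in>J. U j w \<in> B j}) w
              * nn_cond_exp M F (\<lambda>w. indicator C (U b w)) w \<partial>M)"
proof -
  let ?P = "\<lambda>w. \<Prod>j\<in>J. indicator (B j) (U j w) :: ennreal"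
  let ?q = "\<lambda>w. indicator C (U b w) :: ennreal"
  note [measurable] = assms(4,5,6)
  have DM [measurable]: "D \<in> sets M" using assms(4) subalg by (auto simp: subalgebra_def)
  have m1 [measurable]: "?P \<in> borel_measurable M"
    by (intro borel_measurable_prod_ennreal measurable_compose[OF U_meas borel_measurable_indicator] assms(5))
  have m2 [measurable]: "?q \<in> borel_measurable M"
    by (intro measurable_compose[OF U_meas borel_measurable_indicator] assms(6))
  have ind: "indicator (D \<inter> {w \<in> space M. \<forall>j\<in>J. U j w \<in> B j}) w = indicator D w * ?P w"
    if "w \<in> space M" for w
    using that assms(1) by (cases "\<forall>j\<in>J. U j w \<in> B j") (auto simp: indicator_def prod_zero_iff)
  define B' where "B' j = (if j = b then C else B j)" for j
  have *: "(\<Prod>j\<in>insert b J. indicator (B' j) (U j w)) = ?q w * ?P w" for w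
  proof -
    have "(\<Prod>j\<in>J. indicator (B' j) (U j w)) = ?P w"
      using assms(3) by (intro prod.cong) (auto simp: B'_def)
    then show ?thesis using assms(1,3) by (simp add: B'_def)
  qed
  have B'_sets: "\<forall>j\<in>insert b J. B' j \<in> sets borel" using assms(5,6) by (simp add: B'_def)
  have ci1: "AE w in M. nn_cond_exp M F (\<lambda>w. ?q w * ?P w) w
      = (\<Prod>j\<in>insert b J. nn_cond_exp M F (\<lambda>w. indicator (B' j) (U j w)) w)"
    using ci[unfolded cond_indep_def, rule_format, of "insert b J" B'] assms(1-3) B'_sets
    unfolding * by auto
  have ci2: "AE w in M. nn_cond_exp M F ?P w = (\<Prod>j\<in>J. nn_cond_exp M F (\<lambda>w. indicator (B j) (U j w)) w)"
    using ci[unfolded cond_indep_def, rule_format, of J B] assms by auto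
  have **: "(\<Prod>j\<in>insert b J. nn_cond_exp M F (\<lambda>w. indicator (B' j) (U j w)) w)
     = nn_cond_exp M F ?q w * (\<Prod>j\<in>J. nn_cond_exp M F (\<lambda>w. indicator (B j) (U j w)) w)" for w
  proof -
    have "(\<Prod>j\<in>J. nn_cond_exp M F (\<lambda>w. indicator (B' j) (U j w)) w)
      = (\<Prod>j\<in>J. nn_cond_exp M F (\<lambda>w. indicator (B j) (U j w)) w)"
      using assms(3) by (intro prod.cong) (auto simp: B'_def)
    then show ?thesis using assms(1,3) by (simp add: B'_def)
  qed
  have "(\<integral>\<^sup>+w. indicator D w * ?P w * ?q w \<partial>M) = (\<integral>\<^sup>+w. indicator D w * (?q w * ?P w) \<partial>M)"
    by (simp add: mult_ac)
  also have "\<dots> = (\<integral>\<^sup>+w. indicator D w * nn_cond_exp M F (\<lambda>w. ?q w * ?P w) w \<partial>M)"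
    by (rule nn_cond_exp_intg[symmetric]) (use assms(4) in measurable)
  also have "\<dots> = (\<integral>\<^sup>+w. (indicator D w * nn_cond_exp M F ?q w) * nn_cond_exp M F ?P w \<partial>M)"
    using ci1 ci2 unfolding ** by (intro nn_integral_cong_AE) (auto simp: mult_ac)
  also have "\<dots> = (\<integral>\<^sup>+w. (indicator D w * nn_cond_exp M F ?q w) * ?P w \<partial>M)"
    by (rule nn_cond_exp_intg) (use assms(4) in measurable)
  finally have "(\<integral>\<^sup>+w. indicator D w * ?P w * ?q w \<partial>M) = (\<integral>\<^sup>+w. (indicator D w * ?P w) * nn_cond_exp M F ?q w \<partial>M)"
    by (simp add: mult_ac)
  then show ?thesis
    by (simp add: ind cong: nn_integral_cong_simp)
qed

text \<open>For fixed \<open>C\<close> both sides are integrals of \<open>Z\<close> against finite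
  measures on \<open>adjoin M F U J\<close>. These agree on the intersection-stable generators by
  the preceding lemma, hence everywhere.\<close>

lemma nn_integral_mult_indicator:
  assumes J: "finite J" "J \<subseteq> I" "b \<in> I - J" and C: "C \<in> sets borel"
    and Z: "Z \<in> borel_measurable (adjoin M F U J)"
  shows "(\<integral>\<^sup>+w. Z w * indicator C (U b w) \<partial>M)
    = (\<integral>\<^sup>+w. Z w * nn_cond_exp M F (\<lambda>w. indicator C (U b w)) w \<partial>M)"
proof -
  let ?G = "adjoin M F U J"
  let ?q = "\<lambda>w. indicator C (U b w) :: ennreal"
  let ?r = "nn_cond_exp M F ?q"
  have sub: "subalgebra M ?G" by (rule subalgebra_adjoin'[OF J(1)])
  have m2 [measurable]: "?q \<in> borel_measurable M"
    by (intro measurable_compose[OF U_meas borel_measurable_indicator] C)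
  have sub': "subalgebra (density M f) ?G" for f using sub by (auto simp: subalgebra_def)
  have em: "emeasure (restr_to_subalg (density M f) ?G) X = (\<integral>\<^sup>+w. indicator X w * f w \<partial>M)"
    if "X \<in> sets ?G" "f \<in> borel_measurable M" for f X
  proof -
    have "X \<in> sets M" using that(1) sub by (auto simp: subalgebra_def)
    then show ?thesis using that
      by (simp add: emeasure_restr_to_subalg[OF sub'] emeasure_density mult.commute)
  qed
  have eq: "restr_to_subalg (density M ?q) ?G = restr_to_subalg (density M ?r) ?G"
  proof (rule measure_eqI_generator_eq[OF Int_stable_adjoin_generator[of M J U F] adjoin_generator_subset,
        where A = "\<lambda>_::nat. space M"])
    fix X assume X: "X \<in> {D \<inter> {w \<in> space M. \<forall>j\<in>J. U j w \<in> B j} | D B. D \<in> sets F \<and> (\<forall>j\<in>J. B j \<in> sets borel)}"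
    then obtain D B where DB: "X = D \<inter> {w \<in> space M. \<forall>j\<in>J. U j w \<in> B j}" "D \<in> sets F" "\<And>j. j \<in> J \<Longrightarrow> B j \<in> sets borel"
      by blast
    have "X \<in> sets ?G" unfolding DB(1) by (rule adjoin_basic) (use DB in auto)
    then show "emeasure (restr_to_subalg (density M ?q) ?G) X = emeasure (restr_to_subalg (density M ?r) ?G) X"
      using nn_integral_basic_indicator[OF J DB(2) DB(3) C] by (simp add: em DB(1))
  next
    show "sets (restr_to_subalg (density M ?q) ?G) = sigma_sets (space M)
      {D \<inter> {w \<in> space M. \<forall>j\<in>J. U j w \<in> B j} | D B. D \<in> sets F \<and> (\<forall>j\<in>J. B j \<in> sets borel)}"
      by (simp add: sets_restr_to_subalg[OF sub'] sets_adjoin)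
    show "sets (restr_to_subalg (density M ?r) ?G) = sigma_sets (space M)
      {D \<inter> {w \<in> space M. \<forall>j\<in>J. U j w \<in> B j} | D B. D \<in> sets F \<and> (\<forall>j\<in>J. B j \<in> sets borel)}"
      by (simp add: sets_restr_to_subalg[OF sub'] sets_adjoin)
    have "space M \<in> sets F" using subalg sets.top[of F] by (simp add: subalgebra_def)
    then show "range (\<lambda>_::nat. space M) \<subseteq> {D \<inter> {w \<in> space M. \<forall>j\<in>J. U j w \<in> B j} | D B. D \<in> sets F \<and> (\<forall>j\<in>J. B j \<in> sets borel)}"
      by (auto intro!: exI[of _ "space M"] exI[of _ "\<lambda>_. UNIV"])
    have "emeasure (restr_to_subalg (density M ?q) ?G) (space M) = (\<integral>\<^sup>+w. indicator (space M) w * ?q w \<partial>M)"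
      by (rule em) (use sets.top[of ?G] in auto)
    also have "\<dots> \<le> (\<integral>\<^sup>+w. 1 \<partial>M)" by (rule nn_integral_mono) (auto simp: indicator_def)
    also have "\<dots> < \<infinity>" by (simp add: emeasure_space_1)
    finally show "emeasure (restr_to_subalg (density M ?q) ?G) (space M) \<noteq> \<infinity>" by simp
  qed auto
  have ZM: "Z \<in> borel_measurable M" by (rule adjoin_meas_M[OF J(1) Z])
  have t: "(\<integral>\<^sup>+w. Z w * f w \<partial>M) = (\<integral>\<^sup>+w. Z w \<partial>restr_to_subalg (density M f) ?G)"
    if "f \<in> borel_measurable M" for f
    using nn_integral_subalgebra2[OF sub' Z] that ZM by (simp add: nn_integral_density mult.commute)
  show ?thesis by (simp add: t eq)
qed

text \<open>Moving the conditional expectation from \<open>\<phi> \<circ> U b\<close> to \<open>Z\<close> makes both sides measures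
  in \<open>\<phi>\<close>, so that indicators suffice.\<close>
lemma nn_integral_mult_cond_exp:
  assumes J: "finite J" "J \<subseteq> I" "b \<in> I - J" and phi [measurable]: "phi \<in> borel_measurable borel"
    and Z: "Z \<in> borel_measurable (adjoin M F U J)"
  shows "(\<integral>\<^sup>+w. Z w * phi (U b w) \<partial>M) = (\<integral>\<^sup>+w. Z w * nn_cond_exp M F (\<lambda>w. phi (U b w)) w \<partial>M)"
proof -
  let ?Y = "nn_cond_exp M F Z"
  have ZM [measurable]: "Z \<in> borel_measurable M" by (rule adjoin_meas_M[OF J(1) Z])
  \<comment> \<open>Conditional expectation is self-adjoint: both sides equal the integral of the
    product of the two conditional expectations.\<close>
  have sym: "(\<integral>\<^sup>+w. Z w * nn_cond_exp M F g w \<partial>M) = (\<integral>\<^sup>+w. ?Y w * g w \<partial>M)"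
    if [measurable]: "g \<in> borel_measurable M" for g
  proof -
    have "(\<integral>\<^sup>+w. Z w * nn_cond_exp M F g w \<partial>M) = (\<integral>\<^sup>+w. nn_cond_exp M F g w * ?Y w \<partial>M)"
      by (subst nn_cond_exp_intg) (auto simp: mult.commute)
    also have "\<dots> = (\<integral>\<^sup>+w. ?Y w * g w \<partial>M)"
      by (subst mult.commute, rule nn_cond_exp_intg) auto
    finally show ?thesis .
  qed
  have "distr (density M Z) borel (U b) = distr (density M ?Y) borel (U b)"
  proof (rule measure_eqI)
    fix C assume "C \<in> sets (distr (density M Z) borel (U b))"
    then have C [measurable]: "C \<in> sets borel" by simp
    have e: "emeasure (distr (density M f) borel (U b)) C = (\<integral>\<^sup>+w. f w * indicator C (U b w) \<partial>M)"
      if [measurable]: "f \<in> borel_measurable M" for f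
    proof -
      have "emeasure (distr (density M f) borel (U b)) C = emeasure (density M f) (U b -` C \<inter> space M)"
        by (subst emeasure_distr) auto
      also have "\<dots> = (\<integral>\<^sup>+w. f w * indicator (U b -` C \<inter> space M) w \<partial>M)"
        by (rule emeasure_density) auto
      also have "\<dots> = (\<integral>\<^sup>+w. f w * indicator C (U b w) \<partial>M)"
        by (rule nn_integral_cong) (auto simp: indicator_def)
      finally show ?thesis .
    qed
    show "emeasure (distr (density M Z) borel (U b)) C = emeasure (distr (density M ?Y) borel (U b)) C"
      using nn_integral_mult_indicator[OF J C Z] by (simp add: e sym)
  qed simp
  then have "(\<integral>\<^sup>+x. phi x \<partial>distr (density M Z) borel (U b)) = (\<integral>\<^sup>+x. phi x \<partial>distr (density M ?Y) borel (U b))"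
    by simp
  then have "(\<integral>\<^sup>+w. Z w * phi (U b w) \<partial>M) = (\<integral>\<^sup>+w. ?Y w * phi (U b w) \<partial>M)"
    by (simp add: nn_integral_distr nn_integral_density)
  then show ?thesis by (simp add: sym)
qed

end

subsection \<open>Sums of truncated variables\<close>

text \<open>Large values are sent to 0 and not to the nearest endpoint, so that the remainder
  \<open>x - clip x\<close> is either 0 or \<open>x\<close> itself.\<close>

definition clip :: "real \<Rightarrow> real" where
  "clip x = (if \<bar>x\<bar> \<le> 1 then x else 0)"

lemma clip_measurable [measurable]: "clip \<in> borel_measurable borel"
  unfolding clip_def by measurable

lemma clip_uminus [simp]: "clip (- x) = - clip x"
  by (simp add: clip_def)

text \<open>No centring of the clipped variable is needed: outside \<open>[-1, 1]\<close> the linear term is dominated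
  by the quadratic one, so that mean zero of the unclipped variable suffices.\<close>
lemma exp_clip_le: "exp (clip x) \<le> 1 + x + 2 * x\<^sup>2"
proof (cases "\<bar>x\<bar> \<le> 1")
  case True
  show ?thesis
  proof (cases "x \<ge> 0")
    case True
    with \<open>\<bar>x\<bar> \<le> 1\<close> have "exp x \<le> 1 + x + x\<^sup>2" by (intro exp_bound) auto
    then have "exp x \<le> 1 + x + 2 * x\<^sup>2" using zero_le_power2[of x] by linarith
    with \<open>\<bar>x\<bar> \<le> 1\<close> show ?thesis by (simp add: clip_def)
  next
    case False
    define y where "y = - x"
    have y: "y > 0" using False by (simp add: y_def)
    \<comment> \<open>The product equals \<open>1 + y ^ 3\<close>.\<close>
    have "1 \<le> (1 - y + y\<^sup>2) * (1 + y)" using y by (simp add: algebra_simps power2_eq_square power3_eq_cube)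
    also have "\<dots> \<le> (1 - y + y\<^sup>2) * exp y"
    proof (intro mult_left_mono exp_ge_add_one_self)
      have "0 \<le> (1/2 - y)\<^sup>2 + 3/4" by simp
      then show "0 \<le> 1 - y + y\<^sup>2" by (simp add: power2_eq_square algebra_simps)
    qed
    finally have "exp (- y) \<le> 1 - y + y\<^sup>2" by (simp add: exp_minus field_simps)
    then have "exp (- y) \<le> 1 - y + 2 * y\<^sup>2" using zero_le_power2[of y] by linarith
    with \<open>\<bar>x\<bar> \<le> 1\<close> show ?thesis by (simp add: clip_def y_def)
  qed
next
  case False
  then have "\<bar>x\<bar> * 1 \<le> \<bar>x\<bar> * \<bar>x\<bar>" by (intro mult_left_mono) auto
  then have "\<bar>x\<bar> \<le> x\<^sup>2" by (simp add: power2_eq_square)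
  then have "0 \<le> x + 2 * x\<^sup>2" using zero_le_power2[of x] by linarith
  with False show ?thesis by (simp add: clip_def)
qed

lemma ennreal_add_right_cancel_leD: "a + c \<le> b + c \<Longrightarrow> c \<noteq> \<infinity> \<Longrightarrow> a \<le> b" for a b c :: ennreal
  by (simp add: add.commute[of _ c] ennreal_add_left_cancel_le)

text \<open>Abstract form of a centred, conditionally independent family. The weights allow
  arbitrary nonnegative functions of the other summands, which is what peeling off summands one at a
  time consumes: exponentials for the bounded part, truncated values for the tail.
  \<open>mean\<close> compares positive and negative parts since \<open>ennreal\<close> has no
  signed integrals.\<close>

locale truncation = prob_space M for M :: "'w measure" +
  fixes R :: "'l set" and \<zeta> :: "'l \<Rightarrow> 'w \<Rightarrow> real" and G :: "'w set" and L nu :: real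
  assumes finR: "finite R" and \<zeta>_meas [measurable]: "\<And>l. \<zeta> l \<in> borel_measurable M"
    and G_meas [measurable]: "G \<in> sets M" and L_nonneg: "0 \<le> L" and nu_pos: "0 < nu"
    and mean: "\<And>J l phi. J \<subseteq> R \<Longrightarrow> l \<in> R - J \<Longrightarrow> (\<And>j. phi j \<in> borel_measurable borel) \<Longrightarrow>
      (\<integral>\<^sup>+w. indicator G w * (\<Prod>j\<in>J. phi j (\<zeta> j w)) * ennreal (max (\<zeta> l w) 0) \<partial>M)
      = (\<integral>\<^sup>+w. indicator G w * (\<Prod>j\<in>J. phi j (\<zeta> j w)) * ennreal (max (- \<zeta> l w) 0) \<partial>M)"
    and moment: "\<And>J l phi. J \<subseteq> R \<Longrightarrow> l \<in> R - J \<Longrightarrow> (\<And>j. phi j \<in> borel_measurable borel) \<Longrightarrow>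
      (\<integral>\<^sup>+w. indicator G w * (\<Prod>j\<in>J. phi j (\<zeta> j w)) * ennreal (\<bar>\<zeta> l w\<bar> powr (2 + nu)) \<partial>M)
      \<le> ennreal L * (\<integral>\<^sup>+w. indicator G w * (\<Prod>j\<in>J. phi j (\<zeta> j w)) \<partial>M)"
begin

lemma weight_meas:
  fixes phi :: "'l \<Rightarrow> real \<Rightarrow> ennreal"
  assumes "\<And>j. phi j \<in> borel_measurable borel"
  shows "(\<lambda>w. indicator G w * (\<Prod>j\<in>J. phi j (\<zeta> j w))) \<in> borel_measurable M"
proof -
  have [measurable]: "(\<lambda>w. phi j (\<zeta> j w)) \<in> borel_measurable M" for j
    by (rule measurable_compose[OF \<zeta>_meas assms])
  show ?thesis by measurable
qed

lemma moment_bound: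
  assumes J: "J \<subseteq> R" "l \<in> R - J" and phi: "\<And>j. phi j \<in> borel_measurable borel"
    and h: "\<And>x. h x \<le> a + c * \<bar>x\<bar> powr (2 + nu)" and ac: "a \<ge> 0" "c \<ge> 0"
  shows "(\<integral>\<^sup>+w. indicator G w * (\<Prod>j\<in>J. phi j (\<zeta> j w)) * ennreal (h (\<zeta> l w)) \<partial>M)
      \<le> ennreal (a + c * L) * (\<integral>\<^sup>+w. indicator G w * (\<Prod>j\<in>J. phi j (\<zeta> j w)) \<partial>M)"
proof -
  define Z where "Z w = indicator G w * (\<Prod>j\<in>J. phi j (\<zeta> j w))" for w
  have [measurable]: "Z \<in> borel_measurable M" unfolding Z_def by (rule weight_meas[OF phi])
  have "(\<integral>\<^sup>+w. Z w * ennreal (h (\<zeta> l w)) \<partial>M)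
    \<le> (\<integral>\<^sup>+w. ennreal a * Z w + ennreal c * (Z w * ennreal (\<bar>\<zeta> l w\<bar> powr (2 + nu))) \<partial>M)"
  proof (rule nn_integral_mono)
    fix w
    have "ennreal (h (\<zeta> l w)) \<le> ennreal a + ennreal c * ennreal (\<bar>\<zeta> l w\<bar> powr (2 + nu))"
      using h[of "\<zeta> l w"] ac by (simp flip: ennreal_mult ennreal_plus add: ennreal_leI)
    then have "Z w * ennreal (h (\<zeta> l w)) \<le> Z w * (ennreal a + ennreal c * ennreal (\<bar>\<zeta> l w\<bar> powr (2 + nu)))"
      by (rule mult_left_mono) simp
    then show "Z w * ennreal (h (\<zeta> l w)) \<le> ennreal a * Z w + ennreal c * (Z w * ennreal (\<bar>\<zeta> l w\<bar> powr (2 + nu)))"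
      by (simp add: distrib_left mult_ac)
  qed
  also have "\<dots> = ennreal a * (\<integral>\<^sup>+w. Z w \<partial>M) + ennreal c * (\<integral>\<^sup>+w. Z w * ennreal (\<bar>\<zeta> l w\<bar> powr (2 + nu)) \<partial>M)"
    by (simp add: nn_integral_add nn_integral_cmult)
  also have "\<dots> \<le> ennreal a * (\<integral>\<^sup>+w. Z w \<partial>M) + ennreal c * (ennreal L * (\<integral>\<^sup>+w. Z w \<partial>M))"
    using moment[OF J phi] unfolding Z_def by (intro add_left_mono mult_left_mono) auto
  also have "\<dots> = ennreal (a + c * L) * (\<integral>\<^sup>+w. Z w \<partial>M)"
    using ac L_nonneg by (simp add: ennreal_mult algebra_simps)
  finally show ?thesis unfolding Z_def .
qed

lemma square_le_one_plus_powr: "x\<^sup>2 \<le> 1 + 1 * \<bar>x\<bar> powr (2 + nu)" for x :: real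
proof (cases "\<bar>x\<bar> \<le> 1")
  case True
  then have "x\<^sup>2 \<le> 1" by (simp add: abs_square_le_1)
  then show ?thesis using powr_ge_zero[of "\<bar>x\<bar>" "2 + nu"] by linarith
next
  case False
  then have "\<bar>x\<bar> powr 2 \<le> \<bar>x\<bar> powr (2 + nu)" using nu_pos by (intro powr_mono) auto
  with False show ?thesis by simp
qed

text \<open>Induction with the earlier summands as weight: in \<open>exp_clip_le\<close> the linear
  term integrates to zero, and the quadratic term, at most \<open>1 + L\<close> per unit of
  \<open>2 * lam^2\<close>, gives one factor.\<close>

lemma exp_moment_bound:
  assumes "J \<subseteq> R"
  shows "(\<integral>\<^sup>+w. indicator G w * (\<Prod>j\<in>J. ennreal (exp (clip (lam * \<zeta> j w)))) \<partial>M)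
    \<le> ennreal ((1 + 2 * lam\<^sup>2 * (1 + L)) ^ card J)"
proof -
  have "finite J" using assms finR finite_subset by blast
  then show ?thesis using assms
  proof (induction J)
    case empty
    have "(\<integral>\<^sup>+w. indicator G w \<partial>M) \<le> 1"
      using emeasure_le_1[of G] by (simp add: emeasure_space_1 emeasure_space[of M G, unfolded emeasure_space_1])
    then show ?case by simp
  next
    case (insert l J)
    let ?phi = "\<lambda>(j::'l) x. ennreal (exp (clip (lam * x)))"
    have phi: "?phi j \<in> borel_measurable borel" for j by measurable
    define Z where "Z w = indicator G w * (\<Prod>j\<in>J. ?phi j (\<zeta> j w))" for w
    have [measurable]: "Z \<in> borel_measurable M" unfolding Z_def by (rule weight_meas[OF phi])
    have J: "J \<subseteq> R" "l \<in> R - J" using insert by auto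
    let ?K = "1 + 2 * lam\<^sup>2 * (1 + L)"
    have IH: "(\<integral>\<^sup>+w. Z w \<partial>M) \<le> ennreal (?K ^ card J)" unfolding Z_def using insert J by simp
    then have Zfin: "(\<integral>\<^sup>+w. Z w \<partial>M) < \<infinity>" by (rule le_less_trans) simp
    let ?x = "\<lambda>w. lam * \<zeta> l w"
    have cm: "(\<integral>\<^sup>+w. Z w * (c * f w) \<partial>M) = c * (\<integral>\<^sup>+w. Z w * f w \<partial>M)"
      if [measurable]: "f \<in> borel_measurable M" for c f
      by (subst mult.left_commute) (simp add: nn_integral_cmult)
    \<comment> \<open>\<open>lam\<close> may be negative, since the lower tail uses this lemma at
      \<open>- lam\<close>; the two parts then swap roles.\<close>
    have mean': "(\<integral>\<^sup>+w. Z w * ennreal (max (?x w) 0) \<partial>M) = (\<integral>\<^sup>+w. Z w * ennreal (max (- ?x w) 0) \<partial>M)"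
    proof (cases "lam \<ge> 0")
      case True
      have e: "ennreal (max (lam * y) 0) = ennreal lam * ennreal (max y 0)" for y
        using True by (subst ennreal_mult[symmetric]) (auto simp: max_mult_distrib_left)
      have e': "ennreal (max (- (lam * y)) 0) = ennreal lam * ennreal (max (- y) 0)" for y
        using e[of "- y"] by simp
      show ?thesis using mean[OF J phi] unfolding e e' Z_def[symmetric]
        by (simp add: cm)
    next
      case False
      have e: "ennreal (max (lam * y) 0) = ennreal (- lam) * ennreal (max (- y) 0)" for y
        using False by (subst ennreal_mult[symmetric]) (auto simp: max_mult_distrib_left)
      have e': "ennreal (max (- (lam * y)) 0) = ennreal (- lam) * ennreal (max y 0)" for y
        using e[of "- y"] by simp
      show ?thesis using mean[OF J phi] unfolding e e' Z_def[symmetric]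
        by (simp add: cm)
    qed
    have sq: "2 * (lam * x)\<^sup>2 \<le> 2 * lam\<^sup>2 + 2 * lam\<^sup>2 * \<bar>x\<bar> powr (2 + nu)" for x
      using mult_left_mono[OF square_le_one_plus_powr[of x], of "2 * lam\<^sup>2"]
      by (simp add: power_mult_distrib algebra_simps)
    have b1: "(\<integral>\<^sup>+w. Z w * ennreal (1 + 2 * (?x w)\<^sup>2) \<partial>M) \<le> ennreal ?K * (\<integral>\<^sup>+w. Z w \<partial>M)"
      using moment_bound[OF J phi, of "\<lambda>x. 1 + 2 * (lam * x)\<^sup>2" "1 + 2 * lam\<^sup>2" "2 * lam\<^sup>2"] sq
      unfolding Z_def by (simp add: algebra_simps)
    have fin: "(\<integral>\<^sup>+w. Z w * ennreal (max (- ?x w) 0) \<partial>M) \<noteq> \<infinity>"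
    proof -
      have "(\<integral>\<^sup>+w. Z w * ennreal (max (- ?x w) 0) \<partial>M) \<le> (\<integral>\<^sup>+w. Z w * ennreal (1 + 2 * (?x w)\<^sup>2) \<partial>M)"
      proof (intro nn_integral_mono mult_left_mono ennreal_leI)
        fix w
        have "- z \<le> 1 + 2 * z\<^sup>2" for z :: real
        proof -
          have "0 \<le> (1 + z)\<^sup>2" by simp
          then have "0 \<le> 1 + 2 * z + z\<^sup>2" by (simp add: power2_sum)
          with zero_le_power2[of z] show ?thesis by linarith
        qed
        from this[of "?x w"] show "max (- ?x w) 0 \<le> 1 + 2 * (?x w)\<^sup>2" by simp
      qed simp
      also have "\<dots> \<le> ennreal ?K * (\<integral>\<^sup>+w. Z w \<partial>M)" by (rule b1)
      also have "\<dots> < \<infinity>" using Zfin by (simp add: ennreal_mult_less_top)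
      finally show ?thesis by simp
    qed
    \<comment> \<open>The linear term enters as its negative part on the left and its positive part
      on the right. By \<open>mean'\<close> the two integrals coincide, and \<open>fin\<close>
      allows cancelling them in \<open>ennreal\<close>.\<close>
    have "(\<integral>\<^sup>+w. Z w * ennreal (exp (clip (?x w))) \<partial>M) + (\<integral>\<^sup>+w. Z w * ennreal (max (- ?x w) 0) \<partial>M)
      = (\<integral>\<^sup>+w. Z w * (ennreal (exp (clip (?x w))) + ennreal (max (- ?x w) 0)) \<partial>M)"
      by (simp add: distrib_left nn_integral_add)
    also have "\<dots> \<le> (\<integral>\<^sup>+w. Z w * (ennreal (1 + 2 * (?x w)\<^sup>2) + ennreal (max (?x w) 0)) \<partial>M)"
    proof (intro nn_integral_mono mult_left_mono)
      fix w
      have "exp (clip (?x w)) + max (- ?x w) 0 \<le> 1 + 2 * (?x w)\<^sup>2 + max (?x w) 0"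
        using exp_clip_le[of "?x w"] by (auto simp: max_def)
      then show "ennreal (exp (clip (?x w))) + ennreal (max (- ?x w) 0) \<le> ennreal (1 + 2 * (?x w)\<^sup>2) + ennreal (max (?x w) 0)"
        by (subst (1 2) ennreal_plus[symmetric]) (auto simp del: ennreal_plus intro: ennreal_leI)
    qed simp
    also have "\<dots> = (\<integral>\<^sup>+w. Z w * ennreal (1 + 2 * (?x w)\<^sup>2) \<partial>M) + (\<integral>\<^sup>+w. Z w * ennreal (max (?x w) 0) \<partial>M)"
      unfolding distrib_left by (rule nn_integral_add) measurable
    also have "\<dots> = (\<integral>\<^sup>+w. Z w * ennreal (1 + 2 * (?x w)\<^sup>2) \<partial>M) + (\<integral>\<^sup>+w. Z w * ennreal (max (- ?x w) 0) \<partial>M)"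
      by (simp only: mean')
    finally have "(\<integral>\<^sup>+w. Z w * ennreal (exp (clip (?x w))) \<partial>M) \<le> (\<integral>\<^sup>+w. Z w * ennreal (1 + 2 * (?x w)\<^sup>2) \<partial>M)"
      by (rule ennreal_add_right_cancel_leD[OF _ fin])
    also have "\<dots> \<le> ennreal ?K * ennreal (?K ^ card J)"
      by (intro order_trans[OF b1 mult_left_mono[OF IH]]) simp
    also have "\<dots> = ennreal (?K ^ card (insert l J))"
    proof -
      have "0 \<le> ?K" using L_nonneg by simp
      then have "ennreal ?K * ennreal (?K ^ card J) = ennreal (?K * ?K ^ card J)"
        by (intro ennreal_mult[symmetric]) auto
      then show ?thesis using insert(1,2) by simp
    qed
    finally show ?case using insert(1,2) by (simp add: Z_def mult_ac)
  qed
qed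

text \<open>Beyond \<open>1 / lam\<close> missing powers of \<open>x\<close> are paid for with
  powers of \<open>lam\<close>: \<open>lam powr (1 + nu)\<close> for \<open>T x\<close>,
  \<open>lam powr nu\<close> for its square. Diagonal terms use the moment bound once, off-diagonal
  ones twice, with one tail as weight for the other.\<close>

lemma tail_second_moment:
  assumes lam: "lam > 0"
  defines "T \<equiv> \<lambda>x. if lam * \<bar>x\<bar> > 1 then \<bar>x\<bar> else 0"
  shows "(\<integral>\<^sup>+w. indicator G w * (\<Sum>l\<in>R. ennreal (T (\<zeta> l w)))\<^sup>2 \<partial>M)
    \<le> ennreal (real (card R) * (lam powr nu * L) + (real (card R))\<^sup>2 * (lam powr (1 + nu) * L)\<^sup>2)"
proof -
  let ?m = "real (card R)"
  have [measurable]: "T \<in> borel_measurable borel" unfolding T_def by measurable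
  have T0: "T x \<ge> 0" for x by (simp add: T_def)
  have Tle: "T x \<le> 0 + lam powr (1 + nu) * \<bar>x\<bar> powr (2 + nu)" for x
  proof (cases "lam * \<bar>x\<bar> > 1")
    case True
    then have x: "\<bar>x\<bar> > 0" by (cases "x = 0") auto
    have "1 \<le> (lam * \<bar>x\<bar>) powr (1 + nu)" using True nu_pos by (intro ge_one_powr_ge_zero) auto
    then have "\<bar>x\<bar> * 1 \<le> \<bar>x\<bar> * (lam * \<bar>x\<bar>) powr (1 + nu)" by (intro mult_left_mono) auto
    also have "\<dots> = lam powr (1 + nu) * (\<bar>x\<bar> powr 1 * \<bar>x\<bar> powr (1 + nu))"
      using lam x by (simp add: powr_mult)
    also have "\<dots> = lam powr (1 + nu) * \<bar>x\<bar> powr (2 + nu)"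
      by (subst powr_add[symmetric]) (simp add: add.commute)
    finally show ?thesis using True by (simp add: T_def)
  qed (simp add: T_def)
  have T2le: "(T x)\<^sup>2 \<le> 0 + lam powr nu * \<bar>x\<bar> powr (2 + nu)" for x
  proof (cases "lam * \<bar>x\<bar> > 1")
    case True
    then have x: "\<bar>x\<bar> > 0" by (cases "x = 0") auto
    have "1 \<le> (lam * \<bar>x\<bar>) powr nu" using True nu_pos by (intro ge_one_powr_ge_zero) auto
    then have "\<bar>x\<bar>\<^sup>2 * 1 \<le> \<bar>x\<bar>\<^sup>2 * (lam * \<bar>x\<bar>) powr nu" by (intro mult_left_mono) auto
    also have "\<dots> = lam powr nu * (\<bar>x\<bar> powr 2 * \<bar>x\<bar> powr nu)"
      using lam x by (simp add: powr_mult)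
    also have "\<dots> = lam powr nu * \<bar>x\<bar> powr (2 + nu)"
      by (subst powr_add[symmetric]) simp
    finally show ?thesis using True by (simp add: T_def)
  qed (simp add: T_def)
  have G1: "(\<integral>\<^sup>+w. indicator G w \<partial>M) \<le> 1"
    by (simp add: emeasure_space[of M G, unfolded emeasure_space_1])
  have diag: "(\<integral>\<^sup>+w. indicator G w * (ennreal (T (\<zeta> l w)) * ennreal (T (\<zeta> l w))) \<partial>M) \<le> ennreal (lam powr nu * L)"
    if l: "l \<in> R" for l
  proof -
    have "(\<integral>\<^sup>+w. indicator G w * (ennreal (T (\<zeta> l w)) * ennreal (T (\<zeta> l w))) \<partial>M)
       = (\<integral>\<^sup>+w. indicator G w * ennreal ((T (\<zeta> l w))\<^sup>2) \<partial>M)"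
      using T0 by (simp add: power2_eq_square ennreal_mult)
    also have "\<dots> \<le> ennreal (lam powr nu * L) * (\<integral>\<^sup>+w. indicator G w \<partial>M)"
      using moment_bound[of "{}" l "\<lambda>_ _. 1" "\<lambda>x. (T x)\<^sup>2", OF _ _ _ T2le] l by simp
    also have "\<dots> \<le> ennreal (lam powr nu * L) * 1" by (rule mult_left_mono[OF G1]) simp
    finally show ?thesis by simp
  qed
  have off: "(\<integral>\<^sup>+w. indicator G w * (ennreal (T (\<zeta> k w)) * ennreal (T (\<zeta> l w))) \<partial>M) \<le> ennreal ((lam powr (1 + nu) * L)\<^sup>2)"
    if l: "l \<in> R" "k \<in> R" "k \<noteq> l" for k l
  proof -
    have k: "(\<integral>\<^sup>+w. indicator G w * ennreal (T (\<zeta> k w)) \<partial>M) \<le> ennreal (lam powr (1 + nu) * L) * (\<integral>\<^sup>+w. indicator G w \<partial>M)"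
      using moment_bound[of "{}" k "\<lambda>_ _. 1" T, OF _ _ _ Tle] l by simp
    have "(\<integral>\<^sup>+w. indicator G w * (ennreal (T (\<zeta> k w)) * ennreal (T (\<zeta> l w))) \<partial>M)
      \<le> ennreal (lam powr (1 + nu) * L) * (\<integral>\<^sup>+w. indicator G w * ennreal (T (\<zeta> k w)) \<partial>M)"
      using moment_bound[of "{k}" l "\<lambda>_ x. ennreal (T x)" T, OF _ _ _ Tle] l by (simp add: mult_ac)
    also have "\<dots> \<le> ennreal (lam powr (1 + nu) * L) * (ennreal (lam powr (1 + nu) * L) * 1)"
      by (intro mult_left_mono order_trans[OF k] G1) auto
    also have "\<dots> = ennreal ((lam powr (1 + nu) * L)\<^sup>2)"
      using L_nonneg by (simp add: power2_eq_square ennreal_mult[symmetric])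
    finally show ?thesis .
  qed
  have "(\<integral>\<^sup>+w. indicator G w * (\<Sum>l\<in>R. ennreal (T (\<zeta> l w)))\<^sup>2 \<partial>M)
    = (\<integral>\<^sup>+w. (\<Sum>k\<in>R. \<Sum>l\<in>R. indicator G w * (ennreal (T (\<zeta> k w)) * ennreal (T (\<zeta> l w)))) \<partial>M)"
    unfolding power2_eq_square sum_product by (simp add: sum_distrib_left)
  also have "\<dots> = (\<Sum>k\<in>R. \<Sum>l\<in>R. \<integral>\<^sup>+w. indicator G w * (ennreal (T (\<zeta> k w)) * ennreal (T (\<zeta> l w))) \<partial>M)"
    by (simp add: nn_integral_sum)
  also have "\<dots> \<le> (\<Sum>k\<in>R. \<Sum>l\<in>R. ennreal ((if l = k then lam powr nu * L else 0) + (lam powr (1 + nu) * L)\<^sup>2))"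
  proof (intro sum_mono)
    fix k l assume kl: "k \<in> R" "l \<in> R"
    show "(\<integral>\<^sup>+w. indicator G w * (ennreal (T (\<zeta> k w)) * ennreal (T (\<zeta> l w))) \<partial>M)
      \<le> ennreal ((if l = k then lam powr nu * L else 0) + (lam powr (1 + nu) * L)\<^sup>2)"
    proof (cases "l = k")
      case True
      have "ennreal (lam powr nu * L) \<le> ennreal (lam powr nu * L + (lam powr (1 + nu) * L)\<^sup>2)"
        by (intro ennreal_leI) simp
      with diag[OF kl(1)] True show ?thesis using order_trans by fastforce
    next
      case False
      then show ?thesis using off[OF kl(2,1)] by simp
    qed
  qed
  also have "\<dots> = ennreal (\<Sum>k\<in>R. \<Sum>l\<in>R. (if l = k then lam powr nu * L else 0) + (lam powr (1 + nu) * L)\<^sup>2)"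
    using L_nonneg by (simp add: sum_ennreal sum_nonneg del: ennreal_plus)
  also have "(\<Sum>k\<in>R. \<Sum>l\<in>R. (if l = k then lam powr nu * L else 0) + (lam powr (1 + nu) * L)\<^sup>2)
     = ?m * (lam powr nu * L) + ?m\<^sup>2 * (lam powr (1 + nu) * L)\<^sup>2"
    using finR by (simp add: sum.distrib power2_eq_square distrib_left)
  finally show ?thesis .
qed

text \<open>Each summand is cut at \<open>1 / lam\<close>. A sum of size \<open>2 * y\<close> forces
  the clipped scaled sum beyond \<open>lam * y\<close> with one of two signs, or the sum of absolute
  tails beyond \<open>y\<close>: two Chernoff terms, at \<open>lam\<close> and \<open>- lam\<close>,
  and one Chebyshev term.\<close>

lemma deviation_bound:
  assumes lam: "lam > 0" and y: "y > 0"
  shows "measure M {w \<in> space M. w \<in> G \<and> 2 * y \<le> \<bar>\<Sum>l\<in>R. \<zeta> l w\<bar>}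
    \<le> 2 * exp (2 * (1 + L) * lam\<^sup>2 * real (card R) - lam * y)
      + (real (card R) * (lam powr nu * L) + (real (card R))\<^sup>2 * (lam powr (1 + nu) * L)\<^sup>2) / y\<^sup>2"
proof -
  define T where "T = (\<lambda>x. if lam * \<bar>x\<bar> > 1 then \<bar>x\<bar> else 0)"
  have [measurable]: "T \<in> borel_measurable borel" unfolding T_def by measurable
  have T0: "T x \<ge> 0" for x by (simp add: T_def)
  let ?E = "{w \<in> space M. w \<in> G \<and> 2 * y \<le> \<bar>\<Sum>l\<in>R. \<zeta> l w\<bar>}"
  let ?q = "real (card R) * (lam powr nu * L) + (real (card R))\<^sup>2 * (lam powr (1 + nu) * L)\<^sup>2"
  let ?b = "(1 + 2 * lam\<^sup>2 * (1 + L)) ^ card R"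
  have [measurable]: "?E \<in> sets M" by measurable
  define e1 where "e1 s w = indicator G w * (\<Prod>l\<in>R. ennreal (exp (clip (s * \<zeta> l w))))" for s w
  define e3 where "e3 w = indicator G w * (\<Sum>l\<in>R. ennreal (T (\<zeta> l w)))\<^sup>2" for w
  have [measurable]: "e1 s \<in> borel_measurable M" "e3 \<in> borel_measurable M" for s
    unfolding e1_def[abs_def] e3_def[abs_def] by measurable
  have pt: "indicator ?E w \<le> ennreal (exp (- lam * y)) * e1 lam w + ennreal (exp (- lam * y)) * e1 (- lam) w
     + ennreal (1 / y\<^sup>2) * e3 w" if "w \<in> space M" for w
  proof (cases "w \<in> ?E")
    case True
    then have G: "w \<in> G" and big: "2 * y \<le> \<bar>\<Sum>l\<in>R. \<zeta> l w\<bar>" by auto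
    have split: "\<bar>lam * x - clip (lam * x)\<bar> = lam * T x" for x
      using lam by (auto simp: clip_def T_def abs_mult)
    let ?C = "\<Sum>l\<in>R. clip (lam * \<zeta> l w)" and ?T = "\<Sum>l\<in>R. T (\<zeta> l w)"
    have "lam * (\<Sum>l\<in>R. \<zeta> l w) = ?C + (\<Sum>l\<in>R. lam * \<zeta> l w - clip (lam * \<zeta> l w))"
      by (simp add: sum_subtractf sum_distrib_left)
    moreover have "\<bar>\<Sum>l\<in>R. lam * \<zeta> l w - clip (lam * \<zeta> l w)\<bar> \<le> lam * ?T"
      by (rule order_trans[OF sum_abs]) (simp add: split sum_distrib_left)
    moreover have "lam * \<bar>\<Sum>l\<in>R. \<zeta> l w\<bar> = \<bar>lam * (\<Sum>l\<in>R. \<zeta> l w)\<bar>"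
      using lam by (simp add: abs_mult)
    ultimately have "lam * \<bar>\<Sum>l\<in>R. \<zeta> l w\<bar> \<le> \<bar>?C\<bar> + lam * ?T"
      by linarith
    moreover have "lam * (2 * y) \<le> lam * \<bar>\<Sum>l\<in>R. \<zeta> l w\<bar>" using big lam by (intro mult_left_mono) auto
    ultimately have "lam * y \<le> ?C \<or> lam * y \<le> - ?C \<or> lam * y \<le> lam * ?T" by linarith
    then consider "lam * y \<le> ?C" | "lam * y \<le> - ?C" | "y \<le> ?T" using lam by auto
    then have "1 \<le> ennreal (exp (- lam * y)) * e1 lam w \<or> 1 \<le> ennreal (exp (- lam * y)) * e1 (- lam) w
      \<or> 1 \<le> ennreal (1 / y\<^sup>2) * e3 w"
    proof cases
      case 1
      have "e1 lam w = ennreal (exp ?C)" using G finR by (simp add: e1_def prod_ennreal exp_sum)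
      then show ?thesis using 1 by (simp flip: ennreal_mult exp_add)
    next
      case 2
      have "e1 (- lam) w = ennreal (exp (- ?C))" using G finR by (simp add: e1_def prod_ennreal exp_sum sum_negf[symmetric])
      then show ?thesis using 2 by (simp flip: ennreal_mult exp_add)
    next
      case 3
      have "e3 w = ennreal (?T\<^sup>2)" using G T0 by (simp add: e3_def sum_ennreal ennreal_power sum_nonneg)
      moreover have "1 \<le> 1 / y\<^sup>2 * ?T\<^sup>2" using 3 y by (simp add: power_mono field_simps)
      ultimately show ?thesis by (simp flip: ennreal_mult)
    qed
    then show ?thesis using True by (auto intro: order_trans add_increasing add_increasing2)
  qed (auto simp: indicator_def)
  have "emeasure M ?E = (\<integral>\<^sup>+w. indicator ?E w \<partial>M)" by simp
  also have "\<dots> \<le> (\<integral>\<^sup>+w. ennreal (exp (- lam * y)) * e1 lam w + ennreal (exp (- lam * y)) * e1 (- lam) w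
     + ennreal (1 / y\<^sup>2) * e3 w \<partial>M)"
    by (rule nn_integral_mono[OF pt])
  also have "\<dots> = ennreal (exp (- lam * y)) * (\<integral>\<^sup>+w. e1 lam w \<partial>M) + ennreal (exp (- lam * y)) * (\<integral>\<^sup>+w. e1 (- lam) w \<partial>M)
     + ennreal (1 / y\<^sup>2) * (\<integral>\<^sup>+w. e3 w \<partial>M)"
    by (simp add: nn_integral_add nn_integral_cmult)
  also have "\<dots> \<le> ennreal (exp (- lam * y)) * ennreal ?b + ennreal (exp (- lam * y)) * ennreal ?b
     + ennreal (1 / y\<^sup>2) * ennreal ?q"
    using exp_moment_bound[of R lam] exp_moment_bound[of R "- lam"] tail_second_moment[OF lam]
    unfolding e1_def e3_def T_def by (intro add_mono mult_left_mono) auto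
  also have "\<dots> = ennreal (2 * (exp (- lam * y) * ?b) + ?q / y\<^sup>2)"
    using L_nonneg by (simp add: ennreal_mult[symmetric] flip: ennreal_plus)
  finally have "measure M ?E \<le> 2 * (exp (- lam * y) * ?b) + ?q / y\<^sup>2"
    using L_nonneg by (simp add: emeasure_eq_measure del: ennreal_plus)
  moreover have "?b \<le> exp (2 * (1 + L) * lam\<^sup>2 * real (card R))"
  proof -
    have "?b \<le> exp (2 * lam\<^sup>2 * (1 + L)) ^ card R"
      using L_nonneg by (intro power_mono exp_ge_add_one_self) auto
    also have "\<dots> = exp (2 * (1 + L) * lam\<^sup>2 * real (card R))"
      by (subst exp_of_nat_mult[symmetric]) (simp add: mult_ac)
    finally show ?thesis .
  qed
  then have "exp (- lam * y) * ?b \<le> exp (2 * (1 + L) * lam\<^sup>2 * real (card R) - lam * y)"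
    by (simp add: exp_diff exp_minus field_simps)
  ultimately show ?thesis by linarith
qed

end

subsection \<open>Products of conditionally independent noise\<close>

lemma borel_measurable_indicator_adjoin:
  assumes "subalgebra M F" "G \<in> sets F"
  shows "(indicator G :: _ \<Rightarrow> ennreal) \<in> borel_measurable (adjoin M F U J)"
  using sets_subset_adjoin[OF assms(1)] assms(2) by (intro borel_measurable_indicator) blast

context cond_indep_family
begin

text \<open>The summands \<open>a l * U (b l)\<close> only need fresh indices: \<open>U (b l)\<close> must not occur in
  any \<open>a l'\<close> with \<open>l' \<in> R\<close>, nor as another \<open>U (b l')\<close>.\<close>
lemma truncation_products:
  fixes a :: "'l \<Rightarrow> 'w \<Rightarrow> real" and b :: "'l \<Rightarrow> 'i" and K :: "'l \<Rightarrow> 'i set"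
  assumes R: "finite R" and K: "\<And>l. l \<in> R \<Longrightarrow> finite (K l) \<and> K l \<subseteq> I" and b: "\<And>l. l \<in> R \<Longrightarrow> b l \<in> I"
    and inj: "inj_on b R" and fresh: "\<And>l l'. l \<in> R \<Longrightarrow> l' \<in> R \<Longrightarrow> b l \<notin> K l'"
    and a: "\<And>l. l \<in> R \<Longrightarrow> a l \<in> borel_measurable (adjoin M F U (K l))"
    and aM: "\<And>l. a l \<in> borel_measurable M"
    and G: "G \<in> sets F" and L: "L1 \<ge> 0" "L2 \<ge> 0" and nu: "nu > 0"
    and U_mom: "\<And>l. l \<in> R \<Longrightarrow> AE w in M. w \<in> G \<longrightarrow>
        nn_cond_exp M F (\<lambda>w. ennreal (\<bar>U (b l) w\<bar> powr (2 + nu))) w \<le> ennreal L1"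
    and a_mom: "\<And>J l Z. finite J \<Longrightarrow> J \<subseteq> I \<Longrightarrow> J \<inter> K l = {} \<Longrightarrow> l \<in> R \<Longrightarrow> Z \<in> borel_measurable (adjoin M F U J) \<Longrightarrow>
        (\<And>w. w \<notin> G \<Longrightarrow> Z w = 0) \<Longrightarrow>
        (\<integral>\<^sup>+w. Z w * ennreal (\<bar>a l w\<bar> powr (2 + nu)) \<partial>M) \<le> ennreal L2 * (\<integral>\<^sup>+w. Z w \<partial>M)"
    and disj: "\<And>l l'. l \<in> R \<Longrightarrow> l' \<in> R \<Longrightarrow> l \<noteq> l' \<Longrightarrow> K l \<inter> K l' = {}"
    and mean0: "\<And>l. l \<in> R \<Longrightarrow> AE w in M. nn_cond_exp M F (\<lambda>w. ennreal (max (U (b l) w) 0)) w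
        = nn_cond_exp M F (\<lambda>w. ennreal (max (- U (b l) w) 0)) w"
  shows "truncation M R (\<lambda>l w. a l w * U (b l) w) G (L1 * L2) nu"
proof -
  have "subalgebra M F" by (rule subalg)
  then have GM: "G \<in> sets M" using G by (auto simp: subalgebra_def)
  note [measurable] = aM
  define zeta where "zeta l w = a l w * U (b l) w" for l w
  define S where "S J = (\<Union>l\<in>J. insert (b l) (K l))" for J
  define Z where "Z J phi w = indicator G w * (\<Prod>j\<in>J. phi j (zeta j w))" for J w and phi :: "'l \<Rightarrow> real \<Rightarrow> ennreal"
  have S: "finite (S J)" "S J \<subseteq> I" if "J \<subseteq> R" for J
    using that R K b finite_subset[OF that R] by (auto simp: S_def)
  have Zm: "Z J phi \<in> borel_measurable (adjoin M F U (S J))"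
    if J: "J \<subseteq> R" and phi: "\<And>j. phi j \<in> borel_measurable borel" for J phi
  proof -
    have "(\<lambda>w. phi j (zeta j w)) \<in> borel_measurable (adjoin M F U (S J))" if j: "j \<in> J" for j
    proof -
      have "a j \<in> borel_measurable (adjoin M F U (S J))"
        by (rule measurable_adjoin_mono[OF a]) (use J j in \<open>auto simp: S_def\<close>)
      moreover have "U (b j) \<in> borel_measurable (adjoin M F U (S J))"
        by (rule measurable_adjoin_self[OF subalg]) (use j in \<open>auto simp: S_def\<close>)
      ultimately have "zeta j \<in> borel_measurable (adjoin M F U (S J))"
        unfolding zeta_def[abs_def] by (rule borel_measurable_times)
      then show ?thesis by (rule measurable_compose[OF _ phi])
    qed
    then show ?thesis unfolding Z_def[abs_def]
      by (intro borel_measurable_times_ennreal borel_measurable_prod_ennreal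
          borel_measurable_indicator_adjoin[OF subalg G])
  qed
  \<comment> \<open>\<open>b l\<close> is fresh for \<open>Z J phi\<close> and for
    \<open>a l\<close>, so the noise factor may be exchanged for its conditional expectation.
    \<open>h\<close> will be a positive part, a negative part or the moment power of the
    coefficient.\<close>
  have step: "(\<integral>\<^sup>+w. (Z J phi w * ennreal (h (a l w))) * psi (U (b l) w) \<partial>M)
     = (\<integral>\<^sup>+w. (Z J phi w * ennreal (h (a l w))) * nn_cond_exp M F (\<lambda>w. psi (U (b l) w)) w \<partial>M)"
    if J: "J \<subseteq> R" "l \<in> R - J" and phi: "\<And>j. phi j \<in> borel_measurable borel"
      and h: "h \<in> borel_measurable borel" and psi: "psi \<in> borel_measurable borel" for J l phi h psi
  proof (rule nn_integral_mult_cond_exp[OF _ _ _ psi])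
    show "finite (S J \<union> K l)" "S J \<union> K l \<subseteq> I" using S[OF J(1)] K J by auto
    show "b l \<in> I - (S J \<union> K l)"
    proof -
      have "b l \<noteq> b l' \<and> b l \<notin> K l'" if "l' \<in> J" for l'
        using that J fresh inj_onD[OF inj, of l l'] by blast
      then show ?thesis using b[of l] fresh[of l l] J by (auto simp: S_def)
    qed
    have "Z J phi \<in> borel_measurable (adjoin M F U (S J \<union> K l))"
      by (rule measurable_adjoin_mono[OF Zm[OF J(1) phi]]) auto
    moreover have "a l \<in> borel_measurable (adjoin M F U (S J \<union> K l))"
      by (rule measurable_adjoin_mono[OF a]) (use J in auto)
    then have "(\<lambda>w. ennreal (h (a l w))) \<in> borel_measurable (adjoin M F U (S J \<union> K l))"
      by (intro measurable_compose[OF _ measurable_ennreal] measurable_compose[OF _ h])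
    ultimately show "(\<lambda>w. Z J phi w * ennreal (h (a l w))) \<in> borel_measurable (adjoin M F U (S J \<union> K l))"
      by (rule borel_measurable_times_ennreal)
  qed
  have ZM: "Z J phi \<in> borel_measurable M"
    if "J \<subseteq> R" "\<And>j. phi j \<in> borel_measurable borel" for J phi
    by (rule adjoin_meas_M[OF S(1)[OF that(1)] Zm[OF that]])
  show ?thesis
    unfolding zeta_def[abs_def, symmetric]
  proof (unfold_locales)
    show "finite R" "0 \<le> L1 * L2" "0 < nu" "G \<in> sets M" using R L nu GM by auto
    show "zeta l \<in> borel_measurable M" for l unfolding zeta_def[abs_def] by measurable
  next
    fix J l and phi :: "'l \<Rightarrow> real \<Rightarrow> ennreal"
    assume J: "J \<subseteq> R" "l \<in> R - J" and phi: "\<And>j. phi j \<in> borel_measurable borel"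
    note [measurable] = ZM[OF J(1) phi]
    let ?p = "\<lambda>x::real. max x 0" and ?n = "\<lambda>x::real. max (- x) 0"
    have eqs: "(\<integral>\<^sup>+w. (Z J phi w * ennreal (h (a l w))) * ennreal (?p (U (b l) w)) \<partial>M)
       = (\<integral>\<^sup>+w. (Z J phi w * ennreal (h (a l w))) * ennreal (?n (U (b l) w)) \<partial>M)"
      if h: "h \<in> borel_measurable borel" for h
    proof -
      have "AE w in M. nn_cond_exp M F (\<lambda>w. ennreal (?p (U (b l) w))) w = nn_cond_exp M F (\<lambda>w. ennreal (?n (U (b l) w))) w"
        using mean0 J by auto
      then show ?thesis
        using step[OF J phi h, of "\<lambda>x. ennreal (?p x)"] step[OF J phi h, of "\<lambda>x. ennreal (?n x)"]
        by (auto intro!: nn_integral_cong_AE)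
    qed
    \<comment> \<open>Exchanging the two parts of \<open>y\<close> turns the formula for the
      positive part of \<open>x * y\<close> into that for the negative part. A centred noise factor
      thus centres the product, whatever the sign of the coefficient.\<close>
    have pos: "ennreal (?p (x * y)) = ennreal (?p x) * ennreal (?p y) + ennreal (?n x) * ennreal (?n y)" for x y
      by (cases "x \<ge> 0"; cases "y \<ge> 0")
        (auto simp: max_def ennreal_mult[symmetric] mult_nonneg_nonneg mult_nonpos_nonpos mult_le_0_iff zero_le_mult_iff not_le simp flip: ennreal_plus)
    have neg: "ennreal (?n (x * y)) = ennreal (?p x) * ennreal (?n y) + ennreal (?n x) * ennreal (?p y)" for x y
      using pos[of x "- y"] by simp
    have "(\<integral>\<^sup>+w. Z J phi w * ennreal (?p (zeta l w)) \<partial>M)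
      = (\<integral>\<^sup>+w. (Z J phi w * ennreal (?p (a l w))) * ennreal (?p (U (b l) w)) \<partial>M)
       + (\<integral>\<^sup>+w. (Z J phi w * ennreal (?n (a l w))) * ennreal (?n (U (b l) w)) \<partial>M)"
      unfolding zeta_def pos distrib_left mult.assoc[symmetric] by (rule nn_integral_add) measurable
    also have "\<dots> = (\<integral>\<^sup>+w. (Z J phi w * ennreal (?p (a l w))) * ennreal (?n (U (b l) w)) \<partial>M)
       + (\<integral>\<^sup>+w. (Z J phi w * ennreal (?n (a l w))) * ennreal (?p (U (b l) w)) \<partial>M)"
      using eqs[of ?p] eqs[of ?n] by simp
    also have "\<dots> = (\<integral>\<^sup>+w. Z J phi w * ennreal (?n (zeta l w)) \<partial>M)"
      unfolding zeta_def neg distrib_left mult.assoc[symmetric] by (rule nn_integral_add[symmetric]) measurable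
    finally show "(\<integral>\<^sup>+w. indicator G w * (\<Prod>j\<in>J. phi j (zeta j w)) * ennreal (max (zeta l w) 0) \<partial>M)
      = (\<integral>\<^sup>+w. indicator G w * (\<Prod>j\<in>J. phi j (zeta j w)) * ennreal (max (- zeta l w) 0) \<partial>M)"
      unfolding Z_def .
    have "(\<integral>\<^sup>+w. Z J phi w * ennreal (\<bar>zeta l w\<bar> powr (2 + nu)) \<partial>M)
      = (\<integral>\<^sup>+w. (Z J phi w * ennreal (\<bar>a l w\<bar> powr (2 + nu))) * ennreal (\<bar>U (b l) w\<bar> powr (2 + nu)) \<partial>M)"
      by (simp add: zeta_def abs_mult powr_mult ennreal_mult mult.assoc)
    also have "\<dots> = (\<integral>\<^sup>+w. (Z J phi w * ennreal (\<bar>a l w\<bar> powr (2 + nu))) *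
        nn_cond_exp M F (\<lambda>w. ennreal (\<bar>U (b l) w\<bar> powr (2 + nu))) w \<partial>M)"
      using step[OF J phi, of "\<lambda>x. \<bar>x\<bar> powr (2 + nu)" "\<lambda>x. ennreal (\<bar>x\<bar> powr (2 + nu))"] by simp
    also have "\<dots> \<le> (\<integral>\<^sup>+w. ennreal L1 * (Z J phi w * ennreal (\<bar>a l w\<bar> powr (2 + nu))) \<partial>M)"
    proof (rule nn_integral_mono_AE)
      have "AE w in M. w \<in> G \<longrightarrow> nn_cond_exp M F (\<lambda>w. ennreal (\<bar>U (b l) w\<bar> powr (2 + nu))) w \<le> ennreal L1"
        using U_mom J by auto
      then show "AE w in M. Z J phi w * ennreal (\<bar>a l w\<bar> powr (2 + nu)) * nn_cond_exp M F (\<lambda>w. ennreal (\<bar>U (b l) w\<bar> powr (2 + nu))) w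
         \<le> ennreal L1 * (Z J phi w * ennreal (\<bar>a l w\<bar> powr (2 + nu)))"
      proof eventually_elim
        case (elim w)
        show ?case
        proof (cases "w \<in> G")
          case True
          with elim show ?thesis by (subst mult.commute[of "ennreal L1"]) (intro mult_left_mono, auto)
        qed (simp add: Z_def)
      qed
    qed
    also have "\<dots> = ennreal L1 * (\<integral>\<^sup>+w. Z J phi w * ennreal (\<bar>a l w\<bar> powr (2 + nu)) \<partial>M)"
      by (rule nn_integral_cmult) measurable
    \<comment> \<open>With the noise moment gone, the coefficient moment is taken against
      \<open>Z J phi\<close>, which vanishes off \<open>G\<close> and involves no index of
      \<open>K l\<close>.\<close>
    also have "\<dots> \<le> ennreal L1 * (ennreal L2 * (\<integral>\<^sup>+w. Z J phi w \<partial>M))"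
    proof (intro mult_left_mono a_mom)
      show "finite (S J)" "S J \<subseteq> I" using S[OF J(1)] by auto
      show "S J \<inter> K l = {}" using disj fresh J by (fastforce simp: S_def)
      show "Z J phi \<in> borel_measurable (adjoin M F U (S J))" by (rule Zm[OF J(1) phi])
    qed (use J in \<open>auto simp: Z_def\<close>)
    also have "\<dots> = ennreal (L1 * L2) * (\<integral>\<^sup>+w. Z J phi w \<partial>M)"
      using L by (simp add: ennreal_mult mult.assoc)
    finally show "(\<integral>\<^sup>+w. indicator G w * (\<Prod>j\<in>J. phi j (zeta j w)) * ennreal (\<bar>zeta l w\<bar> powr (2 + nu)) \<partial>M)
      \<le> ennreal (L1 * L2) * (\<integral>\<^sup>+w. indicator G w * (\<Prod>j\<in>J. phi j (zeta j w)) \<partial>M)"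
      unfolding Z_def .
  qed
qed

text \<open>Signal times noise: the coefficient is \<open>F\<close>-measurable, so it occupies no
  noise index and \<open>K\<close> is empty; its moment bound comes from boundedness.\<close>

lemma truncation_fixed_times_noise:
  fixes b :: "'l \<Rightarrow> 'i"
  assumes R: "finite R" and b: "\<And>l. l \<in> R \<Longrightarrow> b l \<in> I" and inj: "inj_on b R"
    and a: "\<And>l. l \<in> R \<Longrightarrow> a l \<in> borel_measurable F" and aM: "\<And>l. a l \<in> borel_measurable M"
    and B: "\<And>l w. l \<in> R \<Longrightarrow> w \<in> space M \<Longrightarrow> \<bar>a l w\<bar> \<le> B" "B \<ge> 0" "B powr (2 + nu) \<le> L2"
    and G: "G \<in> sets F" and L: "L1 \<ge> 0" and nu: "nu > 0"
    and U_mom: "\<And>l. l \<in> R \<Longrightarrow> AE w in M. w \<in> G \<longrightarrow>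
        nn_cond_exp M F (\<lambda>w. ennreal (\<bar>U (b l) w\<bar> powr (2 + nu))) w \<le> ennreal L1"
    and mean0: "\<And>l. l \<in> R \<Longrightarrow> AE w in M. nn_cond_exp M F (\<lambda>w. ennreal (max (U (b l) w) 0)) w
        = nn_cond_exp M F (\<lambda>w. ennreal (max (- U (b l) w) 0)) w"
  shows "truncation M R (\<lambda>l w. a l w * U (b l) w) G (L1 * L2) nu"
proof -
  have L2: "L2 \<ge> 0" using B(3) powr_ge_zero order_trans by blast
  have mom: "(\<integral>\<^sup>+w. Z w * ennreal (\<bar>a l w\<bar> powr (2 + nu)) \<partial>M) \<le> ennreal L2 * (\<integral>\<^sup>+w. Z w \<partial>M)"
    if "finite J" "l \<in> R" "Z \<in> borel_measurable (adjoin M F U J)" for J l Z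
  proof -
    have [measurable]: "Z \<in> borel_measurable M" using adjoin_meas_M that by blast
    have "(\<integral>\<^sup>+w. Z w * ennreal (\<bar>a l w\<bar> powr (2 + nu)) \<partial>M) \<le> (\<integral>\<^sup>+w. ennreal L2 * Z w \<partial>M)"
    proof (rule nn_integral_mono)
      fix w assume w: "w \<in> space M"
      have "\<bar>a l w\<bar> powr (2 + nu) \<le> B powr (2 + nu)" using B(1)[OF that(2) w] nu by (intro powr_mono2) auto
      then have "ennreal (\<bar>a l w\<bar> powr (2 + nu)) \<le> ennreal L2" using B(3) by (intro ennreal_leI) auto
      then show "Z w * ennreal (\<bar>a l w\<bar> powr (2 + nu)) \<le> ennreal L2 * Z w"
        by (subst mult.commute[of "ennreal L2"]) (intro mult_left_mono, auto)
    qed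
    also have "\<dots> = ennreal L2 * (\<integral>\<^sup>+w. Z w \<partial>M)" by (rule nn_integral_cmult) measurable
    finally show ?thesis .
  qed
  show ?thesis
    by (rule truncation_products[where K = "\<lambda>_. {}", OF R _ b inj _ _ aM G L L2 nu U_mom mom _ mean0])
      (auto intro: measurable_adjoin_base[OF a subalg])
qed

text \<open>Noise times noise: the factor at \<open>b l\<close> is averaged first, then the one at
  \<open>b' l\<close>. The slack \<open>L1 \<le> L2\<close> lets these sums share one constant with
  the signal-noise sums.\<close>

lemma truncation_noise_times_noise:
  fixes b b' :: "'l \<Rightarrow> 'i"
  assumes R: "finite R" and b: "\<And>l. l \<in> R \<Longrightarrow> b l \<in> I \<and> b' l \<in> I" and inj: "inj_on b R" "inj_on b' R"
    and fresh: "\<And>l l'. l \<in> R \<Longrightarrow> l' \<in> R \<Longrightarrow> b l \<noteq> b' l'"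
    and G: "G \<in> sets F" and L: "L1 \<ge> 0" "L1 \<le> L2" and nu: "nu > 0"
    and U_mom: "\<And>j. j \<in> I \<Longrightarrow> AE w in M. w \<in> G \<longrightarrow>
        nn_cond_exp M F (\<lambda>w. ennreal (\<bar>U j w\<bar> powr (2 + nu))) w \<le> ennreal L1"
    and mean0: "\<And>j. j \<in> I \<Longrightarrow> AE w in M. nn_cond_exp M F (\<lambda>w. ennreal (max (U j w) 0)) w
        = nn_cond_exp M F (\<lambda>w. ennreal (max (- U j w) 0)) w"
  shows "truncation M R (\<lambda>l w. U (b' l) w * U (b l) w) G (L1 * L2) nu"
proof -
  have L2: "L2 \<ge> 0" using L by simp
  have mom: "(\<integral>\<^sup>+w. Z w * ennreal (\<bar>U (b' l) w\<bar> powr (2 + nu)) \<partial>M) \<le> ennreal L2 * (\<integral>\<^sup>+w. Z w \<partial>M)"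
    if J: "finite J" "J \<subseteq> I" "J \<inter> {b' l} = {}" and l: "l \<in> R" and Z: "Z \<in> borel_measurable (adjoin M F U J)"
      and Z0: "\<And>w. w \<notin> G \<Longrightarrow> Z w = 0" for J l Z
  proof -
    have [measurable]: "Z \<in> borel_measurable M" by (rule adjoin_meas_M[OF J(1) Z])
    have "(\<integral>\<^sup>+w. Z w * ennreal (\<bar>U (b' l) w\<bar> powr (2 + nu)) \<partial>M)
      = (\<integral>\<^sup>+w. Z w * nn_cond_exp M F (\<lambda>w. ennreal (\<bar>U (b' l) w\<bar> powr (2 + nu))) w \<partial>M)"
      by (rule nn_integral_mult_cond_exp[OF J(1,2) _ _ Z, of _ "\<lambda>x. ennreal (\<bar>x\<bar> powr (2 + nu))"]) (use b l J in auto)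
    also have "\<dots> \<le> (\<integral>\<^sup>+w. ennreal L2 * Z w \<partial>M)"
    proof (rule nn_integral_mono_AE)
      have "AE w in M. w \<in> G \<longrightarrow> nn_cond_exp M F (\<lambda>w. ennreal (\<bar>U (b' l) w\<bar> powr (2 + nu))) w \<le> ennreal L1"
        using U_mom b l by auto
      then show "AE w in M. Z w * nn_cond_exp M F (\<lambda>w. ennreal (\<bar>U (b' l) w\<bar> powr (2 + nu))) w \<le> ennreal L2 * Z w"
      proof eventually_elim
        case (elim w)
        show ?case
        proof (cases "w \<in> G")
          case True
          with elim have "nn_cond_exp M F (\<lambda>w. ennreal (\<bar>U (b' l) w\<bar> powr (2 + nu))) w \<le> ennreal L2"
            using L(2) ennreal_leI order_trans by blast
          then show ?thesis by (subst mult.commute[of "ennreal L2"]) (intro mult_left_mono, auto)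
        qed (simp add: Z0)
      qed
    qed
    also have "\<dots> = ennreal L2 * (\<integral>\<^sup>+w. Z w \<partial>M)" by (rule nn_integral_cmult) measurable
    finally show ?thesis .
  qed
  show ?thesis
    by (rule truncation_products[where K = "\<lambda>l. {b' l}", OF R _ _ inj(1) _ _ _ G L(1) L2 nu _ mom])
      (use b fresh inj U_mom mean0 in \<open>auto intro!: measurable_adjoin_self[OF subalg] simp: inj_on_def\<close>)
qed

end

subsection \<open>Smooth functions and the pseudo-max distance\<close>

text \<open>\<open>F\<close> sees the latent functions at fixed points, while the signal evaluates
  them at random ones. Simple functions converging to \<open>g\<close> take finitely many values,
  and continuity carries measurability to the limit.\<close>

lemma borel_measurable_caratheodory:
  fixes f :: "'w \<Rightarrow> 'a::{metric_space, second_countable_topology} \<Rightarrow> real"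
  assumes f: "\<And>a. (\<lambda>w. f w a) \<in> borel_measurable F"
    and cont: "\<And>w. w \<in> space F \<Longrightarrow> continuous_on UNIV (f w)"
    and g: "g \<in> borel_measurable F"
  shows "(\<lambda>w. f w (g w)) \<in> borel_measurable F"
proof -
  obtain S where S: "\<And>i. simple_function F (S i)" "\<And>w. w \<in> space F \<Longrightarrow> (\<lambda>i. S i w) \<longlonglongrightarrow> g w"
    using borel_measurable_implies_sequence_metric[OF g] by blast
  show ?thesis
  proof (rule borel_measurable_LIMSEQ_metric)
    fix i :: nat
    show "(\<lambda>w. f w (S i w)) \<in> borel_measurable F"
    proof (rule measurable_compose_countable'[where I = "S i ` space F" and g = "S i" and f = "\<lambda>a w. f w a"])
      show "S i \<in> measurable F (count_space (S i ` space F))"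
        using S(1)[of i] by (auto simp: simple_function_def measurable_def countable_finite sets_borel_eq_count_space
          intro!: simple_functionD)
      show "countable (S i ` space F)" using S(1)[of i] by (simp add: simple_function_def countable_finite)
    qed (rule f)
  next
    fix w assume w: "w \<in> space F"
    have "isCont (f w) (g w)" using cont[OF w] by (simp add: continuous_on_eq_continuous_at)
    then show "(\<lambda>i. f w (S i w)) \<longlonglongrightarrow> f w (g w)" by (rule isCont_tendsto_compose[OF _ S(2)[OF w]])
  qed
qed

lemma linear_axis_expansion:
  fixes D :: "real^'r::finite \<Rightarrow> real"
  assumes "linear D"
  shows "D v = (\<Sum>k\<in>UNIV. D (axis k 1) * v $ k)"
proof -
  have "D v = D (\<Sum>k\<in>UNIV. v $ k *s axis k 1)" by (simp add: basis_expansion)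
  also have "\<dots> = (\<Sum>k\<in>UNIV. v $ k * D (axis k 1))"
    by (simp add: linear_sum[OF assms] scalar_mult_eq_scaleR linear_cmul[OF assms])
  finally show ?thesis by (simp add: mult.commute)
qed

lemma abs_sum_mult_component_le:
  fixes v :: "real^'r::finite"
  assumes "\<And>k. \<bar>d k\<bar> \<le> B"
  shows "\<bar>\<Sum>k\<in>UNIV. d k * v $ k\<bar> \<le> real CARD('r) * B * norm v"
proof -
  have "\<bar>\<Sum>k\<in>UNIV. d k * v $ k\<bar> \<le> (\<Sum>k\<in>(UNIV::'r set). B * norm v)"
    using assms order_trans[OF abs_ge_zero assms]
    by (intro order_trans[OF sum_abs] sum_mono) (auto simp: abs_mult intro!: mult_mono component_le_norm_cart)
  then show ?thesis by simp
qed

lemma has_derivative_pd: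
  assumes "f differentiable (at x)"
  shows "(f has_derivative (\<lambda>v. \<Sum>k\<in>UNIV. pd k f x * v $ k)) (at x)"
proof -
  have D: "(f has_derivative frechet_derivative f (at x)) (at x)"
    using assms frechet_derivative_works by blast
  then have lin: "linear (frechet_derivative f (at x))" by (rule has_derivative_linear)
  have "frechet_derivative f (at x) = (\<lambda>v. \<Sum>k\<in>UNIV. pd k f x * v $ k)"
    unfolding pd_def pderivs.simps by (rule ext, rule linear_axis_expansion[OF lin])
  with D show ?thesis by simp
qed

lemma lipschitz_of_pd_bound:
  fixes f :: "real^'r::finite \<Rightarrow> real"
  assumes "\<And>x. f differentiable (at x)" "\<And>k x. \<bar>pd k f x\<bar> \<le> B"
  shows "\<bar>f x - f y\<bar> \<le> real CARD('r) * B * norm (x - y)"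
proof -
  have "norm (f x - f y) \<le> (real CARD('r) * B) * norm (x - y)"
  proof (rule differentiable_bound[OF convex_UNIV])
    fix z :: "real^'r"
    show "(f has_derivative (\<lambda>v. \<Sum>k\<in>UNIV. pd k f z * v $ k)) (at z within UNIV)"
      using has_derivative_pd[OF assms(1)] by simp
    show "onorm (\<lambda>v. \<Sum>k\<in>UNIV. pd k f z * v $ k) \<le> real CARD('r) * B"
      by (rule onorm_le) (simp add: abs_sum_mult_component_le assms(2))
  qed auto
  then show ?thesis by simp
qed

text \<open>The gradient is frozen at a third point \<open>x\<close>: later all increments must be
  expressed in the Jacobian at one latent position, so that its Gram matrix appears. Within distance
  \<open>d\<close> of \<open>x\<close> the gradient varies by a multiple of \<open>d\<close>, and
  the mean value inequality applies.\<close>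

lemma pd_linearization:
  fixes f :: "real^'r::finite \<Rightarrow> real"
  assumes f: "\<And>x. f differentiable (at x)" "\<And>k x. pd k f differentiable (at x)"
    and B: "\<And>k m x. \<bar>pd m (pd k f) x\<bar> \<le> B"
    and d: "norm (a - x) \<le> d" "norm (b - x) \<le> d"
  shows "\<bar>f b - f a - (\<Sum>k\<in>UNIV. pd k f x * (b - a) $ k)\<bar> \<le> (real CARD('r))\<^sup>2 * B * norm (b - a) * d"
proof -
  let ?c = "real CARD('r)"
  have B0: "0 \<le> B" using B order_trans[OF abs_ge_zero] by blast
  have d0: "0 \<le> d" using d(1) norm_ge_zero order_trans by blast
  have "norm (f b - f a - (\<lambda>v. \<Sum>k\<in>UNIV. pd k f x * v $ k) (b - a)) \<le> norm (b - a) * (?c * (?c * B * d))"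
  proof (rule differentiable_bound_linearization[where S = "cball x d" and f' = "\<lambda>z v. \<Sum>k\<in>UNIV. pd k f z * v $ k"])
    fix t :: real assume t: "t \<in> {0..1}"
    have "a + t *\<^sub>R (b - a) = (1 - t) *\<^sub>R a + t *\<^sub>R b" by (simp add: algebra_simps)
    also have "\<dots> \<in> cball x d"
      using t d by (intro convexD[OF convex_cball]) (auto simp: dist_norm norm_minus_commute)
    finally show "a + t *\<^sub>R (b - a) \<in> cball x d" .
  next
    fix z assume "z \<in> cball x d"
    show "(f has_derivative (\<lambda>v. \<Sum>k\<in>UNIV. pd k f z * v $ k)) (at z within cball x d)"
      using has_derivative_pd[OF f(1)] has_derivative_at_withinI by blast
  next
    fix z assume z: "z \<in> cball x d"
    have zx: "norm (z - x) \<le> d" using z by (simp add: dist_norm norm_minus_commute)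
    have *: "\<bar>pd k f z - pd k f x\<bar> \<le> ?c * B * d" for k
      by (rule order_trans[OF lipschitz_of_pd_bound[OF f(2) B] mult_left_mono[OF zx]]) (use B0 in simp)
    have "\<bar>\<Sum>k\<in>UNIV. (pd k f z - pd k f x) * v $ k\<bar> \<le> ?c * (?c * B * d) * norm v" for v :: "real^'r"
      by (rule abs_sum_mult_component_le[OF *])
    then show "onorm ((\<lambda>v. \<Sum>k\<in>UNIV. pd k f z * v $ k) - (\<lambda>v. \<Sum>k\<in>UNIV. pd k f x * v $ k)) \<le> ?c * (?c * B * d)"
      by (intro onorm_le) (simp add: sum_subtractf left_diff_distrib)
  qed (use d0 in auto)
  then show ?thesis by (simp add: power2_eq_square mult_ac)
qed

lemma smin_mult_norm_le:
  fixes A :: "real^'r^'r::finite"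
  shows "smin A * norm v \<le> norm (A *v v)"
proof (cases "v = 0")
  case False
  let ?u = "v /\<^sub>R norm v"
  have u: "norm ?u = 1" using False by simp
  have "smin A \<le> norm (A *v ?u)"
    unfolding smin_def using u by (intro cInf_lower) (auto intro!: bdd_belowI[of _ 0])
  also have "A *v ?u = (A *v v) /\<^sub>R norm v" by (simp add: matrix_vector_mult_scaleR)
  finally show ?thesis using False by (simp add: field_simps)
qed simp

text \<open>\<open>smin\<close> controls the length of the image of \<open>v\<close>, not the
  quadratic form. The components of the image are averages of directional derivatives with bounded
  weights, so Cauchy-Schwarz brings in the sum of squares; compared with a spectral argument the
  price is \<open>c0\<close> squared and the factor \<open>CARD('r) * B\<close>.\<close>

lemma smin_gram_le_quadratic:
  fixes v :: "real^'r::finite" and eta :: "nat \<Rightarrow> real^'r \<Rightarrow> real"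
  assumes R: "finite R" "card R > 0" and B: "\<And>k l. l \<in> R \<Longrightarrow> \<bar>pd k (eta l) a\<bar> \<le> B" and B0: "B > 0"
    and c0: "0 \<le> c0" "c0 \<le> smin (gram R eta a)"
  shows "real (card R) * (c0\<^sup>2 / (real CARD('r) * B)\<^sup>2) * (norm v)\<^sup>2
     \<le> (\<Sum>l\<in>R. (\<Sum>k\<in>UNIV. pd k (eta l) a * v $ k)\<^sup>2)"
proof -
  let ?m = "real (card R)" and ?c = "real CARD('r)"
  define D where "D l = (\<Sum>k\<in>UNIV. pd k (eta l) a * v $ k)" for l
  have comp: "(gram R eta a *v v) $ k = (\<Sum>l\<in>R. pd k (eta l) a * D l) / ?m" for k
  proof -
    have "(gram R eta a *v v) $ k = (\<Sum>j\<in>UNIV. (\<Sum>l\<in>R. pd k (eta l) a * pd j (eta l) a) / ?m * v $ j)"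
      by (simp add: matrix_vector_mult_def gram_def)
    also have "\<dots> = (\<Sum>j\<in>UNIV. \<Sum>l\<in>R. pd k (eta l) a * (pd j (eta l) a * v $ j)) / ?m"
      by (simp add: sum_divide_distrib sum_distrib_left sum_distrib_right mult_ac)
    also have "\<dots> = (\<Sum>l\<in>R. pd k (eta l) a * D l) / ?m"
      by (subst sum.swap) (simp add: D_def sum_distrib_left)
    finally show ?thesis .
  qed
  have "\<bar>(gram R eta a *v v) $ k\<bar> \<le> B * (\<Sum>l\<in>R. \<bar>D l\<bar>) / ?m" for k
  proof -
    have "\<bar>\<Sum>l\<in>R. pd k (eta l) a * D l\<bar> \<le> (\<Sum>l\<in>R. B * \<bar>D l\<bar>)"
      by (intro order_trans[OF sum_abs] sum_mono) (auto simp: abs_mult intro!: mult_right_mono B)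
    then show ?thesis by (simp add: comp sum_distrib_left divide_right_mono)
  qed
  then have "norm (gram R eta a *v v) \<le> (\<Sum>k\<in>(UNIV::'r set). B * (\<Sum>l\<in>R. \<bar>D l\<bar>) / ?m)"
    by (intro order_trans[OF norm_le_l1_cart] sum_mono)
  then have "c0 * norm v \<le> ?c * B * (\<Sum>l\<in>R. \<bar>D l\<bar>) / ?m"
    using smin_mult_norm_le[of "gram R eta a" v] mult_right_mono[OF c0(2), of "norm v"] by simp
  then have "(c0 * norm v)\<^sup>2 \<le> (?c * B * (\<Sum>l\<in>R. \<bar>D l\<bar>) / ?m)\<^sup>2"
    using c0 by (intro power_mono) auto
  also have "\<dots> = (?c * B)\<^sup>2 / ?m\<^sup>2 * (\<Sum>l\<in>R. \<bar>D l\<bar>)\<^sup>2" by (simp add: power_divide power_mult_distrib)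
  also have "\<dots> \<le> (?c * B)\<^sup>2 / ?m\<^sup>2 * ((\<Sum>l\<in>R. \<bar>D l\<bar>\<^sup>2) * ?m)"
    using sum_squared_le_sum_of_squares[of "\<lambda>l. \<bar>D l\<bar>" R] R by (intro mult_left_mono) (auto simp: mult.commute)
  also have "\<dots> = (?c * B)\<^sup>2 / ?m * (\<Sum>l\<in>R. (D l)\<^sup>2)" using R by (simp add: power2_eq_square)
  finally show ?thesis using R B0 unfolding D_def[symmetric]
    by (simp add: field_simps power_mult_distrib)
qed

section \<open>Deterministic comparison of the pseudo-max distance with the latent distance\<close>

lemma pmd_ge:
  assumes "k < n" "k \<noteq> i" "k \<noteq> j"
  shows "\<bar>\<Sum>l\<in>R. (Y i l - Y j l) * Y k l\<bar> / real (card R) \<le> pmd R n Y i j"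
  unfolding pmd_def using assms by (intro Max_ge) auto

lemma pmd_nonneg: "0 \<le> pmd R n Y i j"
  unfolding pmd_def by (intro Max_ge) auto

lemma pmd_le:
  assumes "0 \<le> c" "\<And>k. k < n \<Longrightarrow> k \<noteq> i \<Longrightarrow> k \<noteq> j \<Longrightarrow> \<bar>\<Sum>l\<in>R. (Y i l - Y j l) * Y k l\<bar> / real (card R) \<le> c"
  shows "pmd R n Y i j \<le> c"
  unfolding pmd_def using assms by (intro Max.boundedI) auto

definition bounded_C2 :: "real \<Rightarrow> (real^'r::finite \<Rightarrow> real) \<Rightarrow> bool" where
  "bounded_C2 B f \<longleftrightarrow> (\<forall>x. f differentiable (at x)) \<and> (\<forall>k x. pd k f differentiable (at x)) \<and>
     (\<forall>x. \<bar>f x\<bar> \<le> B) \<and> (\<forall>k x. \<bar>pd k f x\<bar> \<le> B) \<and> (\<forall>k m x. \<bar>pd m (pd k f) x\<bar> \<le> B)"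

lemma bounded_C2_if_Ck:
  assumes "Ck m f" "2 \<le> m" "\<And>ks a. length ks \<le> m \<Longrightarrow> \<bar>pderivs ks f a\<bar> \<le> B"
  shows "bounded_C2 B f"
  unfolding bounded_C2_def
proof (intro conjI allI)
  show "f differentiable at x" for x using assms(1)[unfolded Ck_def, THEN conjunct1, rule_format, of "[]"] assms(2) by simp
  show "pd k f differentiable at x" for k x
    using assms(1)[unfolded Ck_def, THEN conjunct1, rule_format, of "[k]"] assms(2) by (simp add: pd_def)
  show "\<bar>f x\<bar> \<le> B" for x using assms(3)[of "[]"] by simp
  show "\<bar>pd k f x\<bar> \<le> B" for k x using assms(2) assms(3)[of "[k]"] by (simp add: pd_def)
  show "\<bar>pd j (pd k f) x\<bar> \<le> B" for j k x using assms(2) assms(3)[of "[j, k]"] by (simp add: pd_def)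
qed

lemma bounded_C2_lipschitz:
  fixes f :: "real^'r::finite \<Rightarrow> real"
  shows "bounded_C2 B f \<Longrightarrow> \<bar>f x - f y\<bar> \<le> real CARD('r) * B * norm (x - y)"
  by (rule lipschitz_of_pd_bound) (auto simp: bounded_C2_def)

lemma pmd_upper:
  fixes al :: "nat \<Rightarrow> real^'r::finite"
  assumes B: "B > 0" and et: "\<And>l. l \<in> R \<Longrightarrow> bounded_C2 B (et l)"
  shows "pmd R n (\<lambda>i l. et l (al i)) i j \<le> real CARD('r) * B\<^sup>2 * norm (al i - al j)"
proof (rule pmd_le)
  fix k
  have "\<bar>\<Sum>l\<in>R. (et l (al i) - et l (al j)) * et l (al k)\<bar> \<le> (\<Sum>l\<in>R. (real CARD('r) * B * norm (al i - al j)) * B)"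
  proof (intro order_trans[OF sum_abs] sum_mono)
    fix l assume "l \<in> R"
    then show "\<bar>(et l (al i) - et l (al j)) * et l (al k)\<bar> \<le> (real CARD('r) * B * norm (al i - al j)) * B"
      using bounded_C2_lipschitz[OF et] et B unfolding abs_mult
      by (intro mult_mono) (auto simp: bounded_C2_def)
  qed
  then have "\<bar>\<Sum>l\<in>R. (et l (al i) - et l (al j)) * et l (al k)\<bar> / real (card R)
    \<le> real (card R) * (real CARD('r) * B\<^sup>2 * norm (al i - al j)) / real (card R)"
    by (intro divide_right_mono) (auto simp: power2_eq_square mult_ac)
  also have "\<dots> \<le> real CARD('r) * B\<^sup>2 * norm (al i - al j)"
    by (cases "card R = 0") auto
  finally show "\<bar>\<Sum>l\<in>R. (et l (al i) - et l (al j)) * et l (al k)\<bar> / real (card R) \<le> real CARD('r) * B\<^sup>2 * norm (al i - al j)" .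
qed simp

text \<open>With \<open>D l\<close> the derivative along \<open>y - x\<close>, the increments are
  \<open>D l\<close> and \<open>s * D l\<close> to first order. Main term and errors share the
  factor \<open>norm (a - b) * norm (y - x)\<close>, with relative error of order
  \<open>d + norm (y - x)\<close>, so the bound survives for arbitrarily close \<open>x\<close> and
  \<open>y\<close>.\<close>

lemma sum_increments_lower:
  fixes x y a b :: "real^'r::finite"
  assumes R: "finite R" "card R > 0" and B: "B > 0" and et: "\<And>l. l \<in> R \<Longrightarrow> bounded_C2 B (et l)"
    and c0: "0 < c0" "c0 \<le> smin (gram R et x)"
    and ab: "a - b = s *\<^sub>R (y - x)" "s \<ge> 0" and d: "norm (a - x) \<le> d" "norm (b - x) \<le> d"
  defines "c \<equiv> real CARD('r)"
  shows "real (card R) * (norm (a - b) * norm (y - x) *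
      (c0\<^sup>2 / (c * B)\<^sup>2 - c ^ 3 * B\<^sup>2 * (d + norm (y - x))))
    \<le> (\<Sum>l\<in>R. (et l y - et l x) * (et l a - et l b))"
proof -
  let ?v = "y - x" and ?m = "real (card R)"
  define D where "D l = (\<Sum>k\<in>UNIV. pd k (et l) x * ?v $ k)" for l
  have c: "c \<ge> 0" by (simp add: c_def)
  have na: "norm (a - b) = s * norm ?v" using ab by simp
  have pt: "s * (D l)\<^sup>2 - c ^ 3 * B\<^sup>2 * norm (a - b) * norm ?v * (d + norm ?v) \<le> (et l y - et l x) * (et l a - et l b)"
    if l: "l \<in> R" for l
  proof -
    have e: "et l differentiable (at x)" "pd k (et l) differentiable (at x)" "\<bar>pd k (et l) x\<bar> \<le> B"
       "\<bar>pd m (pd k (et l)) x\<bar> \<le> B" for x k m using et[OF l] by (auto simp: bounded_C2_def)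
    define g w where "g = et l y - et l x" and "w = et l a - et l b"
    have g: "\<bar>g - D l\<bar> \<le> c\<^sup>2 * B * norm ?v * norm ?v"
      unfolding g_def D_def c_def by (rule pd_linearization[OF e(1,2,4)]) auto
    have "(\<Sum>k\<in>UNIV. pd k (et l) x * (a - b) $ k) = s * D l"
      unfolding ab D_def by (simp add: sum_distrib_left mult_ac)
    then have w: "\<bar>w - s * D l\<bar> \<le> c\<^sup>2 * B * norm (a - b) * d"
      using pd_linearization[OF e(1,2,4) d(2) d(1)] by (simp add: w_def c_def)
    have w': "\<bar>w\<bar> \<le> c * B * norm (a - b)"
      using bounded_C2_lipschitz[OF et[OF l]] by (simp add: w_def c_def)
    have D: "\<bar>D l\<bar> \<le> c * B * norm ?v"
      unfolding D_def c_def by (rule abs_sum_mult_component_le[OF e(3)])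
    have "\<bar>D l * (w - s * D l)\<bar> \<le> (c * B * norm ?v) * (c\<^sup>2 * B * norm (a - b) * d)"
      unfolding abs_mult using D w by (intro mult_mono) (auto simp: order_trans[OF abs_ge_zero])
    moreover have "\<bar>(g - D l) * w\<bar> \<le> (c\<^sup>2 * B * norm ?v * norm ?v) * (c * B * norm (a - b))"
      unfolding abs_mult using g w' B c by (intro mult_mono) auto
    moreover have "g * w = s * (D l)\<^sup>2 + D l * (w - s * D l) + (g - D l) * w"
      by (simp add: algebra_simps power2_eq_square)
    moreover have "(c * B * norm ?v) * (c\<^sup>2 * B * norm (a - b) * d) + (c\<^sup>2 * B * norm ?v * norm ?v) * (c * B * norm (a - b))
       = c ^ 3 * B\<^sup>2 * norm (a - b) * norm ?v * (d + norm ?v)"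
      by (simp add: algebra_simps power2_eq_square power3_eq_cube)
    ultimately show ?thesis unfolding g_def w_def by linarith
  qed
  have "?m * (c0\<^sup>2 / (c * B)\<^sup>2) * (norm ?v)\<^sup>2 \<le> (\<Sum>l\<in>R. (D l)\<^sup>2)"
    unfolding D_def c_def using c0 et B by (intro smin_gram_le_quadratic R) (auto simp: bounded_C2_def)
  then have "s * (?m * (c0\<^sup>2 / (c * B)\<^sup>2) * (norm ?v)\<^sup>2) \<le> s * (\<Sum>l\<in>R. (D l)\<^sup>2)"
    using ab(2) by (rule mult_left_mono)
  moreover have "s * (?m * (c0\<^sup>2 / (c * B)\<^sup>2) * (norm ?v)\<^sup>2) = ?m * (norm (a - b) * norm ?v * (c0\<^sup>2 / (c * B)\<^sup>2))"
    by (simp add: na power2_eq_square)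
  moreover have "(\<Sum>l\<in>R. s * (D l)\<^sup>2 - c ^ 3 * B\<^sup>2 * norm (a - b) * norm ?v * (d + norm ?v))
     = s * (\<Sum>l\<in>R. (D l)\<^sup>2) - ?m * (c ^ 3 * B\<^sup>2 * norm (a - b) * norm ?v * (d + norm ?v))"
    by (simp add: sum_subtractf sum_distrib_left)
  moreover have "\<dots> \<le> (\<Sum>l\<in>R. (et l y - et l x) * (et l a - et l b))"
    unfolding calculation(3)[symmetric] by (rule sum_mono[OF pt])
  moreover have "?m * (norm (a - b) * norm ?v * (c0\<^sup>2 / (c * B)\<^sup>2 - c ^ 3 * B\<^sup>2 * (d + norm ?v)))
     = ?m * (norm (a - b) * norm ?v * (c0\<^sup>2 / (c * B)\<^sup>2)) - ?m * (c ^ 3 * B\<^sup>2 * norm (a - b) * norm ?v * (d + norm ?v))"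
    by (simp add: algebra_simps)
  ultimately show ?thesis by linarith
qed

text \<open>The constants are obtained before the row set, the sample size and the functions, so one
  choice serves every \<open>n\<close> and every outcome. The covering hypothesis avoids
  \<open>i\<close> and \<open>j\<close> because the maximum does.\<close>

lemma pmd_near_lower:
  fixes A :: "(real^'r::finite) set"
  assumes A: "convex A" "ball z \<rho> \<subseteq> A" "\<rho> > 0" "\<And>x. x \<in> A \<Longrightarrow> norm x \<le> bd" and bd: "bd > 0"
    and B: "B > 0" and c0: "c0 > 0"
  obtains eps h c1 where "eps > 0" "h > 0" "c1 > 0"
    "\<And>R n (et :: nat \<Rightarrow> real^'r \<Rightarrow> real) al i j.
       finite R \<Longrightarrow> card R > 0 \<Longrightarrow> (\<And>l. l \<in> R \<Longrightarrow> bounded_C2 B (et l)) \<Longrightarrow> al i \<in> A \<Longrightarrow>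
       c0 \<le> smin (gram R et (al i)) \<Longrightarrow>
       (\<And>x. x \<in> A \<Longrightarrow> \<exists>k<n. k \<noteq> i \<and> k \<noteq> j \<and> dist x (al k) < h) \<Longrightarrow>
       norm (al i - al j) \<le> eps \<Longrightarrow>
       c1 * norm (al i - al j) \<le> pmd R n (\<lambda>i l. et l (al i)) i j"
proof -
  define c where "c = real CARD('r)"
  have c: "c > 0" by (simp add: c_def)
  define kap where "kap = c0\<^sup>2 / (c * B)\<^sup>2"
  define K where "K = c ^ 3 * B\<^sup>2"
  have kap: "kap > 0" and K: "K > 0" using c B c0 by (auto simp: kap_def K_def)
  \<comment> \<open>Error budget against the main term \<open>kap\<close>: pulling \<open>a\<close>
    and \<open>b\<close> towards \<open>al i\<close> by the factor \<open>t\<close> costs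
    \<open>kap / 4\<close>, nearness \<open>eps\<close> another \<open>kap / 4\<close>.
    \<open>sg\<close> is the length of \<open>a - b\<close>; \<open>h\<close> makes each replacement
    by a sample point cost \<open>sg * kap / 8\<close> per unit of \<open>norm v\<close>. A half
    minus two eighths, shared by two sample points, leaves \<open>sg * kap / 8\<close>.\<close>
  define t where "t = min 1 (kap / (4 * K * (2 * bd)))"
  define eps where "eps = kap / (4 * K)"
  define sg where "sg = t * \<rho>"
  define h where "h = sg * kap / (8 * (c * B)\<^sup>2)"
  have t: "0 < t" "t \<le> 1" "K * (t * (2 * bd)) \<le> kap / 4"
  proof -
    show "0 < t" "t \<le> 1" using kap K bd by (auto simp: t_def)
    have "t \<le> kap / (4 * K * (2 * bd))" by (simp add: t_def)
    then have "t * (4 * K * (2 * bd)) \<le> kap" using K bd by (subst (asm) pos_le_divide_eq) auto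
    then show "K * (t * (2 * bd)) \<le> kap / 4" by (simp add: mult_ac)
  qed
  have eps: "eps > 0" and sg: "sg > 0" and h: "h > 0" using kap K t A(3) c B by (auto simp: eps_def sg_def h_def)
  show thesis
  proof (rule that[of eps h "sg * kap / 8"])
    fix R n and et :: "nat \<Rightarrow> real^'r \<Rightarrow> real" and al :: "nat \<Rightarrow> real^'r" and i j
    assume R: "finite R" "card R > 0" and et: "\<And>l. l \<in> R \<Longrightarrow> bounded_C2 B (et l)" and ai: "al i \<in> A"
      and sm: "c0 \<le> smin (gram R et (al i))"
      and cov: "\<And>x. x \<in> A \<Longrightarrow> \<exists>k<n. k \<noteq> i \<and> k \<noteq> j \<and> dist x (al k) < h"
      and near: "norm (al i - al j) \<le> eps"
    define x y v where "x = al i" and "y = al j" and "v = al j - al i"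
    let ?m = "real (card R)" and ?pm = "pmd R n (\<lambda>i l. et l (al i)) i j"
    show "sg * kap / 8 * norm (al i - al j) \<le> ?pm"
    proof (cases "v = 0")
      case True
      then show ?thesis using pmd_nonneg by (simp add: v_def norm_minus_commute)
    next
      case False
      \<comment> \<open>Half the radius keeps \<open>z + q\<close> and \<open>z - q\<close> inside
        the open ball. Convexity keeps \<open>a\<close> and \<open>b\<close> in \<open>A\<close>
        even if \<open>x\<close> lies on the boundary, and \<open>a - b\<close> is \<open>q\<close>
        scaled by \<open>2 * t\<close>, hence parallel to \<open>v\<close>.\<close>
      define q where "q = (\<rho> / 2 / norm v) *\<^sub>R v"
      have nq: "norm q = \<rho> / 2" using False A(3) by (simp add: q_def)
      have q: "z + q \<in> A" "z - q \<in> A" using nq A(2,3) by (auto simp: subset_iff dist_norm)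
      define a b where "a = (1 - t) *\<^sub>R x + t *\<^sub>R (z + q)" and "b = (1 - t) *\<^sub>R x + t *\<^sub>R (z - q)"
      have ab: "a \<in> A" "b \<in> A" unfolding a_def b_def using t q ai A(1)
        by (auto intro!: convexD simp: x_def)
      have a_b: "a - b = (sg / norm v) *\<^sub>R (y - x)"
        by (simp add: a_def b_def q_def sg_def x_def y_def v_def[symmetric] algebra_simps flip: scaleR_add_left)
      have na: "norm (a - b) = sg" unfolding a_b using False sg by (simp add: x_def y_def v_def)
      have nd: "norm (p - x) \<le> 2 * bd" if "p \<in> A" for p
        using A(4)[OF that] A(4)[OF ai] norm_triangle_ineq4[of p x] by (simp add: x_def)
      have "a - x = t *\<^sub>R (z + q - x)" "b - x = t *\<^sub>R (z - q - x)" by (simp_all add: a_def b_def algebra_simps)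
      then have d: "norm (a - x) \<le> t * (2 * bd)" "norm (b - x) \<le> t * (2 * bd)"
        using nd q t by (auto intro!: mult_left_mono)
      have main: "?m * (sg * norm v * (kap - K * (t * (2 * bd) + norm v))) \<le> (\<Sum>l\<in>R. (et l y - et l x) * (et l a - et l b))"
        using sum_increments_lower[OF R B et c0 _ a_b _ d] sm sg na
        by (simp add: kap_def K_def c_def x_def y_def v_def)
      have "K * norm v \<le> K * eps" using near K by (simp add: v_def norm_minus_commute)
      also have "\<dots> = kap / 4" using K by (simp add: eps_def)
      finally have "K * (t * (2 * bd) + norm v) \<le> kap / 2" using t(3) by (simp add: distrib_left)
      then have "sg * norm v * (kap / 2) \<le> sg * norm v * (kap - K * (t * (2 * bd) + norm v))"
        using sg by (intro mult_left_mono) auto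
      then have "?m * (sg * norm v * (kap / 2)) \<le> ?m * (sg * norm v * (kap - K * (t * (2 * bd) + norm v)))"
        by (rule mult_left_mono) simp
      with main have main': "?m * (sg * norm v * (kap / 2)) \<le> (\<Sum>l\<in>R. (et l y - et l x) * (et l a - et l b))"
        by linarith
      obtain k where k: "k < n" "k \<noteq> i" "k \<noteq> j" "dist a (al k) < h" using cov[OF ab(1)] by blast
      obtain k' where k': "k' < n" "k' \<noteq> i" "k' \<noteq> j" "dist b (al k') < h" using cov[OF ab(2)] by blast
      define E where "E p = (\<Sum>l\<in>R. (et l (al i) - et l (al j)) * et l p)" for p
      have swap: "(\<Sum>l\<in>R. (et l y - et l x) * (et l a - et l b)) = E b - E a"
        unfolding E_def x_def y_def by (simp add: algebra_simps flip: sum_subtractf)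
      \<comment> \<open>The first factor already supplies \<open>norm v\<close>, so moving the test
        point by \<open>h\<close> costs a fixed fraction of the main term, however close the pair
        is.\<close>
      have lip: "\<bar>E p - E p'\<bar> \<le> ?m * (c * B * norm v * (c * B * dist p p'))" for p p'
      proof -
        have "\<bar>E p - E p'\<bar> = \<bar>\<Sum>l\<in>R. (et l (al i) - et l (al j)) * (et l p - et l p')\<bar>"
          unfolding E_def by (simp add: algebra_simps flip: sum_subtractf)
        also have "\<dots> \<le> (\<Sum>l\<in>R. c * B * norm v * (c * B * dist p p'))"
        proof (intro order_trans[OF sum_abs] sum_mono)
          fix l assume l: "l \<in> R"
          show "\<bar>(et l (al i) - et l (al j)) * (et l p - et l p')\<bar> \<le> c * B * norm v * (c * B * dist p p')"
            unfolding abs_mult dist_norm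
            using bounded_C2_lipschitz[OF et[OF l], of "al i" "al j"] bounded_C2_lipschitz[OF et[OF l], of p p'] c B
            by (intro mult_mono) (auto simp: c_def v_def norm_minus_commute)
        qed
        finally show ?thesis by simp
      qed
      have pm: "\<bar>E (al k)\<bar> \<le> ?m * ?pm" if "k < n" "k \<noteq> i" "k \<noteq> j" for k
        using pmd_ge[OF that, where R = R and Y = "\<lambda>i l. et l (al i)"] R unfolding E_def by (simp add: field_simps)
      have hb: "?m * (c * B * norm v * (c * B * dist p p')) \<le> ?m * (sg * kap / 8 * norm v)" if "dist p p' < h" for p p'
      proof -
        have "?m * (c * B * norm v * (c * B * dist p p')) \<le> ?m * (c * B * norm v * (c * B * h))"
          using that c B by (intro mult_left_mono) auto
        also have "\<dots> = ?m * (sg * kap / 8 * norm v)"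
          using c B by (simp add: h_def power2_eq_square)
        finally show ?thesis .
      qed
      have "?m * (sg * norm v * (kap / 2)) \<le> E b - E a" using main' swap by simp
      also have "\<dots> \<le> 2 * (?m * ?pm) + 2 * (?m * (sg * kap / 8 * norm v))"
        using lip[of a "al k"] hb[OF k(4)] lip[of b "al k'"] hb[OF k'(4)] pm[OF k(1-3)] pm[OF k'(1-3)]
        by linarith
      finally have "?m * (sg * kap / 8 * norm v) \<le> ?m * ?pm" by (simp add: algebra_simps)
      then show ?thesis using R by (simp add: v_def norm_minus_commute)
    qed
  qed (use eps h sg kap in auto)
qed

subsection \<open>Sampling from a convex support\<close>

lemma prob_in_support:
  fixes dens :: "real^'r::finite \<Rightarrow> ennreal"
  assumes "prob_space M" and X: "distributed M lborel X dens"
    and A: "A \<in> sets borel" and dens0: "\<And>a. a \<notin> A \<Longrightarrow> dens a = 0"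
  shows "measure M {w \<in> space M. X w \<in> A} = 1" "emeasure lborel A \<noteq> 0"
proof -
  interpret prob_space M by fact
  have dm [measurable]: "dens \<in> borel_measurable lborel" and Xm [measurable]: "X \<in> measurable M lborel"
    using X by (auto simp: distributed_def)
  have A' [measurable]: "A \<in> sets lborel" using A by simp
  have "emeasure M (X -` A \<inter> space M) = (\<integral>\<^sup>+x. dens x * indicator A x \<partial>lborel)"
    by (rule distributed_emeasure[OF X A'])
  also have "\<dots> = (\<integral>\<^sup>+x. dens x * indicator UNIV x \<partial>lborel)"
    by (rule nn_integral_cong) (auto simp: indicator_def dens0)
  also have "\<dots> = emeasure M (X -` UNIV \<inter> space M)"
    by (rule distributed_emeasure[OF X, symmetric]) simp
  also have "\<dots> = 1" by (simp add: emeasure_space_1)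
  finally have 1: "emeasure M (X -` A \<inter> space M) = 1" .
  moreover have "X -` A \<inter> space M = {w \<in> space M. X w \<in> A}" by auto
  ultimately show "measure M {w \<in> space M. X w \<in> A} = 1" by (simp add: measure_def)
  show "emeasure lborel A \<noteq> 0"
  proof
    assume "emeasure lborel A = 0"
    then have ae: "AE x in lborel. x \<notin> A" using A' by (intro AE_not_in null_setsI)
    have "(\<integral>\<^sup>+x. dens x * indicator A x \<partial>lborel) = (\<integral>\<^sup>+x. 0 \<partial>(lborel :: (real^'r) measure))"
      by (intro nn_integral_cong_AE) (use ae in \<open>auto simp: indicator_def\<close>)
    then show False using 1 distributed_emeasure[OF X A'] by simp
  qed
qed

lemma convex_interior_nonempty:
  fixes A :: "(real^'r::finite) set"
  assumes "convex A" "emeasure lborel A \<noteq> 0" "A \<in> sets borel"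
  shows "interior A \<noteq> {}"
proof
  assume "interior A = {}"
  then have "negligible A" using negligible_convex_interior assms(1) by blast
  then have "A \<in> null_sets lebesgue" by (simp add: negligible_iff_null_sets)
  then have "emeasure lborel A = 0"
    using assms(3) by (simp add: null_sets_def)
  with assms(2) show False by simp
qed

text \<open>For \<open>x\<close> on the boundary the ball may meet \<open>A\<close> only partly. By
  convexity \<open>A\<close> lies in the closure of its interior, so a smaller ball fits into both.
  Its mass bound \<open>q\<close> depends on neither \<open>M\<close> nor \<open>X\<close>, hence
  serves all sample points and all \<open>n\<close>.\<close>

lemma prob_ball_lower:
  fixes A :: "(real^'r::finite) set" and dens :: "real^'r \<Rightarrow> ennreal"
  assumes A: "convex A" "interior A \<noteq> {}" and h: "h > 0" and x: "x \<in> A" and c: "c > 0"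
    and dens: "\<And>a. a \<in> A \<Longrightarrow> ennreal c \<le> dens a"
  obtains q where "q > 0" "\<And>M X. prob_space M \<Longrightarrow> distributed M lborel X dens \<Longrightarrow>
     q \<le> measure M (X -` ball x h \<inter> space M)"
proof -
  have "x \<in> closure (interior A)"
    using convex_closure_interior[OF A] x closure_subset by blast
  then obtain y where y: "y \<in> interior A" "dist y x < h"
    using h unfolding closure_approachable by blast
  have "open (ball x h \<inter> interior A)" by auto
  then obtain r where r: "r > 0" "ball y r \<subseteq> ball x h \<inter> interior A"
    using y openE[of "ball x h \<inter> interior A" y] by (auto simp: dist_commute)
  define q where "q = c * measure lborel (ball y r)"
  have pos: "measure lborel (ball y r) > 0" using r content_ball_pos by auto
  show thesis
  proof (rule that[of q])
    show "q > 0" using pos c by (simp add: q_def)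
    fix M :: "'b measure" and X assume M: "prob_space M" and X: "distributed M lborel X dens"
    interpret prob_space M by fact
    have [measurable]: "dens \<in> borel_measurable lborel" using X by (auto simp: distributed_def)
    have "emeasure lborel (ball y r) = ennreal (measure lborel (ball y r))"
      using emeasure_lborel_ball_finite[of y r] by (intro emeasure_eq_ennreal_measure) (auto simp: less_top)
    then have "ennreal q = ennreal c * emeasure lborel (ball y r)"
      using c by (simp add: q_def ennreal_mult)
    also have "\<dots> = (\<integral>\<^sup>+z. ennreal c * indicator (ball y r) z \<partial>lborel)"
      by (simp add: nn_integral_cmult_indicator)
    also have "\<dots> \<le> (\<integral>\<^sup>+z. dens z * indicator (ball x h) z \<partial>lborel)"
    proof (rule nn_integral_mono)
      fix z
      show "ennreal c * indicator (ball y r) z \<le> dens z * indicator (ball x h) z"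
      proof (cases "z \<in> ball y r")
        case True
        then have "z \<in> ball x h" "z \<in> A" using r(2) interior_subset[of A] by blast+
        with True dens[of z] show ?thesis by simp
      qed simp
    qed
    also have "\<dots> = emeasure M (X -` ball x h \<inter> space M)"
      by (rule distributed_emeasure[OF X, symmetric]) simp
    finally show "q \<le> measure M (X -` ball x h \<inter> space M)"
      by (simp add: emeasure_eq_measure)
  qed
qed

text \<open>Finitely many balls of radius \<open>h / 2\<close> cover \<open>A\<close>, and a sample
  point in the ball containing \<open>x\<close> is within \<open>h\<close> of it. Without the two
  forbidden indices at least \<open>n - 2\<close> independent points remain, each missing a given
  ball with probability at most \<open>1 - q\<close>; the union runs over balls and pairs.\<close>

lemma prob_uncovered:
  fixes A :: "(real^'r::finite) set" and dens :: "real^'r \<Rightarrow> ennreal"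
  assumes A: "compact A" "convex A" "interior A \<noteq> {}" and h: "h > 0" and c: "c > 0"
    and dens: "\<And>a. a \<in> A \<Longrightarrow> ennreal c \<le> dens a"
  obtains N q :: real where "0 < q" "q \<le> 1" "0 \<le> N"
    "\<And>(M :: 'w measure) n al. prob_space M \<Longrightarrow> (\<And>i. i < n \<Longrightarrow> distributed M lborel (al i) dens) \<Longrightarrow>
       prob_space.indep_vars M (\<lambda>_. borel) al {..<n} \<Longrightarrow>
       \<exists>E\<in>sets M. measure M E \<le> N * (real n)\<^sup>2 * (1 - q) ^ (n - 2) \<and>
         (\<forall>w\<in>space M - E. \<forall>x\<in>A. \<forall>i<n. \<forall>j<n. \<exists>k<n. k \<noteq> i \<and> k \<noteq> j \<and> dist x (al k w) < h)"
proof -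
  obtain S where S: "finite S" "S \<subseteq> A" "A \<subseteq> (\<Union>x\<in>S. ball x (h/2))"
    using compactE_image[OF A(1), of A "\<lambda>x. ball x (h/2)"] h by (metis (no_types, lifting) UN_iff centre_in_ball half_gt_zero open_ball subsetI)
  have "\<forall>x\<in>S. \<exists>q. q > 0 \<and> (\<forall>(M :: 'w measure) X. prob_space M \<longrightarrow> distributed M lborel X dens \<longrightarrow>
     q \<le> measure M (X -` ball x (h/2) \<inter> space M))"
  proof
    fix x assume "x \<in> S"
    then have x: "h/2 > 0" "x \<in> A" using S h by auto
    show "\<exists>q. q > 0 \<and> (\<forall>(M :: 'w measure) X. prob_space M \<longrightarrow> distributed M lborel X dens \<longrightarrow>
     q \<le> measure M (X -` ball x (h/2) \<inter> space M))"
    proof (rule prob_ball_lower[OF A(2,3) x c dens])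
      fix q :: real assume "q > 0" and "\<And>(M :: 'w measure) X. prob_space M \<Longrightarrow> distributed M lborel X dens \<Longrightarrow>
         q \<le> measure M (X -` ball x (h/2) \<inter> space M)"
      then show ?thesis by (intro exI[of _ q]) auto
    qed
  qed
  then obtain Q where "\<forall>x\<in>S. Q x > 0 \<and> (\<forall>(M :: 'w measure) X. prob_space M \<longrightarrow> distributed M lborel X dens \<longrightarrow>
     Q x \<le> measure M (X -` ball x (h/2) \<inter> space M))"
    by (rule bchoice[THEN exE])
  then have Q: "\<And>x. x \<in> S \<Longrightarrow> Q x > 0"
    "\<And>x M X. x \<in> S \<Longrightarrow> prob_space M \<Longrightarrow> distributed (M :: 'w measure) lborel X dens \<Longrightarrow>
       Q x \<le> measure M (X -` ball x (h/2) \<inter> space M)" by auto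
  define q where "q = Min (insert 1 (Q ` S))"
  have q: "0 < q" "q \<le> 1" "\<And>x. x \<in> S \<Longrightarrow> q \<le> Q x" using S Q by (auto simp: q_def)
  show thesis
  proof (rule that[OF q(1,2), of "real (card S)"])
    fix M :: "'w measure" and n and al :: "nat \<Rightarrow> 'w \<Rightarrow> real^'r"
    assume M: "prob_space M" and dist: "\<And>i. i < n \<Longrightarrow> distributed M lborel (al i) dens"
      and indep: "prob_space.indep_vars M (\<lambda>_. borel) al {..<n}"
    interpret prob_space M by fact
    have alm: "al k \<in> borel_measurable M" if "k < n" for k
      using dist[OF that] by (auto simp: distributed_def)
    define E where "E x i j = {w \<in> space M. \<forall>k\<in>{..<n} - {i,j}. al k w \<notin> ball x (h/2)}" for x i j
    have Em: "E x i j \<in> sets M" for x i j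
      unfolding E_def
    proof (rule sets.sets_Collect_finite_All)
      fix k assume "k \<in> {..<n} - {i,j}"
      then have "al k -` (- ball x (h/2)) \<inter> space M \<in> sets M"
        using alm by (intro measurable_sets[of _ M borel]) auto
      then show "{w \<in> space M. al k w \<notin> ball x (h/2)} \<in> sets M"
        by (simp add: vimage_def Int_def conj_commute)
    qed simp
    have El: "measure M (E x i j) \<le> (1 - q) ^ (n - 2)" if x: "x \<in> S" for x i j
    proof (cases "{..<n} - {i,j} = {}")
      \<comment> \<open>\<open>indep_varsD\<close> wants a nonempty index set. With no index left
        \<open>n\<close> is at most 2, so the truncated \<open>n - 2\<close> is 0 and the bound is
        the trivial 1.\<close>
      case True
      then have "card {..<n} \<le> card {i,j}" by (intro card_mono) auto
      also have "\<dots> \<le> 2" by (simp add: card_insert_if)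
      finally have "n - 2 = 0" by simp
      then show ?thesis using prob_le_1 by simp
    next
      case False
      let ?J = "{..<n} - {i,j}"
      have "E x i j = (\<Inter>k\<in>?J. al k -` (- ball x (h/2)) \<inter> space M)"
        using False unfolding E_def by auto
      then have "measure M (E x i j) = (\<Prod>k\<in>?J. measure M (al k -` (- ball x (h/2)) \<inter> space M))"
        using indep_varsD[OF indep False, of "\<lambda>_. - ball x (h/2)"] by auto
      also have "\<dots> \<le> (\<Prod>k\<in>?J. 1 - q)"
      proof (intro prod_mono conjI measure_nonneg)
        fix k assume k: "k \<in> ?J"
        have "al k -` (- ball x (h/2)) \<inter> space M = space M - (al k -` ball x (h/2) \<inter> space M)" by auto
        moreover have "al k -` ball x (h/2) \<inter> space M \<in> sets M"
          using k alm by (intro measurable_sets[of _ M borel]) auto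
        ultimately have "measure M (al k -` (- ball x (h/2)) \<inter> space M) = 1 - measure M (al k -` ball x (h/2) \<inter> space M)"
          by (simp add: prob_compl)
        then show "measure M (al k -` (- ball x (h/2)) \<inter> space M) \<le> 1 - q"
          using Q(2)[OF x M dist] q(3)[OF x] k by fastforce
      qed
      also have "\<dots> = (1 - q) ^ card ?J" by simp
      also have "\<dots> \<le> (1 - q) ^ (n - 2)"
      proof (rule power_decreasing)
        have "card {..<n} - card {i,j} \<le> card ?J" by (rule diff_card_le_card_Diff) simp
        moreover have "card {i,j} \<le> 2" by (simp add: card_insert_if)
        ultimately show "n - 2 \<le> card ?J" by simp
      qed (use q in auto)
      finally show ?thesis .
    qed
    define EE where "EE = (\<Union>(x,i,j)\<in>S \<times> {..<n} \<times> {..<n}. E x i j)"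
    show "\<exists>E\<in>sets M. measure M E \<le> real (card S) * (real n)\<^sup>2 * (1 - q) ^ (n - 2) \<and>
         (\<forall>w\<in>space M - E. \<forall>x\<in>A. \<forall>i<n. \<forall>j<n. \<exists>k<n. k \<noteq> i \<and> k \<noteq> j \<and> dist x (al k w) < h)"
    proof (intro bexI[of _ EE] conjI ballI allI impI)
      have "measure M EE \<le> (\<Sum>(x,i,j)\<in>S \<times> {..<n} \<times> {..<n}. measure M (E x i j))"
        unfolding EE_def by (rule order_trans[OF finite_measure_subadditive_finite]) (use S Em in \<open>auto simp: case_prod_beta\<close>)
      also have "\<dots> \<le> (\<Sum>(x,i,j)\<in>S \<times> {..<n} \<times> {..<n}. (1 - q) ^ (n - 2))"
        by (rule sum_mono) (use El in auto)
      also have "\<dots> = real (card S) * (real n)\<^sup>2 * (1 - q) ^ (n - 2)"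
        by (simp add: case_prod_beta card_cartesian_product power2_eq_square)
      finally show "measure M EE \<le> real (card S) * (real n)\<^sup>2 * (1 - q) ^ (n - 2)" .
      fix w x i j assume w: "w \<in> space M - EE" and x: "x \<in> A" and ij: "i < n" "j < n"
      obtain s where s: "s \<in> S" "x \<in> ball s (h/2)" using S x by blast
      have "w \<notin> E s i j" using w s ij by (auto simp: EE_def)
      then obtain k where k: "k < n" "k \<noteq> i" "k \<noteq> j" "al k w \<in> ball s (h/2)"
        using w by (auto simp: E_def)
      have "dist x (al k w) < h" using s k dist_triangle_half_r[of s x h "al k w"] by (simp add: dist_commute)
      with k show "\<exists>k<n. k \<noteq> i \<and> k \<noteq> j \<and> dist x (al k w) < h" by blast
    next
      show "EE \<in> sets M" unfolding EE_def using S Em by (intro sets.finite_UN) auto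
    qed
  qed simp
qed

text \<open>With \<open>s = sqrt (1 - q)\<close> the claim reduces to \<open>n * s ^ n\<close>
  tending to 0; the shift by 2 removes the truncated subtraction.\<close>

lemma square_times_geometric_LIMSEQ:
  fixes q :: real
  assumes "0 < q" "q \<le> 1"
  shows "(\<lambda>n. N * (real n)\<^sup>2 * (1 - q) ^ (n - 2)) \<longlonglongrightarrow> 0"
proof (rule LIMSEQ_offset[of _ 2])
  define s where "s = sqrt (1 - q)"
  have s: "0 \<le> s" "s < 1" "s ^ 2 = 1 - q" using assms by (auto simp: s_def)
  then have "norm s < 1" by simp
  then have lims: "(\<lambda>n. real n * s ^ n) \<longlonglongrightarrow> 0" "(\<lambda>n. s ^ n) \<longlonglongrightarrow> 0"
    by (rule powser_times_n_limit_0, rule LIMSEQ_power_zero)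
  have "(\<lambda>n. N * (real n * s ^ n + 2 * s ^ n)\<^sup>2) \<longlonglongrightarrow> N * (0 + 2 * 0)\<^sup>2"
    by (intro tendsto_mult tendsto_power tendsto_add tendsto_const lims)
  moreover have "N * (real n * s ^ n + 2 * s ^ n)\<^sup>2 = N * (real (n + 2))\<^sup>2 * (1 - q) ^ (n + 2 - 2)" for n
  proof -
    have "(1 - q) ^ n = (s ^ n)\<^sup>2" by (simp add: s(3)[symmetric] power_mult[symmetric] mult.commute)
    then show ?thesis by (simp add: power_mult_distrib[symmetric] distrib_right add.commute)
  qed
  ultimately show "(\<lambda>n. N * (real (n + 2))\<^sup>2 * (1 - q) ^ (n + 2 - 2)) \<longlonglongrightarrow> 0" by simp
qed

subsection \<open>Noise in the pseudo-max distance\<close>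

lemma abs_alternating_sum_le:
  fixes c :: real
  assumes "\<bar>a1\<bar> \<le> c" "\<bar>a2\<bar> \<le> c" "\<bar>a3\<bar> \<le> c" "\<bar>a4\<bar> \<le> c" "\<bar>a5\<bar> \<le> c" "\<bar>a6\<bar> \<le> c"
  shows "\<bar>a1 - a2 + a3 - a4 + a5 - a6\<bar> \<le> 6 * c"
  using assms by (auto simp: abs_le_iff)

text \<open>For fixed \<open>k\<close> the difference consists of six cross sums between distinct
  columns, as \<open>k\<close> avoids \<open>i\<close> and \<open>j\<close>. Uncentred sums of
  squares never enter, which is why no constant \<open>rho_0\<close> appears. Passing to the maximum
  over \<open>k\<close> does not increase the error.\<close>

lemma pmd_perturbation:
  assumes y: "y \<ge> 0" and R: "card R > 0"
    and Hu: "\<And>i k. i < n \<Longrightarrow> k < n \<Longrightarrow> i \<noteq> k \<Longrightarrow> \<bar>\<Sum>l\<in>R. H i l * v k l\<bar> \<le> 2 * y"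
    and uu: "\<And>i k. i < n \<Longrightarrow> k < n \<Longrightarrow> i \<noteq> k \<Longrightarrow> \<bar>\<Sum>l\<in>R. v i l * v k l\<bar> \<le> 2 * y"
    and ij: "i < n" "j < n"
  shows "\<bar>pmd R n (\<lambda>i l. H i l + v i l) i j - pmd R n H i j\<bar> \<le> 12 * y / real (card R)"
proof -
  let ?X = "\<lambda>i l. H i l + v i l" and ?m = "real (card R)"
  define SX where "SX k = (\<Sum>l\<in>R. (?X i l - ?X j l) * ?X k l)" for k
  define SH where "SH k = (\<Sum>l\<in>R. (H i l - H j l) * H k l)" for k
  have d: "\<bar>SX k - SH k\<bar> \<le> 12 * y" if k: "k < n" "k \<noteq> i" "k \<noteq> j" for k
  proof -
    have "SX k - SH k = (\<Sum>l\<in>R. H i l * v k l) - (\<Sum>l\<in>R. H j l * v k l) + (\<Sum>l\<in>R. H k l * v i l)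
       - (\<Sum>l\<in>R. H k l * v j l) + (\<Sum>l\<in>R. v i l * v k l) - (\<Sum>l\<in>R. v j l * v k l)"
      unfolding SX_def SH_def sum_subtractf[symmetric] sum.distrib[symmetric]
      by (rule sum.cong) (simp_all add: algebra_simps)
    also have "\<bar>\<dots>\<bar> \<le> 6 * (2 * y)"
      by (intro abs_alternating_sum_le Hu uu ij k) (use k in auto)
    finally show ?thesis by simp
  qed
  have ge: "\<bar>SX k\<bar> / ?m \<le> pmd R n ?X i j" "\<bar>SH k\<bar> / ?m \<le> pmd R n H i j" if "k < n" "k \<noteq> i" "k \<noteq> j" for k
    using pmd_ge[OF that, where R = R and Y = ?X] pmd_ge[OF that, where R = R and Y = H]
    unfolding SX_def SH_def by auto
  have "pmd R n ?X i j \<le> pmd R n H i j + 12 * y / ?m"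
  proof (rule pmd_le)
    fix k assume k: "k < n" "k \<noteq> i" "k \<noteq> j"
    have "\<bar>SX k\<bar> \<le> \<bar>SH k\<bar> + 12 * y" using d[OF k] by linarith
    then have "\<bar>SX k\<bar> / ?m \<le> (\<bar>SH k\<bar> + 12 * y) / ?m" by (rule divide_right_mono) simp
    also have "\<dots> \<le> pmd R n H i j + 12 * y / ?m" using ge(2)[OF k] by (simp add: add_divide_distrib)
    finally show "\<bar>\<Sum>l\<in>R. (?X i l - ?X j l) * ?X k l\<bar> / ?m \<le> pmd R n H i j + 12 * y / ?m" unfolding SX_def .
  qed (use y pmd_nonneg in simp)
  moreover have "pmd R n H i j \<le> pmd R n ?X i j + 12 * y / ?m"
  proof (rule pmd_le)
    fix k assume k: "k < n" "k \<noteq> i" "k \<noteq> j"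
    have "\<bar>SH k\<bar> \<le> \<bar>SX k\<bar> + 12 * y" using d[OF k] by linarith
    then have "\<bar>SH k\<bar> / ?m \<le> (\<bar>SX k\<bar> + 12 * y) / ?m" by (rule divide_right_mono) simp
    also have "\<dots> \<le> pmd R n ?X i j + 12 * y / ?m" using ge(1)[OF k] by (simp add: add_divide_distrib)
    finally show "\<bar>\<Sum>l\<in>R. (H i l - H j l) * H k l\<bar> / ?m \<le> pmd R n ?X i j + 12 * y / ?m" unfolding SH_def .
  qed (use y pmd_nonneg in simp)
  ultimately show ?thesis by linarith
qed

definition deviation_tail :: "real \<Rightarrow> real \<Rightarrow> real \<Rightarrow> real \<Rightarrow> real \<Rightarrow> real" where
  "deviation_tail L nu m lam y = 2 * exp (2 * (1 + L) * lam\<^sup>2 * m - lam * y)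
      + (m * (lam powr nu * L) + m\<^sup>2 * (lam powr (1 + nu) * L)\<^sup>2) / y\<^sup>2"

lemma prob_pmd_perturbation:
  fixes u :: "nat \<Rightarrow> nat \<Rightarrow> 'w \<Rightarrow> real" and H :: "'w \<Rightarrow> nat \<Rightarrow> nat \<Rightarrow> real"
  assumes cif: "cond_indep_family M F (\<lambda>(i, l). u i l) {(i, l). i < n \<and> l < p}"
    and R: "R \<subseteq> {..<p}" "card R > 0"
    and HF: "\<And>i l. i < n \<Longrightarrow> l \<in> R \<Longrightarrow> (\<lambda>w. H w i l) \<in> borel_measurable F"
    and HM: "\<And>i l. i < n \<Longrightarrow> (\<lambda>w. H w i l) \<in> borel_measurable M"
    and B: "\<And>i l w. w \<in> space M \<Longrightarrow> \<bar>H w i l\<bar> \<le> B" "B \<ge> 0"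
    and G: "G \<in> sets F" and L: "L \<ge> 0" and nu: "nu > 0"
    and U_mom: "\<And>i l. i < n \<Longrightarrow> l < p \<Longrightarrow> AE w in M. w \<in> G \<longrightarrow>
        nn_cond_exp M F (\<lambda>w. ennreal (\<bar>u i l w\<bar> powr (2 + nu))) w \<le> ennreal L"
    and mean0: "\<And>i l. i < n \<Longrightarrow> l < p \<Longrightarrow> AE w in M. nn_cond_exp M F (\<lambda>w. ennreal (max (u i l w) 0)) w
        = nn_cond_exp M F (\<lambda>w. ennreal (max (- u i l w) 0)) w"
    and lam: "lam > 0" and y: "y > 0"
  defines "T \<equiv> deviation_tail (L * max L (B powr (2 + nu))) nu (real (card R)) lam y"
  shows "\<exists>E\<in>sets M. measure M E \<le> 2 * (real n)\<^sup>2 * T \<and>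
    (\<forall>w\<in>space M - E. w \<in> G \<longrightarrow> (\<forall>i<n. \<forall>j<n.
       \<bar>pmd R n (\<lambda>i l. H w i l + u i l w) i j - pmd R n (H w) i j\<bar> \<le> 12 * y / real (card R)))"
proof -
  interpret cond_indep_family M F "\<lambda>(i, l). u i l" "{(i, l). i < n \<and> l < p}" by fact
  let ?L2 = "max L (B powr (2 + nu))" and ?m = "real (card R)"
  have um [measurable]: "u i l \<in> borel_measurable M" for i l using U_meas[of "(i, l)"] by simp
  have GM [measurable]: "G \<in> sets M" using G subalg by (auto simp: subalgebra_def)
  have finR: "finite R" using R(1) finite_subset by blast
  have T0: "T \<ge> 0" unfolding T_def deviation_tail_def using L by (auto intro!: add_nonneg_nonneg mult_nonneg_nonneg divide_nonneg_nonneg)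
  define E1 where "E1 i k = {w \<in> space M. w \<in> G \<and> 2 * y \<le> \<bar>\<Sum>l\<in>R. H w i l * u k l w\<bar>}" for i k
  \<comment> \<open>A sum of squares is not centred, so the diagonal is left out. \<open>E1\<close>
    keeps it, its coefficient being \<open>F\<close>-measurable.\<close>
  define E2 where "E2 i k = (if i = k then {} else {w \<in> space M. w \<in> G \<and> 2 * y \<le> \<bar>\<Sum>l\<in>R. u i l w * u k l w\<bar>})" for i k
  have Em: "E1 i k \<in> sets M" "E2 i k \<in> sets M" if "i < n" for i k
  proof -
    note [measurable] = HM[OF that]
    show "E1 i k \<in> sets M" unfolding E1_def by measurable
    have "{w \<in> space M. w \<in> G \<and> 2 * y \<le> \<bar>\<Sum>l\<in>R. u i l w * u k l w\<bar>} \<in> sets M" by measurable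
    then show "E2 i k \<in> sets M" unfolding E2_def by simp
  qed
  have E1: "measure M (E1 i k) \<le> T" if ik: "i < n" "k < n" for i k
  proof -
    have "truncation M R (\<lambda>l w. H w i l * (case (k, l) of (i, l) \<Rightarrow> u i l) w) G (L * ?L2) nu"
      by (rule truncation_fixed_times_noise[OF finR _ _ HF[OF ik(1)] HM[OF ik(1)] B(1) B(2) _ G L nu])
        (use R ik U_mom mean0 in \<open>auto simp: inj_on_def\<close>)
    then have "truncation M R (\<lambda>l w. H w i l * u k l w) G (L * ?L2) nu" by simp
    from truncation.deviation_bound[OF this lam y] show ?thesis
      unfolding E1_def T_def deviation_tail_def .
  qed
  have E2: "measure M (E2 i k) \<le> T" if ik: "i < n" "k < n" for i k
  proof (cases "i = k")
    case False
    have "truncation M R (\<lambda>l w. (case (i, l) of (i, l) \<Rightarrow> u i l) w * (case (k, l) of (i, l) \<Rightarrow> u i l) w) G (L * ?L2) nu"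
      by (rule truncation_noise_times_noise[OF finR _ _ _ _ G L _ nu])
        (use R ik False U_mom mean0 in \<open>auto simp: inj_on_def\<close>)
    then have "truncation M R (\<lambda>l w. u i l w * u k l w) G (L * ?L2) nu" by simp
    from truncation.deviation_bound[OF this lam y] show ?thesis
      using False unfolding E2_def T_def deviation_tail_def by simp
  qed (use T0 in \<open>simp add: E2_def\<close>)
  define E where "E = (\<Union>(i,k)\<in>{..<n} \<times> {..<n}. E1 i k \<union> E2 i k)"
  show ?thesis
  proof (intro bexI[of _ E] conjI ballI impI allI)
    show "E \<in> sets M" unfolding E_def using Em by (intro sets.finite_UN) auto
    have "measure M E \<le> (\<Sum>(i,k)\<in>{..<n} \<times> {..<n}. measure M (E1 i k \<union> E2 i k))"
      unfolding E_def by (rule order_trans[OF finite_measure_subadditive_finite]) (use Em in \<open>auto simp: case_prod_beta\<close>)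
    also have "\<dots> \<le> (\<Sum>(i,k)\<in>{..<n} \<times> {..<n}. 2 * T)"
    proof (rule sum_mono, unfold case_prod_beta)
      fix x assume "x \<in> {..<n} \<times> {..<n}"
      then have x: "fst x < n" "snd x < n" by auto
      show "measure M (E1 (fst x) (snd x) \<union> E2 (fst x) (snd x)) \<le> 2 * T"
        using measure_Un_le[OF Em(1)[OF x(1)] Em(2)[OF x(1)], of "snd x" "snd x"] E1[OF x] E2[OF x] by linarith
    qed
    also have "\<dots> = 2 * (real n)\<^sup>2 * T" by (simp add: case_prod_beta card_cartesian_product power2_eq_square)
    finally show "measure M E \<le> 2 * (real n)\<^sup>2 * T" .
    fix w i j assume w: "w \<in> space M - E" "w \<in> G" and ij: "i < n" "j < n"
    show "\<bar>pmd R n (\<lambda>i l. H w i l + u i l w) i j - pmd R n (H w) i j\<bar> \<le> 12 * y / ?m"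
    proof (rule pmd_perturbation[OF _ R(2) _ _ ij])
      show "0 \<le> y" using y by simp
      fix i k assume ik: "i < n" "k < n" "i \<noteq> k"
      then have "w \<notin> E1 i k" "w \<notin> E2 i k" using w by (auto simp: E_def)
      then show "\<bar>\<Sum>l\<in>R. H w i l * u k l w\<bar> \<le> 2 * y" "\<bar>\<Sum>l\<in>R. u i l w * u k l w\<bar> \<le> 2 * y"
        using w ik by (auto simp: E1_def E2_def)
    qed
  qed
qed

section \<open>Stochastic order and the rate condition\<close>

text \<open>An upper limit of probabilities is never negative, so only upper bounds are needed. They
  may hold from an \<open>n\<close> on that depends on \<open>eps\<close>, as the limit in
  \<open>n\<close> is taken first.\<close>

lemma lesssim_PI:
  assumes "\<And>d. d > 0 \<Longrightarrow> \<exists>e0. \<forall>eps\<ge>e0. \<forall>\<^sub>F n in sequentially.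
     measure (M n) {w \<in> space (M n). ereal eps * \<bar>B n w\<bar> \<le> \<bar>A n w\<bar>} \<le> d"
  shows "lesssim_P M A B"
  unfolding lesssim_P_def
proof (rule order_tendstoI)
  let ?m = "\<lambda>eps n. measure (M n) {w \<in> space (M n). ereal eps * \<bar>B n w\<bar> \<le> \<bar>A n w\<bar>}"
  fix a :: ereal assume a: "a < 0"
  have "0 \<le> Limsup sequentially (\<lambda>n. ereal (?m eps n))" for eps
    by (rule le_Limsup) auto
  then have "a < Limsup sequentially (\<lambda>n. ereal (?m eps n))" for eps
    using less_le_trans[OF a] by blast
  then show "\<forall>\<^sub>F eps in at_top. a < Limsup sequentially (\<lambda>n. ereal (?m eps n))"
    by simp
next
  let ?m = "\<lambda>eps n. measure (M n) {w \<in> space (M n). ereal eps * \<bar>B n w\<bar> \<le> \<bar>A n w\<bar>}"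
  fix a :: ereal assume "0 < a"
  then obtain d where d: "0 < ereal d" "ereal d < a" using ereal_dense2 by blast
  then obtain e0 where e0: "\<And>eps. eps \<ge> e0 \<Longrightarrow> \<forall>\<^sub>F n in sequentially. ?m eps n \<le> d"
    using assms[of d] by auto
  have "Limsup sequentially (\<lambda>n. ereal (?m eps n)) < a" if "eps \<ge> e0" for eps
  proof -
    have "Limsup sequentially (\<lambda>n. ereal (?m eps n)) \<le> ereal d"
      using e0[OF that] by (intro Limsup_bounded) auto
    then show ?thesis using d(2) by (rule le_less_trans)
  qed
  then show "\<forall>\<^sub>F eps in at_top. Limsup sequentially (\<lambda>n. ereal (?m eps n)) < a"
    unfolding eventually_at_top_linorder by blast
qed

lemma Limsup_tendsto_0_D:
  fixes f :: "real \<Rightarrow> nat \<Rightarrow> real"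
  assumes "((\<lambda>x. Limsup sequentially (\<lambda>n. ereal (f x n))) \<longlongrightarrow> 0) F" "d > 0"
  shows "\<forall>\<^sub>F x in F. \<forall>\<^sub>F n in sequentially. f x n < d"
proof -
  have "\<forall>\<^sub>F x in F. Limsup sequentially (\<lambda>n. ereal (f x n)) < ereal d"
    using assms by (intro order_tendstoD) auto
  then show ?thesis
  proof eventually_elim
    case (elim x)
    from Limsup_lessD[OF this] show ?case by simp
  qed
qed

text \<open>Raising the rate condition to the power \<open>nu / 2\<close> gives \<open>n^2 * (ln n)
  powr (nu / 2 - 1) \<le> C powr (nu / 2) * p powr (nu / 2)\<close>; one more factor
  \<open>ln n\<close> completes the power of \<open>ln n / p\<close>.\<close>

lemma rate_powr_bound:
  fixes n p C nu :: real
  assumes n: "n > 1" and p: "p > 0" and nu: "nu > 0"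
    and rate: "n powr (4 / nu) * ln n powr ((nu - 2) / nu) / p \<le> C"
  shows "n\<^sup>2 * (sqrt (ln n / p)) powr nu \<le> C powr (nu / 2) * ln n"
proof -
  let ?l = "ln n"
  have l: "?l > 0" using n by simp
  have "n powr (4 / nu) * ?l powr ((nu - 2) / nu) \<le> C * p" using rate p by (simp add: field_simps)
  then have "(n powr (4 / nu) * ?l powr ((nu - 2) / nu)) powr (nu / 2) \<le> (C * p) powr (nu / 2)"
    using nu by (intro powr_mono2) auto
  moreover have "(n powr (4 / nu) * ?l powr ((nu - 2) / nu)) powr (nu / 2) = n\<^sup>2 * ?l powr (nu / 2 - 1)"
  proof -
    have "4 / nu * (nu / 2) = 2" "(nu - 2) / nu * (nu / 2) = nu / 2 - 1" using nu by (auto simp: field_simps)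
    then show ?thesis using n by (simp only: powr_mult powr_powr powr_ge_zero) simp
  qed
  moreover have C0: "C \<ge> 0" using rate p order_trans[OF _ rate, of 0] by simp
  ultimately have *: "n\<^sup>2 * ?l powr (nu / 2 - 1) \<le> C powr (nu / 2) * p powr (nu / 2)"
    using p by (simp add: powr_mult)
  have "(sqrt (?l / p)) powr nu = ?l powr (nu / 2) / p powr (nu / 2)"
    using l p by (simp add: powr_half_sqrt[symmetric] powr_powr powr_divide)
  also have "?l powr (nu / 2) = ?l powr (nu / 2 - 1) * ?l"
    using l by (simp add: powr_diff)
  finally have "n\<^sup>2 * (sqrt (?l / p)) powr nu = (n\<^sup>2 * ?l powr (nu / 2 - 1)) * ?l / p powr (nu / 2)" by simp
  also have "\<dots> \<le> (C powr (nu / 2) * p powr (nu / 2)) * ?l / p powr (nu / 2)"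
    using * l by (intro divide_right_mono mult_right_mono) auto
  also have "\<dots> = C powr (nu / 2) * ?l" using p by simp
  finally show ?thesis .
qed

text \<open>\<open>y = eps * d * m / 24\<close> makes the perturbation \<open>12 * y / m\<close>
  equal to \<open>eps * d / 2\<close>. The lower bound on \<open>eps\<close> pushes the Chernoff
  exponent down to \<open>- 3 * ln n\<close>, which beats the \<open>n^2\<close> pairs; 1152 is
  \<open>2 * 24^2\<close>.\<close>

lemma deviation_tail_bound:
  fixes n p m c C L nu eps :: real
  assumes n: "n > 1" and p: "p > 0" and nu: "nu > 0" and c: "c > 0" and m: "c * p \<le> m"
    and rate: "n powr (4 / nu) * ln n powr ((nu - 2) / nu) / p \<le> C" and L: "L \<ge> 0"
    and eps: "eps \<ge> 24 * (2 * (1 + L) + 3 / c)"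
  defines "d \<equiv> sqrt (ln n / p)" and "C' \<equiv> C powr (nu / 2)"
  shows "2 * n\<^sup>2 * deviation_tail L nu m d (eps * d * m / 24)
    \<le> 4 / n + 1152 * (L * C' / c + L\<^sup>2 * C'\<^sup>2) / eps\<^sup>2"
proof -
  let ?l = "ln n" and ?y = "eps * d * m / 24"
  define q where "q = d powr nu"
  have l: "?l > 0" using n by simp
  have d: "d > 0" and d2: "d\<^sup>2 = ?l / p" using l p by (auto simp: d_def)
  have m0: "m > 0" using m c p by (meson less_le_trans mult_pos_pos)
  have "0 < 24 * (2 * (1 + L) + 3 / c)" using c L by (intro mult_pos_pos add_nonneg_pos) auto
  then have eps0: "eps > 0" using eps by (rule less_le_trans)
  have q: "n\<^sup>2 * q \<le> C' * ?l" "q > 0" using rate_powr_bound[OF n p nu rate] d by (auto simp: q_def d_def C'_def)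
  have C': "C' \<ge> 0" by (simp add: C'_def)
  have dm: "c * ?l \<le> d\<^sup>2 * m"
  proof -
    have "c * ?l = ?l / p * (c * p)" using p by simp
    also have "\<dots> \<le> ?l / p * m" using m l p by (intro mult_left_mono) auto
    finally show ?thesis by (simp add: d2)
  qed
  have "2 * (1 + L) * d\<^sup>2 * m - d * ?y = - ((d\<^sup>2 * m) * (eps / 24 - 2 * (1 + L)))"
    by (simp add: algebra_simps power2_eq_square)
  also have "\<dots> \<le> - ((c * ?l) * (3 / c))"
  proof -
    have "3 / c \<le> eps / 24 - 2 * (1 + L)" using eps by simp
    then have "(c * ?l) * (3 / c) \<le> (d\<^sup>2 * m) * (eps / 24 - 2 * (1 + L))"
      by (rule mult_mono[OF dm]) (use c d m0 in auto)
    then show ?thesis by simp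
  qed
  also have "\<dots> = - (3 * ?l)" using c by simp
  finally have "exp (2 * (1 + L) * d\<^sup>2 * m - d * ?y) \<le> exp (- (3 * ?l))" by simp
  also have "exp (- (3 * ?l)) = 1 / n ^ 3"
  proof -
    have "exp (3 * ?l) = exp ?l ^ 3" using exp_of_nat_mult[of 3 ?l] by simp
    then show ?thesis using n by (simp add: exp_minus inverse_eq_divide)
  qed
  finally have "2 * n\<^sup>2 * (2 * exp (2 * (1 + L) * d\<^sup>2 * m - d * ?y)) \<le> 2 * n\<^sup>2 * (2 * (1 / n ^ 3))"
    by (intro mult_left_mono) auto
  also have "\<dots> = 4 / n" using n by (simp add: power2_eq_square power3_eq_cube)
  finally have e: "2 * n\<^sup>2 * (2 * exp (2 * (1 + L) * d\<^sup>2 * m - d * ?y)) \<le> 4 / n" .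
  \<comment> \<open>Diagonal part: \<open>n^2 * q\<close> is at most, and \<open>d^2 * m\<close> at
    least, a multiple of \<open>ln n\<close>, so the logarithms cancel.\<close>
  have t1: "2 * n\<^sup>2 * (m * (q * L) / ?y\<^sup>2) \<le> 1152 * (L * C' / c) / eps\<^sup>2"
  proof -
    have "2 * n\<^sup>2 * (m * (q * L) / ?y\<^sup>2) = 1152 * L / eps\<^sup>2 * ((n\<^sup>2 * q) / (d\<^sup>2 * m))"
      using m0 d eps0 by (simp add: power2_eq_square field_simps)
    also have "\<dots> \<le> 1152 * L / eps\<^sup>2 * ((C' * ?l) / (c * ?l))"
      using q dm c l L C' m0 d by (intro mult_left_mono frac_le) auto
    also have "\<dots> = 1152 * (L * C' / c) / eps\<^sup>2" using l by (simp add: mult_ac)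
    finally show ?thesis .
  qed
  \<comment> \<open>Off-diagonal part: \<open>q\<close> occurs squared, which leaves a spare
    \<open>1 / n\<close> under the square to absorb the logarithm.\<close>
  have t2: "2 * n\<^sup>2 * (m\<^sup>2 * (d powr (1 + nu) * L)\<^sup>2 / ?y\<^sup>2) \<le> 1152 * (L\<^sup>2 * C'\<^sup>2) / eps\<^sup>2"
  proof -
    have "d powr (1 + nu) = d * q" using d by (simp add: powr_add q_def)
    then have "2 * n\<^sup>2 * (m\<^sup>2 * (d powr (1 + nu) * L)\<^sup>2 / ?y\<^sup>2) = 1152 * L\<^sup>2 / eps\<^sup>2 * (n\<^sup>2 * q / n)\<^sup>2"
      using m0 d eps0 n by (simp add: power2_eq_square field_simps)
    also have "\<dots> \<le> 1152 * L\<^sup>2 / eps\<^sup>2 * C'\<^sup>2"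
    proof (intro mult_left_mono power_mono)
      have "n\<^sup>2 * q / n \<le> C' * ?l / n" using q n by (intro divide_right_mono) auto
      also have "\<dots> \<le> C' * 1"
        unfolding times_divide_eq_right[symmetric] using C' n ln_le_minus_one[of n] by (intro mult_left_mono) auto
      finally show "n\<^sup>2 * q / n \<le> C'" by simp
    qed (use q n in auto)
    finally show ?thesis by simp
  qed
  have "2 * n\<^sup>2 * deviation_tail L nu m d ?y = 2 * n\<^sup>2 * (2 * exp (2 * (1 + L) * d\<^sup>2 * m - d * ?y))
     + 2 * n\<^sup>2 * (m * (q * L) / ?y\<^sup>2) + 2 * n\<^sup>2 * (m\<^sup>2 * (d powr (1 + nu) * L)\<^sup>2 / ?y\<^sup>2)"
    unfolding deviation_tail_def q_def[symmetric] by (simp only: distrib_left add_divide_distrib add.assoc)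
  also have "\<dots> \<le> 4 / n + 1152 * (L * C' / c) / eps\<^sup>2 + 1152 * (L\<^sup>2 * C'\<^sup>2) / eps\<^sup>2"
    using e t1 t2 by linarith
  also have "\<dots> = 4 / n + 1152 * (L * C' / c + L\<^sup>2 * C'\<^sup>2) / eps\<^sup>2"
    by (simp add: add_divide_distrib distrib_left)
  finally show ?thesis .
qed

subsection \<open>Indirect matching\<close>

lemma gen_sigma_generator_subset: "(\<Union>g\<in>Gs. {g -` B \<inter> space M | B. B \<in> sets borel}) \<subseteq> Pow (space M)"
  by auto

lemma space_gen_sigma: "space (gen_sigma M Gs) = space M"
  unfolding gen_sigma_def by (simp add: space_measure_of_conv)

lemma measurable_gen_sigma:
  assumes "g \<in> Gs"
  shows "g \<in> borel_measurable (gen_sigma M Gs)"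
proof (rule measurableI)
  fix B :: "real set" assume "B \<in> sets borel"
  with assms have "g -` B \<inter> space M \<in> sets (gen_sigma M Gs)"
    unfolding gen_sigma_def sets_measure_of[OF gen_sigma_generator_subset] by (intro sigma_sets.Basic) blast
  then show "g -` B \<inter> space (gen_sigma M Gs) \<in> sets (gen_sigma M Gs)" by (simp add: space_gen_sigma)
qed simp

lemma subalgebra_gen_sigma:
  assumes "\<And>g. g \<in> Gs \<Longrightarrow> g \<in> borel_measurable M"
  shows "subalgebra M (gen_sigma M Gs)"
  unfolding subalgebra_def
proof
  show "sets (gen_sigma M Gs) \<subseteq> sets M"
    unfolding gen_sigma_def sets_measure_of[OF gen_sigma_generator_subset]
    by (rule sets.sigma_sets_subset) (use assms in \<open>auto intro: measurable_sets\<close>)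
qed (rule space_gen_sigma)

lemma borel_measurable_vecI:
  fixes f :: "'w \<Rightarrow> real^'r::finite"
  assumes "\<And>k. (\<lambda>w. f w $ k) \<in> borel_measurable N"
  shows "f \<in> borel_measurable N"
  by (subst borel_measurable_euclidean_space) (use assms in \<open>auto simp: Basis_vec_def inner_axis\<close>)

lemma pmd_less_sets:
  assumes Y: "\<And>i l. i < n \<Longrightarrow> (\<lambda>w. Y w i l) \<in> borel_measurable M" and ij: "i < n" "j < n" and D: "D > 0"
  shows "{w \<in> space M. pmd R n (Y w) i j < D} \<in> sets M"
proof -
  have "pmd R n (Y w) i j < D \<longleftrightarrow> (\<forall>k\<in>{..<n} - {i,j}. \<bar>\<Sum>l\<in>R. (Y w i l - Y w j l) * Y w k l\<bar> / real (card R) < D)" for w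
    unfolding pmd_def using D by (subst Max_less_iff) auto
  moreover have "{w \<in> space M. \<forall>k\<in>{..<n} - {i,j}. \<bar>\<Sum>l\<in>R. (Y w i l - Y w j l) * Y w k l\<bar> / real (card R) < D} \<in> sets M"
  proof (rule sets.sets_Collect_finite_All)
    fix k assume "k \<in> {..<n} - {i,j}"
    then have [measurable]: "(\<lambda>w. Y w k l) \<in> borel_measurable M" "(\<lambda>w. Y w i l) \<in> borel_measurable M"
      "(\<lambda>w. Y w j l) \<in> borel_measurable M" for l using Y ij by auto
    show "{w \<in> space M. \<bar>\<Sum>l\<in>R. (Y w i l - Y w j l) * Y w k l\<bar> / real (card R) < D} \<in> sets M" by measurable
  qed simp
  ultimately show ?thesis by simp
qed

lemma abs_Max_insert_0_le:
  fixes c :: real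
  assumes "finite S" "0 \<le> c" "\<And>s. s \<in> S \<Longrightarrow> s \<le> c"
  shows "\<bar>Max (insert 0 S)\<bar> \<le> c"
proof -
  have "0 \<le> Max (insert 0 S)" using assms(1) by (intro Max_ge) auto
  moreover have "Max (insert 0 S) \<le> c" using assms by (intro Max.boundedI) auto
  ultimately show ?thesis by simp
qed

lemma ereal_le_abs: "x \<le> \<bar>x\<bar>" for x :: ereal
  by (cases x) auto

theorem mainTheorem6:
  fixes M :: "nat \<Rightarrow> 'w measure"
    and p :: "nat \<Rightarrow> nat"
    and Rd :: "nat \<Rightarrow> nat set"
    and alpha :: "nat \<Rightarrow> nat \<Rightarrow> 'w \<Rightarrow> real^'r::finite"
    and eta :: "nat \<Rightarrow> nat \<Rightarrow> 'w \<Rightarrow> real^'r \<Rightarrow> real"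
    and u :: "nat \<Rightarrow> nat \<Rightarrow> nat \<Rightarrow> 'w \<Rightarrow> real"
    and e :: "nat \<Rightarrow> 'w \<Rightarrow> real^'r \<Rightarrow> 'r \<Rightarrow> nat \<Rightarrow> real"
    and A :: "(real^'r) set"
    and dens :: "real^'r \<Rightarrow> ennreal"
    and mbar :: nat
    and nu :: real
  defines "F \<equiv> \<lambda>n. gen_sigma (M n)
             ({\<lambda>w. alpha n i w $ k | i k. i < n} \<union> {\<lambda>w. eta n l w a | l a. l < p n})"
    and "H \<equiv> \<lambda>n w i l. eta n l w (alpha n i w)"
    and "X \<equiv> \<lambda>n w i l. eta n l w (alpha n i w) + u n i l w"
  assumes prob: "\<And>n. prob_space (M n)"
    \<comment> \<open>asymptotic regime: n \<rightarrow> \<infinity>, p = p n \<rightarrow> \<infinity>; row split with p\<dagger> \<asymp> p\<ddagger> \<asymp> p\<close>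
    and p_lim: "filterlim p at_top sequentially"
    and Rd_sub: "\<And>n. Rd n \<subseteq> {..<p n}"
    and Rd_size: "\<exists>c>0. \<forall>\<^sub>F n in sequentially.
                    c * real (p n) \<le> real (card (Rd n)) \<and>
                    c * real (p n) \<le> real (card ({..<p n} - Rd n))"
    \<comment> \<open>Assumption 1(a)\<close>
    and A_compact: "compact A" and A_convex: "convex A"
    and dens_bounds: "\<exists>c C. 0 < c \<and> (\<forall>a\<in>A. ennreal c \<le> dens a \<and> dens a \<le> ennreal C)"
    and dens_zero: "\<And>a. a \<notin> A \<Longrightarrow> dens a = 0"
    and alpha_distr: "\<And>n i. i < n \<Longrightarrow> distributed (M n) lborel (alpha n i) dens"
    and alpha_indep: "\<And>n. prob_space.indep_vars (M n) (\<lambda>_. borel) (alpha n) {..<n}"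
    \<comment> \<open>Assumption 1(b)\<close>
    and mbar_ge: "mbar \<ge> 2"
    and eta_meas: "\<And>n l a. (\<lambda>w. eta n l w a) \<in> borel_measurable (M n)"
    and eta_smooth: "\<And>n l w. w \<in> space (M n) \<Longrightarrow> Ck mbar (eta n l w)"
    and eta_bdd: "\<exists>B. \<forall>n l w ks a. w \<in> space (M n) \<longrightarrow> length ks \<le> mbar \<longrightarrow>
                     \<bar>pderivs ks (eta n l w) a\<bar> \<le> B"
    \<comment> \<open>Assumption 1(c) and E[u | F] = 0\<close>
    and nu_pos: "nu > 0"
    and u_meas: "\<And>n i l. u n i l \<in> borel_measurable (M n)"
    and u_mean0: "\<And>n i l. i < n \<Longrightarrow> l < p n \<Longrightarrow>
        AE w in M n. nn_cond_exp (M n) (F n) (\<lambda>w. ennreal (max (u n i l w) 0)) w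
                   = nn_cond_exp (M n) (F n) (\<lambda>w. ennreal (max (- u n i l w) 0)) w"
    and u_indep: "\<And>n. cond_indep (M n) (F n) (\<lambda>(i, l). u n i l) {(i, l). i < n \<and> l < p n}"
    and u_mom: "\<And>n i l. i < n \<Longrightarrow> l < p n \<Longrightarrow>
        AE w in M n. nn_cond_exp (M n) (F n) (\<lambda>w. ennreal (\<bar>u n i l w\<bar> powr (2 + nu))) w < \<infinity>"
    and u_mom_unif: "lesssim_P M
        (\<lambda>n w. Max (insert 0 {enn2ereal (nn_cond_exp (M n) (F n)
                                 (\<lambda>w. ennreal (\<bar>u n i l w\<bar> powr (2 + nu))) w) | i l. i < n \<and> l < p n}))
        (\<lambda>n w. 1)"
    \<comment> \<open>tangent-space bases (fixed choice; required whenever the Jacobian has rank r)\<close>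
    and e_onb: "\<And>n w a. w \<in> space (M n) \<Longrightarrow> a \<in> A \<Longrightarrow>
        full_rank_jac (Rd n) (\<lambda>l. eta n l w) a \<Longrightarrow> tangent_onb (Rd n) (\<lambda>l. eta n l w) a (e n w a)"
    \<comment> \<open>condition (i)\<close>
    and cond_i: "\<And>eps. eps > 0 \<Longrightarrow>
        ((\<lambda>Delta. Limsup sequentially (\<lambda>n. ereal (measure (M n)
            {w \<in> space (M n). \<exists>i<n. \<exists>j<n. pmd (Rd n) n (H n w) i j < Delta \<and>
                                       norm (alpha n i w - alpha n j w) > eps})))
          \<longlongrightarrow> 0) (at_right 0)"
    \<comment> \<open>condition (ii)\<close>
    and cond_ii: "\<exists>c>0. (\<lambda>n. measure (M n) {w \<in> space (M n).
            \<forall>i<n. smin (gram (Rd n) (\<lambda>l. eta n l w) (alpha n i w)) \<ge> c}) \<longlonglongrightarrow> 1"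
    \<comment> \<open>condition (iii)\<close>
    and cond_iii: "\<exists>c>0. (\<lambda>n. measure (M n) {w \<in> space (M n).
            \<forall>q. \<forall>i<n. Sup {sqnorm (Rd n) (proj_dir (Rd n) (e n w (alpha n i w) q) (\<lambda>l. eta n l w a))
                           / real (card (Rd n)) | a. a \<in> A} \<ge> c}) \<longlonglongrightarrow> 1"
    \<comment> \<open>rate condition n^(4/nu) (log n)^((nu-2)/nu) / p \<lesssim> 1\<close>
    and rate: "\<exists>C. \<forall>\<^sub>F n in sequentially.
        real n powr (4 / nu) * ln (real n) powr ((nu - 2) / nu) / real (p n) \<le> C"
  shows
    \<comment> \<open>Assumption 2(a) with rho_0 = 0 and a_n = (log n / p)^(1/2)\<close>
    "lesssim_P M
       (\<lambda>n w. ereal (Max (insert 0 {\<bar>pmd (Rd n) n (X n w) i j - pmd (Rd n) n (H n w) i j\<bar>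
                                      | i j. i < n \<and> j < n})))
       (\<lambda>n w. ereal (sqrt (ln (real n) / real (p n))))
   \<and> \<comment> \<open>Assumption 2(b) with both exponents equal to 1\<close>
     lesssim_P M
       (\<lambda>n w. ereal (Max (insert 0 {pmd (Rd n) n (H n w) i j / norm (alpha n i w - alpha n j w)
                                      | i j. i < n \<and> j < n \<and> alpha n i w \<noteq> alpha n j w})))
       (\<lambda>n w. 1)
   \<and> lesssim_P M
       (\<lambda>n w. 1)
       (\<lambda>n w. Inf {ereal (pmd (Rd n) n (H n w) i j / norm (alpha n i w - alpha n j w))
                    | i j. i < n \<and> j < n \<and> alpha n i w \<noteq> alpha n j w})"
proof -
  obtain B0 where B0: "\<And>n l w ks a. w \<in> space (M n) \<Longrightarrow> length ks \<le> mbar \<Longrightarrow> \<bar>pderivs ks (eta n l w) a\<bar> \<le> B0"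
    using eta_bdd by blast
  define B where "B = max B0 1"
  have B: "B > 0" by (simp add: B_def)
  have C2: "bounded_C2 B (eta n l w)" if "w \<in> space (M n)" for n l w
  proof (rule bounded_C2_if_Ck[OF eta_smooth[OF that] mbar_ge])
    show "\<bar>pderivs ks (eta n l w) a\<bar> \<le> B" if "length ks \<le> mbar" for ks a
      using B0[OF \<open>w \<in> space (M n)\<close> that] by (simp add: B_def le_max_iff_disj)
  qed
  have HB: "\<bar>H n w i l\<bar> \<le> B" if "w \<in> space (M n)" for n w i l
    using C2[OF that, of l] by (simp add: H_def bounded_C2_def)
  have eta_cont: "continuous_on UNIV (eta n l w)" if "w \<in> space (M n)" for n l w
    using eta_smooth[OF that] unfolding Ck_def by (metis le0 list.size(3) pderivs.simps(1))
  have alpha_meas: "alpha n i \<in> borel_measurable (M n)" if "i < n" for n i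
    using alpha_distr[OF that] by (auto simp: distributed_def)
  have HM: "(\<lambda>w. H n w i l) \<in> borel_measurable (M n)" if "i < n" for n i l
    unfolding H_def by (rule borel_measurable_caratheodory[OF eta_meas eta_cont alpha_meas[OF that]])
  have nth_meas: "(\<lambda>x::real^'r. x $ k) \<in> borel_measurable borel" for k
    by (intro borel_measurable_continuous_onI continuous_intros)
  have subF: "subalgebra (M n) (F n)" for n
    unfolding F_def
    by (rule subalgebra_gen_sigma) (auto intro!: eta_meas measurable_compose[OF alpha_meas nth_meas])
  have spaceF: "space (F n) = space (M n)" for n using subF by (simp add: subalgebra_def)
  have alphaF: "alpha n i \<in> borel_measurable (F n)" if "i < n" for n i
    unfolding F_def by (rule borel_measurable_vecI, rule measurable_gen_sigma) (use that in auto)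
  have HF: "(\<lambda>w. H n w i l) \<in> borel_measurable (F n)" if "i < n" "l < p n" for n i l
    unfolding H_def
  proof (rule borel_measurable_caratheodory[OF _ _ alphaF[OF that(1)]])
    show "(\<lambda>w. eta n l w a) \<in> borel_measurable (F n)" for a
      unfolding F_def by (rule measurable_gen_sigma) (use that in auto)
  qed (auto simp: spaceF eta_cont)
  have cif: "cond_indep_family (M n) (F n) (\<lambda>(i, l). u n i l) {(i, l). i < n \<and> l < p n}" for n
  proof -
    interpret prob_space "M n" by (rule prob)
    show ?thesis by unfold_locales (use subF u_indep u_meas in auto)
  qed
  obtain cR where cR: "cR > 0" and Rd_ev: "\<forall>\<^sub>F n in sequentially. cR * real (p n) \<le> real (card (Rd n)) \<and>
      cR * real (p n) \<le> real (card ({..<p n} - Rd n))" using Rd_size by blast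
  have Rd_le: "card (Rd n) \<le> p n" for n using card_mono[OF _ Rd_sub[of n]] by simp
  have Rd_fin: "finite (Rd n)" for n using Rd_sub finite_subset by blast
  have p_ev: "\<forall>\<^sub>F n in sequentially. p n > 0"
    using p_lim[unfolded filterlim_at_top, rule_format, of 1] by eventually_elim simp
  from dens_bounds obtain cd C where "0 < cd \<and> (\<forall>a\<in>A. ennreal cd \<le> dens a \<and> dens a \<le> ennreal C)"
    by (elim exE)
  then have cd: "cd > 0" "\<And>a. a \<in> A \<Longrightarrow> ennreal cd \<le> dens a" by auto
  have A_borel: "A \<in> sets borel" by (intro borel_closed compact_imp_closed A_compact)
  have alpha_A: "measure (M n) {w \<in> space (M n). alpha n i w \<in> A} = 1" if "i < n" for n i
    by (rule prob_in_support[OF prob alpha_distr[OF that] A_borel dens_zero])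
  \<comment> \<open>The sample of size 1 suffices: its density puts mass 1 on
    \<open>A\<close>.\<close>
  have "emeasure lborel A \<noteq> 0"
    by (rule prob_in_support(2)[OF prob[of 1] alpha_distr[of 0 1] A_borel dens_zero]) simp
  then have A_int: "interior A \<noteq> {}" by (rule convex_interior_nonempty[OF A_convex _ A_borel])

  \<comment> \<open>Noise perturbation of order \<open>sqrt (ln n / p)\<close>\<close>
  have main_a: "lesssim_P M
       (\<lambda>n w. ereal (Max (insert 0 {\<bar>pmd (Rd n) n (X n w) i j - pmd (Rd n) n (H n w) i j\<bar>
                                      | i j. i < n \<and> j < n})))
       (\<lambda>n w. ereal (sqrt (ln (real n) / real (p n))))" (is "lesssim_P M (\<lambda>n w. ereal (Max (insert 0 (?S n w)))) (\<lambda>n w. ereal (?d n))")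
  proof (rule lesssim_PI)
    fix t :: real assume t: "t > 0"
    let ?cm = "\<lambda>n i l. nn_cond_exp (M n) (F n) (\<lambda>w. ennreal (\<bar>u n i l w\<bar> powr (2 + nu)))"
    let ?MX = "\<lambda>n w. Max (insert 0 {enn2ereal (?cm n i l w) | i l. i < n \<and> l < p n})"
    \<comment> \<open>The moment level \<open>L\<close> depends on the tolerance \<open>t\<close>;
      outcomes exceeding it use up \<open>t / 3\<close>.\<close>
    have "\<forall>\<^sub>F x in at_top. \<forall>\<^sub>F n in sequentially.
        measure (M n) {w \<in> space (M n). ereal x * \<bar>1\<bar> \<le> \<bar>?MX n w\<bar>} < t / 3"
      using u_mom_unif t unfolding lesssim_P_def by (intro Limsup_tendsto_0_D) auto
    from eventually_happens'[OF _ eventually_conj[OF eventually_ge_at_top[of 1] this]]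
    obtain L where L: "1 \<le> L" and L_ev: "\<forall>\<^sub>F n in sequentially.
        measure (M n) {w \<in> space (M n). ereal L * \<bar>1\<bar> \<le> \<bar>?MX n w\<bar>} < t / 3" by auto
    obtain C where C_ev: "\<forall>\<^sub>F n in sequentially.
        real n powr (4 / nu) * ln (real n) powr ((nu - 2) / nu) / real (p n) \<le> C" using rate by blast
    define Lam where "Lam = L * max L (B powr (2 + nu))"
    have Lam: "Lam \<ge> 0" using L by (simp add: Lam_def)
    define K where "K = 1152 * (Lam * C powr (nu / 2) / cR + Lam\<^sup>2 * (C powr (nu / 2))\<^sup>2)"
    have K: "K \<ge> 0" using Lam cR by (simp add: K_def)
    \<comment> \<open>The first entry is what \<open>deviation_tail_bound\<close> requires; the
      second, since \<open>eps \<ge> 1\<close> gives \<open>eps \<le> eps * eps\<close>, makes the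
      Chebyshev remainder at most \<open>t / 3\<close>.\<close>
    define e0 where "e0 = max (24 * (2 * (1 + Lam) + 3 / cR)) (3 * K / t + 1)"
    show "\<exists>e0. \<forall>eps\<ge>e0. \<forall>\<^sub>F n in sequentially. measure (M n)
       {w \<in> space (M n). ereal eps * \<bar>ereal (?d n)\<bar> \<le> \<bar>ereal (Max (insert 0 (?S n w)))\<bar>} \<le> t"
    proof (intro exI[of _ e0] allI impI)
      fix eps assume "e0 \<le> eps"
      then have eps: "24 * (2 * (1 + Lam) + 3 / cR) \<le> eps" "3 * K / t + 1 \<le> eps" by (auto simp: e0_def)
      have "0 \<le> 3 * K / t" using K t by simp
      then have eps1: "1 \<le> eps" using eps(2) by linarith
      have "eps * 1 \<le> eps * eps" using eps1 by (intro mult_left_mono) auto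
      then have "3 * K / t \<le> eps\<^sup>2" using eps(2) by (simp add: power2_eq_square)
      then have Keps: "K / eps\<^sup>2 \<le> t / 3" using t eps1 by (simp add: field_simps)
      have "\<forall>\<^sub>F n in sequentially. real n \<ge> 12 / t + 2" 
        using filterlim_real_sequentially unfolding filterlim_at_top by (rule spec)
      with L_ev C_ev Rd_ev p_ev show "\<forall>\<^sub>F n in sequentially. measure (M n)
         {w \<in> space (M n). ereal eps * \<bar>ereal (?d n)\<bar> \<le> \<bar>ereal (Max (insert 0 (?S n w)))\<bar>} \<le> t"
      proof eventually_elim
        case (elim n)
        interpret prob_space "M n" by (rule prob)
        let ?m = "real (card (Rd n))"
        have n: "real n > 1" "4 / real n \<le> t / 3"
        proof -
          have "0 \<le> 12 / t" using t by simp
          then show n1: "real n > 1" using elim(5) by linarith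
          have "12 / t \<le> real n" using elim(5) by simp
          then show "4 / real n \<le> t / 3" using t n1 by (simp add: field_simps)
        qed
        have pn: "real (p n) > 0" using elim by simp
        have m: "cR * real (p n) \<le> ?m" using elim by simp
        have m0: "?m > 0" using m cR pn by (meson less_le_trans mult_pos_pos)
        have d: "?d n > 0" using n pn by simp
        \<comment> \<open>The strict inequality makes the complement of \<open>G\<close> exactly the
          event measured by \<open>lesssim_P\<close>. Conditional expectations being
          \<open>F\<close>-measurable, \<open>G\<close> is an event of \<open>F\<close>.\<close>
        define G where "G = {w \<in> space (M n). \<forall>x\<in>{..<n} \<times> {..<p n}. ?cm n (fst x) (snd x) w < ennreal L}"
        have G: "G \<in> sets (F n)"
          unfolding G_def spaceF[symmetric] by (rule sets.sets_Collect_finite_All) auto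
        have GM: "G \<in> sets (M n)" using G subF by (auto simp: subalgebra_def)
        have Gc: "space (M n) - G = {w \<in> space (M n). ereal L * \<bar>1\<bar> \<le> \<bar>?MX n w\<bar>}"
        proof -
          have eq: "(ereal L * \<bar>1\<bar> \<le> \<bar>?MX n w\<bar>) \<longleftrightarrow> (\<exists>x\<in>{..<n} \<times> {..<p n}. ennreal L \<le> ?cm n (fst x) (snd x) w)" for w
          proof -
            let ?Q = "{enn2ereal (?cm n i l w) | i l. i < n \<and> l < p n}"
            have fin: "finite ?Q" by (rule finite_image_set2) auto
            have "0 \<le> ?MX n w" using fin by (intro Max_ge) auto
            then have "(ereal L * \<bar>1\<bar> \<le> \<bar>?MX n w\<bar>) \<longleftrightarrow> (ereal L \<le> Max (insert 0 ?Q))" by simp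
            also have "\<dots> \<longleftrightarrow> (\<exists>q\<in>insert 0 ?Q. ereal L \<le> q)" using fin by (intro Max_ge_iff) auto
            also have "\<dots> \<longleftrightarrow> (\<exists>i<n. \<exists>l<p n. ereal L \<le> enn2ereal (?cm n i l w))"
              using L by auto
            also have "\<dots> \<longleftrightarrow> (\<exists>i<n. \<exists>l<p n. ennreal L \<le> ?cm n i l w)"
              using L by (simp add: less_eq_ennreal.rep_eq)
            finally show ?thesis by auto
          qed
          have "space (M n) - G = {w \<in> space (M n). \<exists>x\<in>{..<n} \<times> {..<p n}. ennreal L \<le> ?cm n (fst x) (snd x) w}"
          proof -
            have "S - {w \<in> S. \<forall>x\<in>X. f x w < c} = {w \<in> S. \<exists>x\<in>X. c \<le> f x w}"
              for S :: "'w set" and X :: "(nat \<times> nat) set" and f and c :: ennreal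
              by (auto simp: not_less)
            then show ?thesis unfolding G_def .
          qed
          then show ?thesis by (simp only: eq)
        qed
        have U_mom: "AE w in M n. w \<in> G \<longrightarrow> ?cm n i l w \<le> ennreal L" if "i < n" "l < p n" for i l
          using that by (intro AE_I2) (force simp: G_def intro: less_imp_le)
        define y where "y = eps * ?d n * ?m / 24"
        have y: "y > 0" unfolding y_def using eps1 d m0 by simp
        have L0: "0 \<le> L" using L by simp
        obtain E where E: "E \<in> sets (M n)"
            "measure (M n) E \<le> 2 * (real n)\<^sup>2 * deviation_tail Lam nu ?m (?d n) y"
            "\<And>w i j. w \<in> space (M n) - E \<Longrightarrow> w \<in> G \<Longrightarrow> i < n \<Longrightarrow> j < n \<Longrightarrow>
               \<bar>pmd (Rd n) n (\<lambda>i l. H n w i l + u n i l w) i j - pmd (Rd n) n (H n w) i j\<bar> \<le> 12 * y / ?m"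
        proof -
          have "\<exists>E\<in>sets (M n). measure (M n) E \<le> 2 * (real n)\<^sup>2 * deviation_tail Lam nu ?m (?d n) y \<and>
            (\<forall>w\<in>space (M n) - E. w \<in> G \<longrightarrow> (\<forall>i<n. \<forall>j<n.
               \<bar>pmd (Rd n) n (\<lambda>i l. H n w i l + u n i l w) i j - pmd (Rd n) n (H n w) i j\<bar> \<le> 12 * y / ?m))"
            unfolding Lam_def
            by (rule prob_pmd_perturbation[where H = "H n" and u = "u n" and p = "p n",
                  OF cif Rd_sub _ _ HM HB _ G L0 nu_pos U_mom u_mean0 d y])
              (use HF Rd_sub m0 B in \<open>auto simp: subset_iff\<close>)
          then show thesis using that by blast
        qed
        have "measure (M n) E \<le> 4 / real n + K / eps\<^sup>2"
          using E(2) deviation_tail_bound[OF n(1) pn nu_pos cR m elim(2) Lam eps(1)] unfolding K_def y_def by linarith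
        then have mE: "measure (M n) E \<le> t / 3 + t / 3" using n(2) Keps by linarith
        \<comment> \<open>Monotonicity asks for measurability of the covering set alone. Off that
          set the maximum is at most half the threshold.\<close>
        have "measure (M n) {w \<in> space (M n). ereal eps * \<bar>ereal (?d n)\<bar> \<le> \<bar>ereal (Max (insert 0 (?S n w)))\<bar>}
           \<le> measure (M n) ((space (M n) - G) \<union> E)"
        proof (rule finite_measure_mono, rule subsetI, rule ccontr)
          fix w assume "w \<in> {w \<in> space (M n). ereal eps * \<bar>ereal (?d n)\<bar> \<le> \<bar>ereal (Max (insert 0 (?S n w)))\<bar>}"
            and w: "w \<notin> (space (M n) - G) \<union> E"
          then have w': "w \<in> space (M n)" and big: "eps * ?d n \<le> \<bar>Max (insert 0 (?S n w))\<bar>"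
            using d by auto
          have "\<bar>Max (insert 0 (?S n w))\<bar> \<le> 12 * y / ?m"
          proof (rule abs_Max_insert_0_le)
            show "finite (?S n w)" by (rule finite_image_set2) auto
            show "0 \<le> 12 * y / ?m" using y by (intro divide_nonneg_nonneg) auto
            fix s assume "s \<in> ?S n w"
            then show "s \<le> 12 * y / ?m" using E(3)[of w] w w' by (auto simp: X_def H_def)
          qed
          also have "\<dots> = eps * ?d n / 2" using m0 by (simp add: y_def)
          finally have "eps * ?d n \<le> eps * ?d n / 2" using big by linarith
          moreover have "eps * ?d n > 0" using eps1 d by simp
          ultimately show False by linarith
        qed (use E(1) GM in auto)
        also have "\<dots> \<le> measure (M n) (space (M n) - G) + measure (M n) E"
          by (rule measure_Un_le) (use E(1) GM in auto)
        also have "\<dots> \<le> t" using elim(1) mE unfolding Gc by linarith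
        finally show ?case .
      qed
    qed
  qed

  \<comment> \<open>Upper comparison with the latent distance\<close>
  have main_b: "lesssim_P M
       (\<lambda>n w. ereal (Max (insert 0 {pmd (Rd n) n (H n w) i j / norm (alpha n i w - alpha n j w)
                                      | i j. i < n \<and> j < n \<and> alpha n i w \<noteq> alpha n j w})))
       (\<lambda>n w. 1)" (is "lesssim_P M (\<lambda>n w. ereal (Max (insert 0 (?S n w)))) _")
  proof (rule lesssim_PI)
    fix t :: real assume t: "t > 0"
    let ?C = "real CARD('r) * B\<^sup>2"
    show "\<exists>e0. \<forall>eps\<ge>e0. \<forall>\<^sub>F n in sequentially. measure (M n)
       {w \<in> space (M n). ereal eps * \<bar>1\<bar> \<le> \<bar>ereal (Max (insert 0 (?S n w)))\<bar>} \<le> t"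
    \<comment> \<open>The Lipschitz bound holds for every outcome, so beyond the constant the event
      is empty for every \<open>n\<close>.\<close>
    proof (intro exI[of _ "?C + 1"] allI impI always_eventually)
      fix eps n assume eps: "?C + 1 \<le> eps"
      have "\<bar>Max (insert 0 (?S n w))\<bar> \<le> ?C" if w: "w \<in> space (M n)" for w
      proof (rule abs_Max_insert_0_le)
        show "finite (?S n w)"
          by (rule finite_subset[of _ "(\<lambda>(i,j). pmd (Rd n) n (H n w) i j / norm (alpha n i w - alpha n j w)) ` ({..<n} \<times> {..<n})"]) auto
        fix s assume "s \<in> ?S n w"
        then obtain i j where s: "s = pmd (Rd n) n (H n w) i j / norm (alpha n i w - alpha n j w)"
          "alpha n i w \<noteq> alpha n j w" by blast
        then show "s \<le> ?C"
          using pmd_upper[OF B C2[OF w], of "Rd n" n "\<lambda>l. l" "\<lambda>i. alpha n i w" i j]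
          by (simp add: H_def divide_le_eq)
      qed simp
      then have empty: "{w \<in> space (M n). ereal eps * \<bar>1\<bar> \<le> \<bar>ereal (Max (insert 0 (?S n w)))\<bar>} = {}"
        using eps by (auto simp: not_le) force
      show "measure (M n) {w \<in> space (M n). ereal eps * \<bar>1\<bar> \<le> \<bar>ereal (Max (insert 0 (?S n w)))\<bar>} \<le> t"
        unfolding empty using t by simp
    qed
  qed

  \<comment> \<open>Lower comparison with the latent distance\<close>
  have main_c: "lesssim_P M
       (\<lambda>n w. 1)
       (\<lambda>n w. Inf {ereal (pmd (Rd n) n (H n w) i j / norm (alpha n i w - alpha n j w))
                    | i j. i < n \<and> j < n \<and> alpha n i w \<noteq> alpha n j w})" (is "lesssim_P M _ (\<lambda>n w. Inf (?S n w))")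
  proof (rule lesssim_PI)
    fix t :: real assume t: "t > 0"
    obtain c2 where c2: "c2 > 0" and lim2: "(\<lambda>n. measure (M n) {w \<in> space (M n).
            \<forall>i<n. smin (gram (Rd n) (\<lambda>l. eta n l w) (alpha n i w)) \<ge> c2}) \<longlonglongrightarrow> 1" using cond_ii by blast
    obtain z where "z \<in> interior A" using A_int by blast
    then obtain \<rho> where \<rho>: "\<rho> > 0" "ball z \<rho> \<subseteq> A" unfolding mem_interior by blast
    obtain bd where bd: "bd > 0" "\<And>x. x \<in> A \<Longrightarrow> norm x \<le> bd"
      using compact_imp_bounded[OF A_compact] unfolding bounded_pos by blast
    obtain ep h c1 where near: "ep > 0" "h > 0" "c1 > 0"
      "\<And>R n (et :: nat \<Rightarrow> real^'r \<Rightarrow> real) al i j.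
       finite R \<Longrightarrow> card R > 0 \<Longrightarrow> (\<And>l. l \<in> R \<Longrightarrow> bounded_C2 B (et l)) \<Longrightarrow> al i \<in> A \<Longrightarrow>
       c2 \<le> smin (gram R et (al i)) \<Longrightarrow>
       (\<And>x. x \<in> A \<Longrightarrow> \<exists>k<n. k \<noteq> i \<and> k \<noteq> j \<and> dist x (al k) < h) \<Longrightarrow>
       norm (al i - al j) \<le> ep \<Longrightarrow>
       c1 * norm (al i - al j) \<le> pmd R n (\<lambda>i l. et l (al i)) i j"
      apply (rule pmd_near_lower[OF A_convex \<rho>(2,1) bd(2,1) B c2], assumption)
      subgoal premises prems by (rule prems(1)[OF prems(2-5)])
      done
    obtain N q :: real where q: "0 < q" "q \<le> 1" and cover:
      "\<And>(M :: 'w measure) n al. prob_space M \<Longrightarrow> (\<And>i. i < n \<Longrightarrow> distributed M lborel (al i) dens) \<Longrightarrow>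
       prob_space.indep_vars M (\<lambda>_. borel) al {..<n} \<Longrightarrow>
       \<exists>E\<in>sets M. measure M E \<le> N * (real n)\<^sup>2 * (1 - q) ^ (n - 2) \<and>
         (\<forall>w\<in>space M - E. \<forall>x\<in>A. \<forall>i<n. \<forall>j<n. \<exists>k<n. k \<noteq> i \<and> k \<noteq> j \<and> dist x (al k w) < h)"
      apply (rule prob_uncovered[where 'w = 'w, OF A_compact A_convex A_int near(2) cd], assumption)
      subgoal premises prems by (rule prems(1)[OF prems(2,3,5)])
      done
    let ?Ei = "\<lambda>D n. {w \<in> space (M n). \<exists>i<n. \<exists>j<n. pmd (Rd n) n (H n w) i j < D \<and> norm (alpha n i w - alpha n j w) > ep}"
    have "\<forall>\<^sub>F D in at_right 0. \<forall>\<^sub>F n in sequentially. measure (M n) (?Ei D n) < t / 3"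
      by (rule Limsup_tendsto_0_D[OF cond_i[OF near(1)]]) (use t in simp)
    from eventually_happens'[OF trivial_limit_at_right_real eventually_conj[OF eventually_at_right_less this]]
    obtain D where D: "D > 0" and D_ev: "\<forall>\<^sub>F n in sequentially. measure (M n) (?Ei D n) < t / 3" by auto
    \<comment> \<open>Near pairs contribute \<open>c1\<close>. Far pairs have pseudo-max distance at
      least \<open>D\<close> off the bad event and latent distance at most
      \<open>2 * bd\<close>.\<close>
    define c3 where "c3 = min c1 (D / (2 * bd))"
    have c3: "c3 > 0" using near(3) D bd by (simp add: c3_def)
    show "\<exists>e0. \<forall>eps\<ge>e0. \<forall>\<^sub>F n in sequentially. measure (M n)
       {w \<in> space (M n). ereal eps * \<bar>Inf (?S n w)\<bar> \<le> \<bar>1\<bar>} \<le> t"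
    \<comment> \<open>Off the bad events the infimum is at least \<open>c3\<close>, also when there
      is no pair and it is infinite; then \<open>eps * c3 \<ge> 2\<close> contradicts the
      event.\<close>
    proof (intro exI[of _ "2 / c3"] allI impI)
      fix eps assume eps: "2 / c3 \<le> eps"
      have "0 < 2 / c3" using c3 by simp
      then have eps0: "0 < eps" using eps by (rule less_le_trans)
      \<comment> \<open>The \<open>1/2\<close> matters for large \<open>t\<close>: it keeps the
        probability positive, and a set of positive \<open>measure\<close> is measurable. This is
        how \<open>G\<close> below becomes an event.\<close>
      have "max (1 - t / 3) (1/2) < 1" using t by simp
      note lim2_ev = order_tendstoD(1)[OF lim2 this]
      have cov_ev: "\<forall>\<^sub>F n in sequentially. N * (real n)\<^sup>2 * (1 - q) ^ (n - 2) < t / 3"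
        by (rule order_tendstoD(2)[OF square_times_geometric_LIMSEQ[OF q]]) (use t in simp)
      from D_ev lim2_ev cov_ev Rd_ev p_ev show "\<forall>\<^sub>F n in sequentially. measure (M n)
         {w \<in> space (M n). ereal eps * \<bar>Inf (?S n w)\<bar> \<le> \<bar>1\<bar>} \<le> t"
      proof eventually_elim
        case (elim n)
        interpret prob_space "M n" by (rule prob)
        have m0: "card (Rd n) > 0"
          using elim(4,5) cR by (metis mult_pos_pos of_nat_0_less_iff less_le_trans)
        define G where "G = {w \<in> space (M n). \<forall>i<n. smin (gram (Rd n) (\<lambda>l. eta n l w) (alpha n i w)) \<ge> c2}"
        have Gpr: "measure (M n) G > 1 - t / 3" "measure (M n) G > 1/2" using elim(2) by (auto simp: G_def)
        then have GM: "G \<in> sets (M n)" using measure_notin_sets by force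
        then have Gc: "measure (M n) (space (M n) - G) < t / 3" using Gpr by (simp add: prob_compl)
        obtain E where E: "E \<in> sets (M n)" "measure (M n) E \<le> N * (real n)\<^sup>2 * (1 - q) ^ (n - 2)"
          "\<And>w x i j. w \<in> space (M n) - E \<Longrightarrow> x \<in> A \<Longrightarrow> i < n \<Longrightarrow> j < n \<Longrightarrow>
             \<exists>k<n. k \<noteq> i \<and> k \<noteq> j \<and> dist x (alpha n k w) < h"
          using cover[OF prob alpha_distr alpha_indep, of n] by blast
        \<comment> \<open>Subadditivity needs measurability, which the bound \<open>t / 3\<close>
          does not give: a non-measurable set also has \<open>measure\<close> 0.\<close>
        have Ei: "?Ei D n \<in> sets (M n)"
        proof -
          have "?Ei D n = (\<Union>i\<in>{..<n}. \<Union>j\<in>{..<n}. {w \<in> space (M n). pmd (Rd n) n (H n w) i j < D}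
              \<inter> {w \<in> space (M n). norm (alpha n i w - alpha n j w) > ep})" by auto
          also have "\<dots> \<in> sets (M n)"
          proof (intro sets.finite_UN sets.Int)
            fix i j assume "i \<in> {..<n}" "j \<in> {..<n}"
            then have ij: "i < n" "j < n" by auto
            show "{w \<in> space (M n). pmd (Rd n) n (H n w) i j < D} \<in> sets (M n)"
              by (rule pmd_less_sets[OF HM ij D])
            note [measurable] = alpha_meas[OF ij(1)] alpha_meas[OF ij(2)]
            show "{w \<in> space (M n). norm (alpha n i w - alpha n j w) > ep} \<in> sets (M n)" by measurable
          qed auto
          finally show ?thesis .
        qed
        \<comment> \<open>Sample points lie in \<open>A\<close> only almost surely; the exceptional
          outcomes form a null set, removed because the local bound and the diameter bound need
          points of \<open>A\<close>.\<close>
        define Z where "Z = (\<Union>i\<in>{..<n}. {w \<in> space (M n). alpha n i w \<notin> A})"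
        have Z_null: "{w \<in> space (M n). alpha n i w \<notin> A} \<in> null_sets (M n)" if "i < n" for i
        proof -
          have s: "{w \<in> space (M n). alpha n i w \<in> A} \<in> sets (M n)"
            using measurable_sets[OF alpha_meas[OF that] A_borel] by (simp add: vimage_def Int_def conj_commute)
          have e: "{w \<in> space (M n). alpha n i w \<notin> A} = space (M n) - {w \<in> space (M n). alpha n i w \<in> A}" by auto
          show ?thesis unfolding e using s alpha_A[OF that]
            by (intro null_setsI) (auto simp: emeasure_eq_measure prob_compl)
        qed
        have Z: "Z \<in> null_sets (M n)" unfolding Z_def using Z_null by (intro null_sets_UN') auto
        then have Z': "Z \<in> sets (M n)" "measure (M n) Z = 0" by (auto simp: null_sets_def measure_def)
        have Gc_sets: "space (M n) - G \<in> sets (M n)" using GM by (rule sets.compl_sets)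
        have un_sets: "?Ei D n \<union> (space (M n) - G) \<in> sets (M n)" "E \<union> Z \<in> sets (M n)"
          by (intro sets.Un Ei Gc_sets E(1) Z'(1))+
        have "measure (M n) {w \<in> space (M n). ereal eps * \<bar>Inf (?S n w)\<bar> \<le> \<bar>1\<bar>}
           \<le> measure (M n) ((?Ei D n \<union> (space (M n) - G)) \<union> (E \<union> Z))"
        proof (rule finite_measure_mono, rule subsetI, rule ccontr)
          fix w assume w0: "w \<in> {w \<in> space (M n). ereal eps * \<bar>Inf (?S n w)\<bar> \<le> \<bar>1\<bar>}"
            and w: "w \<notin> (?Ei D n \<union> (space (M n) - G)) \<union> (E \<union> Z)"
          then have ws: "w \<in> space (M n)" and le1: "ereal eps * \<bar>Inf (?S n w)\<bar> \<le> 1" by auto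
          have wA: "alpha n i w \<in> A" if "i < n" for i using w ws that by (auto simp: Z_def)
          have "ereal c3 \<le> Inf (?S n w)"
          proof (rule Inf_greatest, clarify)
            fix i j assume ij: "i < n" "j < n" "alpha n i w \<noteq> alpha n j w"
            let ?v = "norm (alpha n i w - alpha n j w)"
            have v: "?v > 0" using ij by simp
            have "c3 * ?v \<le> pmd (Rd n) n (H n w) i j"
            proof (cases "?v \<le> ep")
              case True
              have "c1 * ?v \<le> pmd (Rd n) n (\<lambda>i l. eta n l w (alpha n i w)) i j"
                by (rule near(4)[OF Rd_fin m0 C2[OF ws] wA[OF ij(1)] _ _ True])
                  (use w ws ij E(3)[of w] in \<open>auto simp: G_def\<close>)
              moreover have "c3 * ?v \<le> c1 * ?v" using v by (intro mult_right_mono) (auto simp: c3_def)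
              ultimately show ?thesis by (simp add: H_def)
            next
              case False
              have "w \<notin> ?Ei D n" using w by blast
              with ws False ij(1,2) have "D \<le> pmd (Rd n) n (H n w) i j" by (force simp: not_less not_le)
              moreover have vle: "?v \<le> 2 * bd"
                using norm_triangle_ineq4[of "alpha n i w" "alpha n j w"] bd(2)[OF wA[OF ij(1)]] bd(2)[OF wA[OF ij(2)]] by linarith
              have "c3 * ?v \<le> (D / (2 * bd)) * (2 * bd)"
              proof (rule mult_mono)
                show "0 \<le> D / (2 * bd)" using D bd(1) by simp
              qed (use v vle in \<open>auto simp: c3_def\<close>)
              then have "c3 * ?v \<le> D" using bd by simp
              ultimately show ?thesis by linarith
            qed
            then show "ereal c3 \<le> ereal (pmd (Rd n) n (H n w) i j / ?v)" using v by (simp add: le_divide_eq)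
          qed
          also have "\<dots> \<le> \<bar>Inf (?S n w)\<bar>" by (rule ereal_le_abs)
          finally have "ereal eps * ereal c3 \<le> ereal eps * \<bar>Inf (?S n w)\<bar>"
            using eps0 by (intro ereal_mult_left_mono) auto
          with le1 have "ereal eps * ereal c3 \<le> 1" by (rule order_trans[rotated])
          then have "eps * c3 \<le> 1" by (simp add: one_ereal_def)
          moreover have "2 \<le> eps * c3" using eps c3 by (simp add: divide_le_eq)
          ultimately show False by linarith
        qed (rule sets.Un[OF un_sets])
        also have "\<dots> \<le> measure (M n) (?Ei D n \<union> (space (M n) - G)) + measure (M n) (E \<union> Z)"
          by (rule measure_Un_le[OF un_sets])
        also have "\<dots> \<le> (measure (M n) (?Ei D n) + measure (M n) (space (M n) - G)) + (measure (M n) E + measure (M n) Z)"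
          by (intro add_mono measure_Un_le Ei Gc_sets E(1) Z'(1))
        also have "\<dots> \<le> t" using elim(1,3) Gc E(2) Z'(2) by linarith
        finally show ?case .
      qed
    qed
  qed

  from main_a main_b main_c show ?thesis by blast
qed

end
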